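(* Let $\Gamma$ be a countable orderable group. Then the space of orderings $\mathcal{O}(\Gamma)$ is either finite or contains a homeomorphic copy of the Cantor set.
   Context: An ordering on a group $\Gamma$ is a total order relation $\preceq$ on $\Gamma$ that is left-invariant ($g \preceq h$ implies $fg \preceq fh$ for all $f,g,h \in \Gamma$); $\Gamma$ is orderable if it admits an ordering. $\mathcal{O}(\Gamma)$ denotes the set of all orderings on $\Gamma$, endowed with the topology having as sub-basis the sets $U_{f,g} = \{\preceq \,:\, f \prec g\}$, $f,g \in \Gamma$, $f\neq g$. *)

theory Defs
  imports "HOL-Algebra.Group" "HOL-Analysis.Analysis"
begin

text \<open>An ordering is encoded as the set of pairs \<open>(g, h)\<close> with \<open>g \<preceq> h\<close>;
  \<^const>\<open>linear_order_on\<close> also makes it a subset of \<open>carrier G \<times> carrier G\<close>, so distinct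
  elements of \<open>orderings G\<close> are distinct orderings of the group.\<close>

definition left_invariant :: "('a, 'b) monoid_scheme \<Rightarrow> 'a rel \<Rightarrow> bool" where
  "left_invariant G r \<longleftrightarrow>
     (\<forall>f\<in>carrier G. \<forall>g\<in>carrier G. \<forall>h\<in>carrier G.
        (g, h) \<in> r \<longrightarrow> (f \<otimes>\<^bsub>G\<^esub> g, f \<otimes>\<^bsub>G\<^esub> h) \<in> r)"

definition orderings :: "('a, 'b) monoid_scheme \<Rightarrow> 'a rel set" where
  "orderings G = {r. linear_order_on (carrier G) r \<and> left_invariant G r}"

definition orderable :: "('a, 'b) monoid_scheme \<Rightarrow> bool" where
  "orderable G \<longleftrightarrow> orderings G \<noteq> {}"

definition ordering_subbasic :: "('a, 'b) monoid_scheme \<Rightarrow> 'a \<Rightarrow> 'a \<Rightarrow> 'a rel set" where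
  "ordering_subbasic G f g = {r \<in> orderings G. (f, g) \<in> r \<and> f \<noteq> g}"

text \<open>The whole space is added to the generating sets because \<^const>\<open>topology_generated_by\<close>
  does not close under the empty intersection; this only matters for the trivial group,
  which has no sets \<open>ordering_subbasic G f g\<close> with \<open>f \<noteq> g\<close>.\<close>

definition space_of_orderings :: "('a, 'b) monoid_scheme \<Rightarrow> 'a rel topology" where
  "space_of_orderings G =
     topology_generated_by
       (insert (orderings G)
          {ordering_subbasic G f g | f g. f \<in> carrier G \<and> g \<in> carrier G \<and> f \<noteq> g})"

lemma topspace_space_of_orderings [simp]:
  "topspace (space_of_orderings G) = orderings G"
  by (auto simp: space_of_orderings_def topology_generated_by_topspace ordering_subbasic_def)

text \<open>The middle-thirds Cantor set: passing from each stage to the next one removes the open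
  middle third of every constituent interval.\<close>

primrec cantor_stage :: "nat \<Rightarrow> real set" where
  "cantor_stage 0 = {0..1}"
| "cantor_stage (Suc n) = (\<lambda>x. x / 3) ` cantor_stage n \<union> (\<lambda>x. 2 / 3 + x / 3) ` cantor_stage n"

definition cantor_set :: "real set" where
  "cantor_set = (\<Inter>n. cantor_stage n)"

end

theory Submission
  imports Defs "HOL-Algebra.Coset"
begin

text \<open>
  If there are uncountably many orderings, a Cantor scheme of uncountable sets of orderings yields a
  Cantor set, so it remains to show that countably many orderings are only finitely many (Linnell).
  In the countable case, the group acts by conjugation on the compact space of orderings, and Baire's
  theorem in a minimal closed invariant set provides an ordering \<open>r\<close> with finite orbit, so that some
  power of every element preserves \<open>r\<close> from the right. An ordering with infinitely many convex
  subgroups can be flipped independently on infinitely many levels, so \<open>r\<close> has only finitely many of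
  them, and one argues by induction along this chain. Each jump \<open>A \<subset> B\<close> is archimedean and
  hence, by Hoelder's argument, the kernel of a real homomorphism of \<open>B\<close>; it has rank one, since
  otherwise there are uncountably many orderings. Now \<open>B\<close> acts on the top jump of \<open>A\<close> by real factors.
  If all factors are positive, then \<open>B\<close> has uncountably many orderings, coming from affine
  actions on the line or from pairs of homomorphisms. If some factor is negative, then \<open>A\<close> is
  convex in every ordering of \<open>B\<close> by Tararin's argument, so \<open>B\<close> inherits finiteness from \<open>A\<close>.
\<close>

section \<open>Left-ordered groups\<close>

text \<open>In a left-ordered group a maximal proper convex subgroup need not be normal, and the
  jump above it need not be archimedean. The finite orbit removes this obstacle: right
  multiplication by a suitable power of \<open>g\<close> preserves \<open>r\<close>, so the elements
  lying between powers of \<open>g\<close> form a subgroup. The induction follows the convex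
  subgroups of this one \<open>r\<close>, but its invariant has to speak about all orderings:
  conjugation by an element of \<open>B\<close> carries \<open>Restr r A\<close> to another ordering
  of \<open>A\<close>, and a real factor exists because the homomorphism of the top jump of
  \<open>A\<close> is compatible, up to sign, with both. Rank one leaves a single choice of sign
  outside \<open>A\<close>, so the orderings of \<open>B\<close> inject into pairs of an ordering of
  \<open>A\<close> and a bit. Countability descends to each convex subgroup because its orderings
  can be glued to \<open>r\<close> outside it.\<close>

lemma orderings_iff:
  "r \<in> orderings G \<longleftrightarrow> r \<subseteq> carrier G \<times> carrier G \<and> (\<forall>x\<in>carrier G. (x, x) \<in> r) \<and>
     (\<forall>x\<in>carrier G. \<forall>y\<in>carrier G. \<forall>z\<in>carrier G. (x, y) \<in> r \<longrightarrow> (y, z) \<in> r \<longrightarrow> (x, z) \<in> r) \<and>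
     (\<forall>x\<in>carrier G. \<forall>y\<in>carrier G. (x, y) \<in> r \<longrightarrow> (y, x) \<in> r \<longrightarrow> x = y) \<and>
     (\<forall>x\<in>carrier G. \<forall>y\<in>carrier G. (x, y) \<in> r \<or> (y, x) \<in> r) \<and>
     (\<forall>f\<in>carrier G. \<forall>g\<in>carrier G. \<forall>h\<in>carrier G.
        (g, h) \<in> r \<longrightarrow> (f \<otimes>\<^bsub>G\<^esub> g, f \<otimes>\<^bsub>G\<^esub> h) \<in> r)"
  (is "_ \<longleftrightarrow> ?R")
proof
  assume "r \<in> orderings G"
  then show ?R
    unfolding orderings_def left_invariant_def linear_order_on_def partial_order_on_def
      preorder_on_def refl_on_def antisym_def total_on_def
    by (simp, intro conjI) (blast elim: transE, metis)
next
  assume R: ?R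
  then have sub: "r \<subseteq> carrier G \<times> carrier G" by simp
  then have c: "x \<in> carrier G \<and> y \<in> carrier G" if "(x, y) \<in> r" for x y using that by blast
  have "trans r"
  proof (rule transI)
    fix x y z assume "(x, y) \<in> r" "(y, z) \<in> r"
    with c[of x y] c[of y z] show "(x, z) \<in> r" using R by blast
  qed
  moreover have "antisym r"
  proof (rule antisymI)
    fix x y assume "(x, y) \<in> r" "(y, x) \<in> r"
    with c[of x y] show "x = y" using R by blast
  qed
  moreover have "total_on (carrier G) r" unfolding total_on_def using R by blast
  moreover have "refl_on (carrier G) r" unfolding refl_on_def using R by blast
  moreover have "left_invariant G r" unfolding left_invariant_def using R by blast
  ultimately show "r \<in> orderings G" using sub
    by (simp add: orderings_def linear_order_on_def partial_order_on_def preorder_on_def)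
qed

lemma orderingsD:
  assumes "r \<in> orderings G"
  shows "(x, y) \<in> r \<Longrightarrow> x \<in> carrier G" "(x, y) \<in> r \<Longrightarrow> y \<in> carrier G"
    and "x \<in> carrier G \<Longrightarrow> (x, x) \<in> r"
    and "(x, y) \<in> r \<Longrightarrow> (y, z) \<in> r \<Longrightarrow> (x, z) \<in> r"
    and "(x, y) \<in> r \<Longrightarrow> (y, x) \<in> r \<Longrightarrow> x = y"
    and "x \<in> carrier G \<Longrightarrow> y \<in> carrier G \<Longrightarrow> (x, y) \<in> r \<or> (y, x) \<in> r"
    and "(x, y) \<in> r \<Longrightarrow> z \<in> carrier G \<Longrightarrow> (z \<otimes>\<^bsub>G\<^esub> x, z \<otimes>\<^bsub>G\<^esub> y) \<in> r"
proof -
  have c: "x \<in> carrier G" "y \<in> carrier G" if "(x, y) \<in> r" for x y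
    using assms that unfolding orderings_iff by blast+
  show "(x, y) \<in> r \<Longrightarrow> x \<in> carrier G" "(x, y) \<in> r \<Longrightarrow> y \<in> carrier G" using c by blast+
  show "x \<in> carrier G \<Longrightarrow> (x, x) \<in> r" using assms unfolding orderings_iff by blast
  show "(x, y) \<in> r \<Longrightarrow> (y, z) \<in> r \<Longrightarrow> (x, z) \<in> r"
    using assms c unfolding orderings_iff by meson
  show "(x, y) \<in> r \<Longrightarrow> (y, x) \<in> r \<Longrightarrow> x = y" using assms c unfolding orderings_iff by meson
  show "x \<in> carrier G \<Longrightarrow> y \<in> carrier G \<Longrightarrow> (x, y) \<in> r \<or> (y, x) \<in> r"
    using assms unfolding orderings_iff by meson
  show "(x, y) \<in> r \<Longrightarrow> z \<in> carrier G \<Longrightarrow> (z \<otimes>\<^bsub>G\<^esub> x, z \<otimes>\<^bsub>G\<^esub> y) \<in> r"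
    using assms c unfolding orderings_iff by meson
qed

text \<open>Every axiom of a left order involves at most three pairs, so it passes to pointwise
  limits. This serves both for compactness of the space of orderings and for the branches of the
  Cantor scheme.\<close>

lemma orderings_limit:
  assumes sub: "r \<subseteq> carrier G \<times> carrier G"
    and lim: "\<And>F. finite F \<Longrightarrow> \<exists>s\<in>orderings G. \<forall>p\<in>F. p \<in> r \<longleftrightarrow> p \<in> s"
  shows "r \<in> orderings G"
proof -
  have lim3: "\<exists>s\<in>orderings G. (a \<in> r \<longleftrightarrow> a \<in> s) \<and> (b \<in> r \<longleftrightarrow> b \<in> s) \<and> (c \<in> r \<longleftrightarrow> c \<in> s)" for a b c
    using lim[of "{a, b, c}"] by auto
  show ?thesis unfolding orderings_iff
  proof (intro conjI ballI impI sub)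
    fix x assume "x \<in> carrier G"
    then show "(x, x) \<in> r" using lim3[of "(x, x)"] orderingsD(3) by metis
  next
    fix x y z assume "x \<in> carrier G" "y \<in> carrier G" "z \<in> carrier G" "(x, y) \<in> r" "(y, z) \<in> r"
    then show "(x, z) \<in> r"
      using lim3[of "(x, y)" "(y, z)" "(x, z)"] orderingsD(4)[of _ G] by metis
  next
    fix x y assume "x \<in> carrier G" "y \<in> carrier G" "(x, y) \<in> r" "(y, x) \<in> r"
    then show "x = y" using lim3[of "(x, y)" "(y, x)"] orderingsD(5)[of _ G] by metis
  next
    fix x y assume "x \<in> carrier G" "y \<in> carrier G"
    then show "(x, y) \<in> r \<or> (y, x) \<in> r"
      using lim3[of "(x, y)" "(y, x)"] orderingsD(6)[of _ G] by metis
  next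
    fix f x y assume "f \<in> carrier G" "x \<in> carrier G" "y \<in> carrier G" "(x, y) \<in> r"
    then show "(f \<otimes>\<^bsub>G\<^esub> x, f \<otimes>\<^bsub>G\<^esub> y) \<in> r"
      using lim3[of "(x, y)" "(f \<otimes>\<^bsub>G\<^esub> x, f \<otimes>\<^bsub>G\<^esub> y)"] orderingsD(7)[of _ G] by metis
  qed
qed

lemma (in group) mult_inv_cancel [simp]:
  "\<lbrakk>x \<in> carrier G; y \<in> carrier G\<rbrakk> \<Longrightarrow> x \<otimes> (inv x \<otimes> y) = y"
  "\<lbrakk>x \<in> carrier G; y \<in> carrier G\<rbrakk> \<Longrightarrow> inv x \<otimes> (x \<otimes> y) = y"
  by (simp_all flip: m_assoc)

locale left_ordered_group = group G for G (structure) +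
  fixes r
  assumes ord: "r \<in> orderings G"
begin

abbreviation lt (infix "\<sqsubset>" 50) where "x \<sqsubset> y \<equiv> (x, y) \<in> r \<and> x \<noteq> y"

lemmas carrierD = orderingsD(1,2)[OF ord]
  and refl [simp] = orderingsD(3)[OF ord]
  and le_trans [trans] = orderingsD(4)[OF ord]
  and antisym = orderingsD(5)[OF ord]
  and total = orderingsD(6)[OF ord]
  and mult_le = orderingsD(7)[OF ord]

lemma not_le: "x \<in> carrier G \<Longrightarrow> y \<in> carrier G \<Longrightarrow> (x, y) \<notin> r \<longleftrightarrow> y \<sqsubset> x"
  using total antisym refl by blast

lemma le_lt_trans [trans]: "(x, y) \<in> r \<Longrightarrow> y \<sqsubset> z \<Longrightarrow> x \<sqsubset> z"
  using le_trans antisym by blast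

lemma lt_le_trans [trans]: "x \<sqsubset> y \<Longrightarrow> (y, z) \<in> r \<Longrightarrow> x \<sqsubset> z"
  using le_trans antisym by blast

lemma mult_le_iff:
  assumes "x \<in> carrier G" "y \<in> carrier G" "z \<in> carrier G"
  shows "(z \<otimes> x, z \<otimes> y) \<in> r \<longleftrightarrow> (x, y) \<in> r"
  using mult_le[of x y z] mult_le[of "z \<otimes> x" "z \<otimes> y" "inv z"] assms by auto

lemma le_iff: "x \<in> carrier G \<Longrightarrow> y \<in> carrier G \<Longrightarrow> (x, y) \<in> r \<longleftrightarrow> (\<one>, inv x \<otimes> y) \<in> r"
  using mult_le_iff[of "\<one>" "inv x \<otimes> y" x] by simp

lemma inv_le: "x \<in> carrier G \<Longrightarrow> (inv x, \<one>) \<in> r \<longleftrightarrow> (\<one>, x) \<in> r"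
  using mult_le_iff[of "inv x" "\<one>" x] by simp

lemma le_inv: "x \<in> carrier G \<Longrightarrow> (\<one>, inv x) \<in> r \<longleftrightarrow> (x, \<one>) \<in> r"
  using mult_le_iff[of "\<one>" "inv x" x] by simp

lemma mult_ge: "(\<one>, y) \<in> r \<Longrightarrow> x \<in> carrier G \<Longrightarrow> (x, x \<otimes> y) \<in> r"
  using mult_le[of "\<one>" y x] by simp

lemma mult_pos: "(\<one>, x) \<in> r \<Longrightarrow> (\<one>, y) \<in> r \<Longrightarrow> (\<one>, x \<otimes> y) \<in> r"
  using mult_ge[of y x] le_trans carrierD by blast

lemma pow_pos: "(\<one>, x) \<in> r \<Longrightarrow> (\<one>, x [^] (n::nat)) \<in> r"
  by (induction n) (auto intro: mult_pos)

lemma pow_ge: "(\<one>, x) \<in> r \<Longrightarrow> n > 0 \<Longrightarrow> (x, x [^] (n::nat)) \<in> r"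
  using mult_ge[OF pow_pos[of x "n - 1"], of x] carrierD(2)[of "\<one>" x] nat_pow_Suc2[of x "n - 1"]
  by simp

end

definition cone_order :: "('a, 'b) monoid_scheme \<Rightarrow> 'a set \<Rightarrow> 'a rel" where
  "cone_order G P = {(x, y) \<in> carrier G \<times> carrier G. x = y \<or> inv\<^bsub>G\<^esub> x \<otimes>\<^bsub>G\<^esub> y \<in> P}"

text \<open>\<open>P\<close> is the set of strictly positive elements. Left invariance is automatic,
  since \<open>inv x \<otimes> y\<close> does not change when \<open>x\<close> and \<open>y\<close>
  are multiplied on the left by the same element.\<close>

lemma (in group) cone_order_in_orderings:
  assumes P: "P \<subseteq> carrier G" and one: "\<one> \<notin> P"
    and mult: "\<And>x y. x \<in> P \<Longrightarrow> y \<in> P \<Longrightarrow> x \<otimes> y \<in> P"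
    and tot: "\<And>x. x \<in> carrier G \<Longrightarrow> x \<noteq> \<one> \<Longrightarrow> x \<in> P \<or> inv x \<in> P"
  shows "cone_order G P \<in> orderings G"
proof -
  have m: "inv x \<otimes> z \<in> P" if "x \<in> carrier G" "y \<in> carrier G" "z \<in> carrier G"
    "inv x \<otimes> y \<in> P" "inv y \<otimes> z \<in> P" for x y z
    using mult[OF that(4,5)] that(1-3) by (simp add: m_assoc)
  have eq: "inv x \<otimes> y = \<one> \<longleftrightarrow> x = y" if "x \<in> carrier G" "y \<in> carrier G" for x y
    using that by (metis inv_closed inv_inv inv_equality l_inv)
  have t: "inv x \<otimes> y \<in> P \<or> inv y \<otimes> x \<in> P" if "x \<in> carrier G" "y \<in> carrier G" "x \<noteq> y" for x y
    using tot[of "inv x \<otimes> y"] that eq by (simp add: inv_mult_group)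
  have l: "inv (f \<otimes> g) \<otimes> (f \<otimes> h) = inv g \<otimes> h" if "f \<in> carrier G" "g \<in> carrier G" "h \<in> carrier G" for f g h
    using that by (simp add: inv_mult_group m_assoc)
  show ?thesis unfolding orderings_iff
  proof (intro conjI ballI impI)
    show "cone_order G P \<subseteq> carrier G \<times> carrier G" by (auto simp: cone_order_def)
  next
    fix x assume "x \<in> carrier G" then show "(x, x) \<in> cone_order G P" by (simp add: cone_order_def)
  next
    fix x y z assume "x \<in> carrier G" "y \<in> carrier G" "z \<in> carrier G"
      "(x, y) \<in> cone_order G P" "(y, z) \<in> cone_order G P"
    then show "(x, z) \<in> cone_order G P" using m[of x y z] by (auto simp: cone_order_def)
  next
    fix x y assume "x \<in> carrier G" "y \<in> carrier G"
      "(x, y) \<in> cone_order G P" "(y, x) \<in> cone_order G P"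
    then show "x = y" using m[of x y x] one by (auto simp: cone_order_def)
  next
    fix x y assume "x \<in> carrier G" "y \<in> carrier G"
    then show "(x, y) \<in> cone_order G P \<or> (y, x) \<in> cone_order G P"
      using t[of x y] by (auto simp: cone_order_def)
  next
    fix f g h assume "f \<in> carrier G" "g \<in> carrier G" "h \<in> carrier G" "(g, h) \<in> cone_order G P"
    then show "(f \<otimes> g, f \<otimes> h) \<in> cone_order G P" using l by (auto simp: cone_order_def)
  qed
qed

section \<open>Cantor sets of orderings\<close>

text \<open>Stretches each outer third onto the unit interval; the clamped term interpolates
  linearly over the removed third and so makes the map continuous on the whole line.\<close>

definition cantor_shift :: "real \<Rightarrow> real" where
  "cantor_shift x = 3 * x - 2 * max 0 (min 1 (3 * x - 1))"

text \<open>The ternary digit at place \<open>n\<close>, counted from 0, with \<open>True\<close>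
  for the digit 2. The threshold lies in the removed third, so no iterate of a point of the Cantor
  set attains it and both values are open conditions.\<close>

definition cantor_digit :: "nat \<Rightarrow> real \<Rightarrow> bool" where
  "cantor_digit n x \<longleftrightarrow> (cantor_shift ^^ n) x > 1 / 2"

lemma cantor_stage_subset: "cantor_stage n \<subseteq> {0..1}"
  by (induction n) auto

lemma cantor_set_cases:
  assumes "x \<in> cantor_set"
  shows "x \<in> {0..1 / 3} \<or> x \<in> {2 / 3..1}"
proof -
  have "x \<in> cantor_stage (Suc 0)" using assms unfolding cantor_set_def by blast
  then show ?thesis by auto
qed

lemma cantor_shift_in_cantor_set:
  assumes "x \<in> cantor_set"
  shows "cantor_shift x \<in> cantor_set"
  unfolding cantor_set_def
proof
  fix n
  have "x \<in> cantor_stage (Suc n)" using assms unfolding cantor_set_def by blast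
  then obtain y where y: "y \<in> cantor_stage n" "x = y / 3 \<or> x = 2 / 3 + y / 3" by auto
  then have "y \<in> {0..1}" using cantor_stage_subset by blast
  then have "cantor_shift x = y" using y(2) by (auto simp: cantor_shift_def max_def min_def)
  then show "cantor_shift x \<in> cantor_stage n" using y by simp
qed

lemma cantor_shift_funpow_in_cantor_set:
  "x \<in> cantor_set \<Longrightarrow> (cantor_shift ^^ n) x \<in> cantor_set"
  by (induction n) (auto intro: cantor_shift_in_cantor_set)

lemma compact_cantor_set: "compact cantor_set"
proof -
  have "compact (cantor_stage n)" for n
    by (induction n) (auto intro!: compact_Un compact_continuous_image continuous_intros)
  then have "closed cantor_set" unfolding cantor_set_def by (auto intro: compact_imp_closed)
  moreover have "cantor_set \<subseteq> {0..1}"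
    using cantor_stage_subset[of 0] unfolding cantor_set_def by blast
  ultimately show ?thesis
    by (metis bounded_closed_interval bounded_subset compact_eq_bounded_closed)
qed

lemma continuous_on_cantor_shift_funpow: "continuous_on A (cantor_shift ^^ n)"
proof (induction n)
  case (Suc n)
  have "continuous_on UNIV cantor_shift"
    unfolding cantor_shift_def by (intro continuous_intros)
  then have "continuous_on A (\<lambda>x. cantor_shift ((cantor_shift ^^ n) x))"
    using Suc by (rule continuous_on_compose2) auto
  then show ?case by (simp add: comp_def)
qed auto

lemma openin_cantor_digit:
  "openin (top_of_set cantor_set) {x \<in> cantor_set. cantor_digit n x = b}"
proof (cases b)
  case True
  have "openin (top_of_set cantor_set) (cantor_set \<inter> (cantor_shift ^^ n) -` {1 / 2<..})"
    by (intro continuous_openin_preimage_gen continuous_on_cantor_shift_funpow) auto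
  then show ?thesis using True by (simp add: cantor_digit_def vimage_def Int_def)
next
  case False
  have eq: "{x \<in> cantor_set. cantor_digit n x = b} = cantor_set \<inter> (cantor_shift ^^ n) -` {..<1 / 2}"
  proof -
    have "\<not> (cantor_shift ^^ n) x > 1 / 2 \<longleftrightarrow> (cantor_shift ^^ n) x < 1 / 2" if "x \<in> cantor_set" for x
      using cantor_set_cases[OF cantor_shift_funpow_in_cantor_set[OF that, of n]] by auto
    then show ?thesis using False by (auto simp: cantor_digit_def)
  qed
  show ?thesis unfolding eq
    by (intro continuous_openin_preimage_gen continuous_on_cantor_shift_funpow) auto
qed

text \<open>The shift triples the distance of two points in the same outer third. Equal digits keep
  the iterates in a common third, so distinct points would move arbitrarily far apart inside the
  unit interval.\<close>

lemma cantor_digit_inject: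
  assumes x: "x \<in> cantor_set" and y: "y \<in> cantor_set"
    and eq: "\<And>n. cantor_digit n x = cantor_digit n y"
  shows "x = y"
proof (rule ccontr)
  assume "x \<noteq> y"
  have expand: "\<bar>cantor_shift u - cantor_shift v\<bar> = 3 * \<bar>u - v\<bar>"
    if "u \<in> cantor_set" "v \<in> cantor_set" "u > 1 / 2 \<longleftrightarrow> v > 1 / 2" for u v
    using cantor_set_cases[OF that(1)] cantor_set_cases[OF that(2)] that(3)
    by (auto simp: cantor_shift_def max_def min_def abs_if)
  have pow: "\<bar>(cantor_shift ^^ n) x - (cantor_shift ^^ n) y\<bar> = 3 ^ n * \<bar>x - y\<bar>" for n
    using expand[OF cantor_shift_funpow_in_cantor_set[OF x] cantor_shift_funpow_in_cantor_set[OF y]]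
      eq by (induction n) (auto simp: cantor_digit_def)
  have "3 ^ n * \<bar>x - y\<bar> \<le> 1" for n
    using cantor_set_cases[OF cantor_shift_funpow_in_cantor_set[OF x, of n]]
      cantor_set_cases[OF cantor_shift_funpow_in_cantor_set[OF y, of n]]
    by (auto simp flip: pow)
  moreover obtain n where "1 / \<bar>x - y\<bar> < 3 ^ n" using real_arch_pow[of 3] by auto
  ultimately show False using \<open>x \<noteq> y\<close>
    by (metis divide_less_eq linorder_not_less right_minus_eq zero_less_abs_iff)
qed

text \<open>The points sharing their first \<open>n\<close> digits with a given point form an open
  cylinder. Continuity of the map into the space of orderings is checked with this.\<close>

lemma openin_cantor_digits_prefix:
  assumes "\<And>x y. \<lbrakk>x \<in> cantor_set; y \<in> cantor_set; \<And>i. i < n \<Longrightarrow> cantor_digit i x = cantor_digit i y\<rbrakk>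
      \<Longrightarrow> Q x \<Longrightarrow> Q y"
  shows "openin (top_of_set cantor_set) {x \<in> cantor_set. Q x}"
proof (subst openin_subopen, intro ballI)
  fix x assume x: "x \<in> {x \<in> cantor_set. Q x}"
  let ?T = "cantor_set \<inter> (\<Inter>i\<in>{..<n}. {y \<in> cantor_set. cantor_digit i y = cantor_digit i x})"
  have "openin (top_of_set cantor_set) ?T"
    by (rule openin_Int_Inter) (auto intro: openin_cantor_digit)
  moreover have "x \<in> ?T" using x by auto
  moreover have "?T \<subseteq> {x \<in> cantor_set. Q x}" using assms[of x] x by auto
  ultimately show "\<exists>T. openin (top_of_set cantor_set) T \<and> x \<in> T \<and> T \<subseteq> {x \<in> cantor_set. Q x}"
    by blast
qed

section \<open>Topology of the space of orderings\<close>

lemma orderings_subset: "r \<in> orderings G \<Longrightarrow> r \<subseteq> carrier G \<times> carrier G"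
  by (auto dest: orderingsD(1,2))

text \<open>A total relation cannot be enlarged without violating antisymmetry.\<close>

lemma orderings_eqI:
  assumes "r \<in> orderings G" "s \<in> orderings G" "r \<subseteq> s"
  shows "r = s"
proof
  show "s \<subseteq> r"
  proof
    fix p assume "p \<in> s"
    then obtain x y where p: "p = (x, y)" "(x, y) \<in> s" by (cases p) auto
    then have "x \<in> carrier G" "y \<in> carrier G" using orderingsD(1,2)[OF assms(2)] by blast+
    then show "p \<in> r"
      using p orderingsD(6)[OF assms(1), of x y] orderingsD(5)[OF assms(2), of x y] assms(3)
        orderingsD(3)[OF assms(1)] by blast
  qed
qed fact

lemma openin_ordering_subbasic:
  assumes "x \<in> carrier G" "y \<in> carrier G" "x \<noteq> y"
  shows "openin (space_of_orderings G) (ordering_subbasic G x y)"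
  unfolding space_of_orderings_def
  by (rule topology_generated_by_Basis) (use assms in blast)

lemma Hausdorff_space_of_orderings: "Hausdorff_space (space_of_orderings G)"
  unfolding Hausdorff_space_def topspace_space_of_orderings
proof (intro allI impI, elim conjE)
  fix r s assume rs: "r \<in> orderings G" "s \<in> orderings G" "r \<noteq> s"
  then have "\<not> r \<subseteq> s" using orderings_eqI by metis
  then obtain x y where xy: "(x, y) \<in> r" "(x, y) \<notin> s" by auto
  have c: "x \<in> carrier G" "y \<in> carrier G" using orderingsD(1,2)[OF rs(1)] xy by auto
  have ne: "x \<noteq> y" using xy orderingsD(3)[OF rs(2)] c by auto
  have "r \<in> ordering_subbasic G x y" "s \<in> ordering_subbasic G y x"
    using rs xy c ne orderingsD(6)[OF rs(2)] by (auto simp: ordering_subbasic_def)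
  moreover have "disjnt (ordering_subbasic G x y) (ordering_subbasic G y x)"
    using orderingsD(5)[of _ G x y] ne by (auto simp: disjnt_def ordering_subbasic_def)
  ultimately show "\<exists>U V. openin (space_of_orderings G) U \<and> openin (space_of_orderings G) V \<and>
      r \<in> U \<and> s \<in> V \<and> disjnt U V"
    using openin_ordering_subbasic[OF c ne] openin_ordering_subbasic[OF c(2,1) ne[symmetric]]
    by blast
qed

lemma continuous_map_space_of_orderings:
  assumes "f \<in> topspace X \<rightarrow> orderings G"
    and "\<And>x y. \<lbrakk>x \<in> carrier G; y \<in> carrier G; x \<noteq> y\<rbrakk> \<Longrightarrow> openin X {u \<in> topspace X. (x, y) \<in> f u}"
  shows "continuous_map X (space_of_orderings G) f"
  unfolding space_of_orderings_def
proof (rule continuous_on_generated_topo)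
  fix U assume "U \<in> insert (orderings G)
          {ordering_subbasic G f g | f g. f \<in> carrier G \<and> g \<in> carrier G \<and> f \<noteq> g}"
  then consider "U = orderings G" | x y where "U = ordering_subbasic G x y" "x \<in> carrier G" "y \<in> carrier G" "x \<noteq> y"
    by blast
  then show "openin X (f -` U \<inter> topspace X)"
  proof cases
    case 1
    then have "f -` U \<inter> topspace X = topspace X" using assms(1) by auto
    then show ?thesis by simp
  next
    case 2
    then have "f -` U \<inter> topspace X = {u \<in> topspace X. (x, y) \<in> f u}"
      using assms(1) by (auto simp: ordering_subbasic_def)
    then show ?thesis using assms(2) 2 by simp
  qed
qed (use assms(1) in \<open>auto simp: ordering_subbasic_def\<close>)

text \<open>If every pair had a countable side, deleting these countably many countable sides would
  leave only orderings that agree on every pair, hence at most one, and \<open>U\<close> would be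
  countable.\<close>

lemma uncountable_split:
  assumes cnt: "countable (carrier G)" and U: "U \<subseteq> orderings G" "uncountable U"
  shows "\<exists>p. uncountable {r \<in> U. p \<in> r} \<and> uncountable {r \<in> U. p \<notin> r}"
proof (rule ccontr)
  assume "\<not> ?thesis"
  then have dich: "countable {r \<in> U. p \<in> r} \<or> countable {r \<in> U. p \<notin> r}" for p by blast
  define D where "D p = (if countable {r \<in> U. p \<in> r} then {r \<in> U. p \<in> r} else {r \<in> U. p \<notin> r})" for p
  let ?R = "U - (\<Union>p\<in>carrier G \<times> carrier G. D p)"
  have cD: "countable (\<Union>p\<in>carrier G \<times> carrier G. D p)"
    using cnt dich by (auto simp: D_def)
  have "r = s" if "r \<in> ?R" "s \<in> ?R" for r s
  proof -
    have "p \<in> r \<longleftrightarrow> p \<in> s" if "p \<in> carrier G \<times> carrier G" for p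
      using that \<open>r \<in> ?R\<close> \<open>s \<in> ?R\<close> by (auto simp: D_def split: if_splits)
    moreover have "r \<in> orderings G" "s \<in> orderings G" using that U(1) by auto
    then have "r \<subseteq> carrier G \<times> carrier G" "s \<subseteq> carrier G \<times> carrier G"
      by (simp_all add: orderings_subset)
    ultimately show ?thesis by blast
  qed
  then have "?R \<subseteq> {SOME r. r \<in> ?R}" by (metis (mono_tags, lifting) singletonI someI subsetI)
  then have "countable ?R" by (rule countable_subset) simp
  then have "countable (?R \<union> (\<Union>p\<in>carrier G \<times> carrier G. D p))" using cD by (rule countable_Un)
  then have "countable U" by (rule countable_subset[rotated]) blast
  then show False using U by simp
qed

text \<open>A Cantor scheme of uncountable sets of orderings. The \<open>n\<close>-th step first decides whether the
  \<open>n\<close>-th pair belongs to the orderings, so that each branch determines a single ordering, and then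
  splits along another pair.\<close>

lemma uncountable_orderings_contains_cantor_set:
  assumes cnt: "countable (carrier G)" and unc: "uncountable (orderings G)"
  shows "\<exists>S \<subseteq> topspace (space_of_orderings G).
       subtopology (space_of_orderings G) S homeomorphic_space top_of_set cantor_set"
proof -
  let ?G2 = "carrier G \<times> carrier G"
  define e where "e = from_nat_into ?G2"
  have sub: "r \<subseteq> ?G2" if "r \<in> orderings G" for r using that by (rule orderings_subset)
  have "carrier G \<noteq> {}"
  proof
    assume "carrier G = {}"
    then have "orderings G \<subseteq> {{}}" using sub by auto
    then show False using unc by (meson countable_empty countable_insert countable_subset)
  qed
  then have e: "\<exists>n. p = e n" if "p \<in> ?G2" for p
    using that cnt from_nat_into_surj[of ?G2 p] unfolding e_def by (metis countable_SIGMA)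
  \<comment> \<open>If only countably many members contain \<open>e n\<close>, then uncountably many
    omit it, so either branch keeps an uncountable set on which \<open>e n\<close> is
    decided.\<close>
  define half where "half n U = (if uncountable {r \<in> U. e n \<in> r} then {r \<in> U. e n \<in> r}
      else {r \<in> U. e n \<notin> r})" for n and U :: "'a rel set"
  define split_pair where "split_pair U = (SOME p. uncountable {r \<in> U. p \<in> r} \<and> uncountable {r \<in> U. p \<notin> r})"
    for U :: "'a rel set"
  define child where "child n U b = {r \<in> half n U. split_pair (half n U) \<in> r \<longleftrightarrow> b}" for n U b
  define node where "node \<alpha> n = rec_nat (orderings G) (\<lambda>n U. child n U (\<alpha> n)) n" for \<alpha> n
  have node_0: "node \<alpha> 0 = orderings G" and node_Suc: "node \<alpha> (Suc n) = child n (node \<alpha> n) (\<alpha> n)" for \<alpha> n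
    by (simp_all add: node_def)
  have half: "half n U \<subseteq> U \<and> uncountable (half n U)" if "uncountable U" for n U
  proof (cases "uncountable {r \<in> U. e n \<in> r}")
    case False
    moreover have "U = {r \<in> U. e n \<in> r} \<union> {r \<in> U. e n \<notin> r}" by blast
    ultimately show ?thesis using that by (metis (no_types, lifting) countable_Un half_def mem_Collect_eq subsetI)
  qed (auto simp: half_def)
  have child: "uncountable (child n U b)" if "U \<subseteq> orderings G" "uncountable U" for n U b
  proof -
    have "\<exists>p. uncountable {r \<in> half n U. p \<in> r} \<and> uncountable {r \<in> half n U. p \<notin> r}"
      using half that by (intro uncountable_split[OF cnt]) auto
    from someI_ex[OF this] show ?thesis unfolding child_def split_pair_def by (cases b) auto
  qed
  have node: "node \<alpha> n \<subseteq> orderings G \<and> uncountable (node \<alpha> n)" for \<alpha> n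
  proof (induction n)
    case (Suc n)
    then show ?case using child[of "node \<alpha> n" n "\<alpha> n"] half[of "node \<alpha> n" n]
      by (auto simp: node_Suc child_def)
  qed (use unc in \<open>simp add: node_0\<close>)
  have nonempty: "node \<alpha> n \<noteq> {}" for \<alpha> n using node[of \<alpha> n] by auto
  have "node \<alpha> (Suc n) \<subseteq> node \<alpha> n" for \<alpha> n
    using half node[of \<alpha> n] by (auto simp: node_Suc child_def)
  then have mono: "node \<alpha> n \<subseteq> node \<alpha> m" if "m \<le> n" for \<alpha> m n
    using that by (rule lift_Suc_antimono_le)
  have node_cong: "(\<And>i. i < n \<Longrightarrow> \<alpha> i = \<beta> i) \<Longrightarrow> node \<alpha> n = node \<beta> n" for \<alpha> \<beta> n
    by (induction n) (auto simp: node_0 node_Suc)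
  have decided: "e n \<in> s \<longleftrightarrow> e n \<in> t" if "s \<in> node \<alpha> (Suc n)" "t \<in> node \<alpha> (Suc n)" for s t \<alpha> n
    using that by (auto simp: node_Suc child_def half_def split: if_splits)
  \<comment> \<open>Membership of \<open>e n\<close> is read off at level \<open>Suc n\<close>,
    because passing from level \<open>n\<close> to \<open>Suc n\<close> decides that pair.\<close>
  define lim where "lim \<alpha> = {p. \<exists>n. p = e n \<and> p \<in> ?G2 \<and> (\<forall>s\<in>node \<alpha> (Suc n). p \<in> s)}" for \<alpha>
  have agree: "e n \<in> lim \<alpha> \<longleftrightarrow> e n \<in> s" if "s \<in> node \<alpha> N" "n < N" for \<alpha> n N s
  proof
    assume "e n \<in> lim \<alpha>"
    then obtain m where m: "e n = e m" "\<forall>s\<in>node \<alpha> (Suc m). e m \<in> s" unfolding lim_def by force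
    obtain t where t: "t \<in> node \<alpha> (Suc (max m n))" using nonempty by blast
    have "e n \<in> t" using m t mono[of "Suc m" "Suc (max m n)" \<alpha>] by auto
    then show "e n \<in> s"
      using decided[of t \<alpha> n s] t mono[of "Suc n" "Suc (max m n)" \<alpha>] mono[of "Suc n" N \<alpha>] that by auto
  next
    assume "e n \<in> s"
    then have "\<forall>t\<in>node \<alpha> (Suc n). e n \<in> t"
      using decided[of s \<alpha> n] mono[of "Suc n" N \<alpha>] that by auto
    moreover have "e n \<in> ?G2" using \<open>e n \<in> s\<close> that(1) node[of \<alpha> N] sub by blast
    ultimately show "e n \<in> lim \<alpha>" unfolding lim_def mem_Collect_eq by (intro exI[of _ n] conjI refl)
  qed
  have lim_ord: "lim \<alpha> \<in> orderings G" for \<alpha>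
  proof (rule orderings_limit)
    show "lim \<alpha> \<subseteq> ?G2" unfolding lim_def by auto
    fix F :: "('a \<times> 'a) set" assume "finite F"
    \<comment> \<open>A finite set of pairs is decided at one common level, where any ordering in
      the node agrees with the limit on it.\<close>
    then have "\<exists>N. \<forall>p\<in>F \<inter> ?G2. \<exists>n<N. p = e n"
    proof induction
      case (insert p F)
      then obtain N where N: "\<forall>p\<in>F \<inter> ?G2. \<exists>n<N. p = e n" by blast
      obtain k where k: "p \<in> ?G2 \<Longrightarrow> p = e k" using e by blast
      show ?case
      proof (rule exI[of _ "max N (Suc k)"], rule ballI)
        fix q assume "q \<in> insert p F \<inter> ?G2"
        then consider "q = p" "p \<in> ?G2" | "q \<in> F \<inter> ?G2" by blast
        then show "\<exists>n<max N (Suc k). q = e n"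
        proof cases
          case 1
          then show ?thesis using k by (intro exI[of _ k]) auto
        next
          case 2
          then obtain m where "m < N" "q = e m" using N by blast
          then show ?thesis by (intro exI[of _ m]) auto
        qed
      qed
    qed auto
    then obtain N where N: "\<forall>p\<in>F \<inter> ?G2. \<exists>n<N. p = e n" by blast
    obtain s where s: "s \<in> node \<alpha> N" using nonempty by blast
    have "p \<in> lim \<alpha> \<longleftrightarrow> p \<in> s" if "p \<in> F" for p
    proof (cases "p \<in> ?G2")
      case True
      then have "p \<in> F \<inter> ?G2" using that by simp
      then obtain n where "n < N" "p = e n" using N by blast
      then show ?thesis using agree[OF s] by simp
    next
      case False
      then show ?thesis using sub node[of \<alpha> N] s by (auto simp: lim_def)
    qed
    then show "\<exists>s\<in>orderings G. \<forall>p\<in>F. p \<in> lim \<alpha> \<longleftrightarrow> p \<in> s" using s node[of \<alpha> N] by blast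
  qed
  have lim_inj: "\<alpha> = \<beta>" if eq: "lim \<alpha> = lim \<beta>" for \<alpha> \<beta>
  proof (rule ccontr)
    assume "\<alpha> \<noteq> \<beta>"
    then have ex: "\<exists>n. \<alpha> n \<noteq> \<beta> n" by auto
    define n where "n = (LEAST n. \<alpha> n \<noteq> \<beta> n)"
    have n: "\<alpha> n \<noteq> \<beta> n" using LeastI_ex[OF ex] by (simp add: n_def)
    have less: "\<alpha> i = \<beta> i" if "i < n" for i using not_less_Least that unfolding n_def by blast
    \<comment> \<open>At the first place where the branches differ their nodes still coincide, so a
      single splitting pair separates the two limits.\<close>
    define q where "q = split_pair (half n (node \<alpha> n))"
    have eqn: "node \<beta> n = node \<alpha> n" using node_cong[of n \<alpha> \<beta>] less by simp
    have qa: "q \<in> s \<longleftrightarrow> \<alpha> n" if "s \<in> node \<alpha> (Suc n)" for s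
      using that by (simp add: node_Suc child_def q_def)
    have qb: "q \<in> s \<longleftrightarrow> \<beta> n" if "s \<in> node \<beta> (Suc n)" for s
      using that eqn by (simp add: node_Suc child_def q_def)
    obtain sa sb where sab: "sa \<in> node \<alpha> (Suc n)" "sb \<in> node \<beta> (Suc n)" using nonempty by blast
    have "q \<in> sa \<or> q \<in> sb" using qa[OF sab(1)] qb[OF sab(2)] n by blast
    moreover have "sa \<in> orderings G" "sb \<in> orderings G" using sab node by blast+
    ultimately have "q \<in> ?G2" using sub by blast
    then obtain m where m: "q = e m" using e by blast
    define N where "N = max (Suc n) (Suc m)"
    obtain ta tb where tab: "ta \<in> node \<alpha> N" "tb \<in> node \<beta> N" using nonempty by blast
    have "q \<in> lim \<alpha> \<longleftrightarrow> \<alpha> n" "q \<in> lim \<beta> \<longleftrightarrow> \<beta> n"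
      using agree[OF tab(1), of m] agree[OF tab(2), of m] qa[of ta] qb[of tb] tab m
        mono[of "Suc n" N \<alpha>] mono[of "Suc n" N \<beta>] by (auto simp: N_def)
    then show False using n eq by simp
  qed
  define f where "f x = lim (\<lambda>n. cantor_digit n x)" for x
  have "openin (top_of_set cantor_set) {x \<in> cantor_set. p \<in> f x}" if p: "p \<in> ?G2" for p
  proof -
    obtain n where n: "p = e n" using e p by blast
    show ?thesis
    proof (rule openin_cantor_digits_prefix)
      fix x y assume xy: "\<And>i. i < Suc n \<Longrightarrow> cantor_digit i x = cantor_digit i y" "p \<in> f x"
      obtain s where s: "s \<in> node (\<lambda>n. cantor_digit n x) (Suc n)" using nonempty by blast
      have "node (\<lambda>n. cantor_digit n x) (Suc n) = node (\<lambda>n. cantor_digit n y) (Suc n)"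
        by (rule node_cong) (rule xy)
      then show "p \<in> f y"
        using agree[OF s, of n] agree[of s "\<lambda>n. cantor_digit n y" "Suc n" n] s xy(2) n by (simp add: f_def)
    qed
  qed
  then have "continuous_map (top_of_set cantor_set) (space_of_orderings G) f"
    using lim_ord by (intro continuous_map_space_of_orderings) (auto simp: f_def)
  moreover have "inj_on f cantor_set"
  proof (rule inj_onI)
    fix x y assume "x \<in> cantor_set" "y \<in> cantor_set" "f x = f y"
    moreover from this(3) have "(\<lambda>n. cantor_digit n x) = (\<lambda>n. cantor_digit n y)"
      unfolding f_def by (rule lim_inj)
    then have "cantor_digit n x = cantor_digit n y" for n by (rule fun_cong)
    ultimately show "x = y" by (intro cantor_digit_inject)
  qed
  ultimately have "embedding_map (top_of_set cantor_set) (space_of_orderings G) f"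
    using compact_cantor_set Hausdorff_space_of_orderings
    by (intro continuous_imp_embedding_map) (auto simp: compact_space_def)
  then have "top_of_set cantor_set homeomorphic_space subtopology (space_of_orderings G) (f ` cantor_set)"
    unfolding embedding_map_def by (metis homeomorphic_map_imp_homeomorphic_space topspace_euclidean_subtopology)
  moreover have "f ` cantor_set \<subseteq> orderings G" using lim_ord by (auto simp: f_def)
  ultimately show ?thesis
    by (metis homeomorphic_space_sym topspace_space_of_orderings)
qed

section \<open>Orderings with finite orbit\<close>

text \<open>Tychonoff's theorem for indicator functions of relations: those of orderings form a
  closed set \<open>C\<close> by \<open>orderings_limit\<close>, and \<open>Collect\<close> maps it
  continuously onto the orderings.\<close>

lemma compact_space_of_orderings: "compact_space (space_of_orderings G)"
proof -
  let ?P = "product_topology (\<lambda>_. discrete_topology (UNIV :: bool set)) (UNIV :: ('a \<times> 'a) set)"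
  define C where "C = {f. Collect f \<in> orderings G}"
  have tops [simp]: "topspace ?P = UNIV" by simp
  have "compact_space ?P"
    by (simp add: compact_space_product_topology compact_space_discrete_topology)
  moreover have "closedin ?P C"
  proof -
    have "f \<in> C" if f: "f \<in> ?P closure_of C" for f
    proof -
      have near: "\<exists>g\<in>C. \<forall>p\<in>F. g p = f p" if "finite F" for F
      proof -
        let ?X = "\<lambda>p. if p \<in> F then {f p} else UNIV"
        have "finite {p. ?X p \<noteq> topspace (discrete_topology (UNIV :: bool set))}"
          by (rule finite_subset[OF _ that]) auto
        then have "openin ?P (\<Pi>\<^sub>E p\<in>UNIV. ?X p)"
          by (intro product_topology_basis) auto
        moreover have "f \<in> (\<Pi>\<^sub>E p\<in>UNIV. ?X p)" by (auto simp: PiE_def)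
        ultimately obtain g where g: "g \<in> C" "g \<in> (\<Pi>\<^sub>E p\<in>UNIV. ?X p)"
          using f unfolding in_closure_of by blast
        have "g p = f p" if "p \<in> F" for p using PiE_mem[OF g(2), of p] that by auto
        then show ?thesis using g(1) by blast
      qed
      have "Collect f \<in> orderings G"
      proof (rule orderings_limit)
        show "Collect f \<subseteq> carrier G \<times> carrier G"
        proof
          fix p assume "p \<in> Collect f"
          moreover obtain g where "g \<in> C" "g p = f p" using near[of "{p}"] by auto
          ultimately show "p \<in> carrier G \<times> carrier G" using orderings_subset[of "Collect g" G]
            unfolding C_def by blast
        qed
        fix F :: "('a \<times> 'a) set" assume "finite F"
        then obtain g where "g \<in> C" "\<forall>p\<in>F. g p = f p" using near by blast
        then show "\<exists>s\<in>orderings G. \<forall>p\<in>F. (p \<in> Collect f) = (p \<in> s)"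
          by (intro bexI[of _ "Collect g"]) (auto simp: C_def)
      qed
      then show ?thesis by (simp add: C_def)
    qed
    then have "?P closure_of C \<subseteq> C" by blast
    then show ?thesis by (metis closure_of_subset closure_of_eq subset_antisym tops subset_UNIV)
  qed
  ultimately have "compactin ?P C" by (rule closedin_compact_space)
  then have "compactin (subtopology ?P C) C" by (simp add: compactin_subtopology)
  moreover have "continuous_map (subtopology ?P C) (space_of_orderings G) Collect"
  proof (rule continuous_map_space_of_orderings)
    show "Collect \<in> topspace (subtopology ?P C) \<rightarrow> orderings G" by (auto simp: C_def)
    fix x y
    have "openin ?P {f \<in> topspace ?P. f (x, y) \<in> {True}}"
      by (rule openin_continuous_map_preimage[OF continuous_map_product_projection]) auto
    then show "openin (subtopology ?P C) {f \<in> topspace (subtopology ?P C). (x, y) \<in> Collect f}"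
      unfolding openin_subtopology by (intro exI[of _ "{f \<in> topspace ?P. f (x, y) \<in> {True}}"]) auto
  qed
  ultimately have "compactin (space_of_orderings G) (Collect ` C)" by (rule image_compactin)
  moreover have "Collect ` C = orderings G"
  proof
    show "orderings G \<subseteq> Collect ` C"
    proof
      fix r assume "r \<in> orderings G"
      then show "r \<in> Collect ` C" by (intro image_eqI[of _ _ "\<lambda>p. p \<in> r"]) (auto simp: C_def)
    qed
  qed (auto simp: C_def)
  ultimately show ?thesis by (simp add: compact_space_def)
qed

text \<open>Otherwise the points would be countably many closed sets with empty interior, and by
  Baire their union, the whole space, would have empty interior.\<close>

lemma countable_compact_Hausdorff_isolated_point:
  assumes "compact_space X" "Hausdorff_space X" "countable (topspace X)" "topspace X \<noteq> {}"
  shows "\<exists>x\<in>topspace X. openin X {x}"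
proof (rule ccontr)
  assume *: "\<not> ?thesis"
  have "X interior_of {x} = {}" for x
  proof (rule ccontr)
    assume "X interior_of {x} \<noteq> {}"
    then have "X interior_of {x} = {x}" using interior_of_subset[of X "{x}"] by blast
    then have "openin X {x}" using openin_interior_of[of X "{x}"] by simp
    then show False using * openin_subset[of X "{x}"] by auto
  qed
  moreover have "closedin X {x}" if "x \<in> topspace X" for x
    using assms(2) that by (rule closedin_Hausdorff_singleton)
  moreover have "locally_compact_space X \<and> regular_space X"
    using assms(1,2) compact_Hausdorff_imp_regular_space compact_imp_locally_compact_space by blast
  ultimately have "X interior_of \<Union>((\<lambda>x. {x}) ` topspace X) = {}"
    using assms(3) by (intro Baire_category_alt) auto
  moreover have "\<Union>((\<lambda>x. {x}) ` topspace X) = topspace X" by blast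
  ultimately show False using assms(4) by (simp add: interior_of_topspace)
qed

text \<open>Every orbit in a minimal closed invariant set is dense there, so it contains the isolated
  points that exist by Baire's theorem. Hence all points of the set are isolated, and compactness
  makes it finite.\<close>

lemma (in group) exists_finite_orbit:
  fixes X :: "'x topology" and act :: "'a \<Rightarrow> 'x \<Rightarrow> 'x"
  assumes X: "compact_space X" "Hausdorff_space X" "countable (topspace X)" "topspace X \<noteq> {}"
    and cont: "\<And>g. g \<in> carrier G \<Longrightarrow> continuous_map X X (act g)"
    and one: "\<And>x. x \<in> topspace X \<Longrightarrow> act \<one> x = x"
    and mult: "\<And>g h x. \<lbrakk>g \<in> carrier G; h \<in> carrier G; x \<in> topspace X\<rbrakk> \<Longrightarrow> act (g \<otimes> h) x = act g (act h x)"
  shows "\<exists>x\<in>topspace X. finite ((\<lambda>g. act g x) ` carrier G)"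
proof -
  have maps: "act g x \<in> topspace X" if "g \<in> carrier G" "x \<in> topspace X" for g x
    using continuous_map_image_subset_topspace[OF cont] that by blast
  have cancel: "act (inv g) (act g x) = x" "act g (act (inv g) x) = x"
    if "g \<in> carrier G" "x \<in> topspace X" for g x
    using mult[of "inv g" g x] mult[of g "inv g" x] one that by simp_all
  \<comment> \<open>These are the complements of the nonempty closed invariant sets; a maximal
    member gives a minimal closed invariant set, called \<open>M\<close> below.\<close>
  define \<A> where "\<A> = {U. openin X U \<and> U \<noteq> topspace X \<and>
    (\<forall>g\<in>carrier G. \<forall>x\<in>topspace X. act g x \<in> U \<longrightarrow> x \<in> U)}"
  have "\<exists>U\<in>\<A>. \<forall>V\<in>\<A>. U \<subseteq> V \<longrightarrow> V = U"
  proof (rule subset_Zorn_nonempty)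
    have "{} \<in> \<A>" using X(4) openin_empty[of X] unfolding \<A>_def by fast
    then show "\<A> \<noteq> {}" by blast
    fix \<C> assume \<C>: "\<C> \<noteq> {}" "subset.chain \<A> \<C>"
    then have sub: "\<C> \<subseteq> \<A>" by (simp add: subset.chain_def)
    have "\<Union>\<C> \<noteq> topspace X"
    proof
      assume eq: "\<Union>\<C> = topspace X"
      have "\<forall>U\<in>\<C>. openin X U" using sub by (auto simp: \<A>_def)
      \<comment> \<open>By compactness finitely many members of the chain would cover, and the
        largest of them would already be the whole space.\<close>
      then obtain \<F> where \<F>: "finite \<F>" "\<F> \<subseteq> \<C>" "\<Union>\<F> = topspace X"
        using X(1) eq unfolding compact_space by meson
      have "\<F> \<noteq> {}" using \<F>(3) X(4) by fast
      moreover have "subset.chain \<A> \<F>" using \<C>(2) \<F>(2) unfolding subset.chain_def by blast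
      ultimately have "topspace X \<in> \<F>" using Union_in_chain[of \<F> \<A>] \<F> by simp
      then show False using \<F>(2) sub by (auto simp: \<A>_def)
    qed
    moreover have "openin X (\<Union>\<C>)" using sub by (intro openin_Union) (auto simp: \<A>_def)
    moreover have "x \<in> \<Union>\<C>" if "g \<in> carrier G" "x \<in> topspace X" "act g x \<in> \<Union>\<C>" for g x
      using that sub unfolding \<A>_def by blast
    ultimately show "\<Union>\<C> \<in> \<A>" by (simp add: \<A>_def)
  qed
  then obtain U where U: "U \<in> \<A>" and max: "\<And>V. V \<in> \<A> \<Longrightarrow> U \<subseteq> V \<Longrightarrow> V = U" by blast
  define M where "M = topspace X - U"
  have opU: "openin X U" and Uinv: "\<And>g x. \<lbrakk>g \<in> carrier G; x \<in> topspace X; act g x \<in> U\<rbrakk> \<Longrightarrow> x \<in> U"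
    and Une: "U \<noteq> topspace X" using U by (auto simp: \<A>_def)
  have M: "M \<subseteq> topspace X" "closedin X M" "M \<noteq> {}" using opU Une openin_subset[OF opU]
    by (auto simp: M_def)
  have inv: "act g x \<in> M" if "g \<in> carrier G" "x \<in> M" for g x
    using that Uinv maps by (auto simp: M_def)
  have dense: "X closure_of ((\<lambda>g. act g x) ` carrier G) = M" if x: "x \<in> M" for x
  proof -
    let ?O = "(\<lambda>g. act g x) ` carrier G"
    \<comment> \<open>The complement of an orbit closure is again in \<A> and contains
      \<open>U\<close>, so maximality makes the orbit dense in \<open>M\<close>.\<close>
    let ?V = "topspace X - X closure_of ?O"
    have "?O \<subseteq> M" using inv x by auto
    then have clM: "X closure_of ?O \<subseteq> M" using M(2) closure_of_minimal by blast
    have "?O \<subseteq> topspace X" using \<open>?O \<subseteq> M\<close> M(1) by blast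
    then have sub: "?O \<subseteq> X closure_of ?O" by (rule closure_of_subset)
    have "act g y \<in> X closure_of ?O" if "g \<in> carrier G" "y \<in> X closure_of ?O" for g y
    proof -
      have "act g ` ?O \<subseteq> ?O" using mult[of g _ x] that(1) x M(1) by (auto simp flip: mult)
      then have "X closure_of (act g ` ?O) \<subseteq> X closure_of ?O" by (rule closure_of_mono)
      then show ?thesis
        using continuous_map_image_closure_subset[OF cont[OF that(1)], of ?O] that(2) by blast
    qed
    moreover have "x \<in> X closure_of ?O" using sub one[of x] x M(1) by force
    then have "?V \<noteq> topspace X" using clM M(1) by blast
    ultimately have "?V \<in> \<A>"
      unfolding \<A>_def by (auto simp: closedin_closure_of)
    moreover have "U \<subseteq> ?V" using clM openin_subset[OF opU] by (auto simp: M_def)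
    ultimately have "?V = U" by (rule max)
    then show ?thesis using closure_of_subset_topspace[of X ?O] by (auto simp: M_def)
  qed
  have cM: "compact_space (subtopology X M)"
    using X(1) M(2) by (simp add: closedin_compact_space compact_space_subtopology)
  have "\<exists>m\<in>topspace (subtopology X M). openin (subtopology X M) {m}"
    using cM X(2,3) M by (intro countable_compact_Hausdorff_isolated_point Hausdorff_space_subtopology)
      (auto simp: Int_absorb1 countable_subset)
  then obtain m W where m: "m \<in> M" and W: "openin X W" "W \<inter> M = {m}"
    unfolding openin_subtopology by auto
  have orbit: "\<exists>g\<in>carrier G. x = act g m" if x: "x \<in> M" for x
  proof -
    have "m \<in> X closure_of ((\<lambda>g. act g x) ` carrier G)" using dense[OF x] m by simp
    moreover have "m \<in> W" using W by blast
    ultimately obtain g where g: "g \<in> carrier G" "act g x \<in> W" using W(1) unfolding in_closure_of by blast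
    then have "act g x = m" using W(2) inv x by blast
    then have "x = act (inv g) m" using cancel(1)[of g x] g(1) x M(1) by auto
    then show ?thesis using g(1) by blast
  qed
  have "openin (subtopology X M) {x}" if x: "x \<in> M" for x
  proof -
    obtain g where g: "g \<in> carrier G" "x = act g m" using orbit x by blast
    \<comment> \<open>The translate by \<open>g\<close> of the neighbourhood isolating
      \<open>m\<close> isolates \<open>act g m\<close>.\<close>
    let ?W = "{y \<in> topspace X. act (inv g) y \<in> W}"
    have "openin X ?W" using W(1) g(1) cont by (intro openin_continuous_map_preimage) auto
    moreover have "?W \<inter> M = {x}"
    proof
      show "?W \<inter> M \<subseteq> {x}"
      proof
        fix y assume y: "y \<in> ?W \<inter> M"
        then have "act (inv g) y = m" using W(2) inv[of "inv g" y] g(1) by blast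
        then show "y \<in> {x}" using cancel(2)[of g y] g y by auto
      qed
      show "{x} \<subseteq> ?W \<inter> M" using x M(1) cancel(1)[of g m] g m W(2) by auto
    qed
    ultimately show ?thesis unfolding openin_subtopology by blast
  qed
  then have "discrete_topology M = subtopology X M"
    using M(1) unfolding discrete_topology_unique by (auto simp: Int_absorb1)
  then have "finite M" using cM by (metis compact_space_discrete_topology)
  moreover have "(\<lambda>g. act g m) ` carrier G \<subseteq> M" using inv m by auto
  ultimately show ?thesis using m M(1) finite_subset by blast
qed

text \<open>On left-invariant orders, right translation coincides with conjugation.\<close>

definition right_translate :: "('a, 'b) monoid_scheme \<Rightarrow> 'a \<Rightarrow> 'a rel \<Rightarrow> 'a rel" where
  "right_translate G g r =
     {(x, y) \<in> carrier G \<times> carrier G. (x \<otimes>\<^bsub>G\<^esub> g, y \<otimes>\<^bsub>G\<^esub> g) \<in> r}"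

lemma (in group) right_translate_in_orderings:
  assumes r: "r \<in> orderings G" and g: "g \<in> carrier G"
  shows "right_translate G g r \<in> orderings G"
  unfolding orderings_iff
proof (intro conjI ballI impI)
  show "right_translate G g r \<subseteq> carrier G \<times> carrier G" by (auto simp: right_translate_def)
next
  fix x assume "x \<in> carrier G"
  then show "(x, x) \<in> right_translate G g r"
    using orderingsD(3)[OF r] g by (simp add: right_translate_def)
next
  fix x y z assume "(x, y) \<in> right_translate G g r" "(y, z) \<in> right_translate G g r"
  then show "(x, z) \<in> right_translate G g r"
    using orderingsD(4)[OF r] by (auto simp: right_translate_def)
next
  fix x y assume "(x, y) \<in> right_translate G g r" "(y, x) \<in> right_translate G g r"
  then show "x = y" using orderingsD(5)[OF r, of "x \<otimes> g" "y \<otimes> g"] g by (auto simp: right_translate_def)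
next
  fix x y assume "x \<in> carrier G" "y \<in> carrier G"
  then show "(x, y) \<in> right_translate G g r \<or> (y, x) \<in> right_translate G g r"
    using orderingsD(6)[OF r, of "x \<otimes> g" "y \<otimes> g"] g by (auto simp: right_translate_def)
next
  fix f x y assume "f \<in> carrier G" "(x, y) \<in> right_translate G g r"
  then show "(f \<otimes> x, f \<otimes> y) \<in> right_translate G g r"
    using orderingsD(7)[OF r, of "x \<otimes> g" "y \<otimes> g" f] g by (auto simp: right_translate_def m_assoc)
qed

text \<open>In a finite orbit two translates by powers of \<open>b\<close> coincide, and the
  difference of the two exponents is the required \<open>n\<close>.\<close>

lemma (in group) exists_virtually_right_invariant_ordering:
  assumes "countable (orderings G)" "orderings G \<noteq> {}"
  shows "\<exists>r\<in>orderings G. \<forall>b\<in>carrier G. \<exists>n>0. \<forall>x\<in>carrier G. \<forall>y\<in>carrier G.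
    (x \<otimes> b [^] (n::nat), y \<otimes> b [^] n) \<in> r \<longleftrightarrow> (x, y) \<in> r"
proof -
  have mult: "right_translate G (g \<otimes> h) r = right_translate G g (right_translate G h r)"
    if "g \<in> carrier G" "h \<in> carrier G" for g h r
    using that by (auto simp: right_translate_def m_assoc)
  have one: "right_translate G \<one> r = r" if "r \<in> orderings G" for r
    using orderings_subset[OF that] by (auto simp: right_translate_def)
  have "\<exists>r\<in>topspace (space_of_orderings G). finite ((\<lambda>g. right_translate G g r) ` carrier G)"
  proof (rule exists_finite_orbit)
    show "continuous_map (space_of_orderings G) (space_of_orderings G) (right_translate G g)"
      if g: "g \<in> carrier G" for g
    proof (rule continuous_map_space_of_orderings)
      fix x y assume xy: "x \<in> carrier G" "y \<in> carrier G" "x \<noteq> y"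
      have "{r \<in> topspace (space_of_orderings G). (x, y) \<in> right_translate G g r} =
          ordering_subbasic G (x \<otimes> g) (y \<otimes> g)"
        using xy g by (auto simp: right_translate_def ordering_subbasic_def)
      then show "openin (space_of_orderings G)
          {r \<in> topspace (space_of_orderings G). (x, y) \<in> right_translate G g r}"
        using xy g openin_ordering_subbasic[of "x \<otimes> g" G "y \<otimes> g"] by simp
    qed (use right_translate_in_orderings g in auto)
  qed (use assms compact_space_of_orderings Hausdorff_space_of_orderings one mult in auto)
  then obtain r where r: "r \<in> orderings G" "finite ((\<lambda>g. right_translate G g r) ` carrier G)" by auto
  have "\<exists>n>0. \<forall>x\<in>carrier G. \<forall>y\<in>carrier G. (x \<otimes> b [^] (n::nat), y \<otimes> b [^] n) \<in> r \<longleftrightarrow> (x, y) \<in> r"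
    if b: "b \<in> carrier G" for b
  proof -
    let ?t = "\<lambda>n::nat. right_translate G (b [^] n) r"
    have "finite (range ?t)" using b by (intro finite_subset[OF _ r(2)]) auto
    then have "\<not> inj ?t" using finite_imageD by blast
    then obtain i j where ij: "i < j" "?t i = ?t j" unfolding inj_def by (metis linorder_neqE_nat)
    define n where "n = j - i"
    have j: "b [^] i \<otimes> b [^] n = b [^] j" using ij(1) b by (simp add: n_def nat_pow_mult)
    have "(x \<otimes> b [^] n, y \<otimes> b [^] n) \<in> r \<longleftrightarrow> (x, y) \<in> r" if xy: "x \<in> carrier G" "y \<in> carrier G" for x y
    proof -
      let ?x = "x \<otimes> inv (b [^] i)" let ?y = "y \<otimes> inv (b [^] i)"
      have c: "inv (b [^] i) \<otimes> b [^] j = b [^] n"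
        using b by (simp flip: j)
      have "(?x, ?y) \<in> ?t i \<longleftrightarrow> (?x, ?y) \<in> ?t j" using ij(2) by simp
      then show ?thesis using xy b c by (simp add: right_translate_def m_assoc)
    qed
    moreover have "n > 0" using ij(1) by (simp add: n_def)
    ultimately show ?thesis by blast
  qed
  then show ?thesis using r(1) by blast
qed

section \<open>Convex subgroups\<close>

lemma finite_if_countable_Pow:
  assumes "countable (Pow A)"
  shows "finite A"
proof (rule ccontr)
  assume "infinite A"
  then obtain f :: "nat \<Rightarrow> 'a" where f: "inj f" "range f \<subseteq> A"
    using infinite_countable_subset by blast
  have "inj (image f)" using f(1) by (simp add: inj_image_eq_iff inj_on_def)
  moreover have "countable (range (image f))"
    using assms by (rule countable_subset[rotated]) (use f(2) in blast)
  ultimately have "countable (UNIV :: nat set set)" by (rule countable_image_inj_on[rotated])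
  then have "range (from_nat_into (UNIV :: nat set set)) = Pow UNIV"
    by (simp add: range_from_nat_into)
  then show False using Cantors_theorem[of "UNIV :: nat set"] by blast
qed

context left_ordered_group
begin

text \<open>Convexity is demanded only above \<one>; \<open>convex_greater\<close> recovers the
  other side by a left translation.\<close>

definition convex_subgroup :: "'a set \<Rightarrow> bool" where
  "convex_subgroup C \<longleftrightarrow> subgroup C G \<and> (\<forall>x. \<forall>y\<in>C. (\<one>, x) \<in> r \<longrightarrow> (x, y) \<in> r \<longrightarrow> x \<in> C)"

lemma convex_subgroupD:
  assumes "convex_subgroup C"
  shows "subgroup C G" "C \<subseteq> carrier G" "\<one> \<in> C"
    and "x \<in> C \<Longrightarrow> y \<in> C \<Longrightarrow> x \<otimes> y \<in> C" "x \<in> C \<Longrightarrow> inv x \<in> C"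
    and "(\<one>, x) \<in> r \<Longrightarrow> (x, y) \<in> r \<Longrightarrow> y \<in> C \<Longrightarrow> x \<in> C"
  using assms by (auto simp: convex_subgroup_def subgroup.m_closed subgroup.m_inv_closed
      subgroup.one_closed dest: subgroup.subset)

lemma subgroup_inv_iff: "subgroup C G \<Longrightarrow> x \<in> carrier G \<Longrightarrow> inv x \<in> C \<longleftrightarrow> x \<in> C"
  by (metis inv_inv subgroup.m_inv_closed)

lemma subgroup_mult_iff:
  assumes "subgroup C G" "x \<in> carrier G" "y \<in> carrier G"
  shows "x \<in> C \<Longrightarrow> x \<otimes> y \<in> C \<longleftrightarrow> y \<in> C" "y \<in> C \<Longrightarrow> x \<otimes> y \<in> C \<longleftrightarrow> x \<in> C"
proof -
  show "x \<otimes> y \<in> C \<longleftrightarrow> y \<in> C" if "x \<in> C"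
    using that assms subgroup.m_closed[of C G "inv x" "x \<otimes> y"] subgroup.m_inv_closed[of C G x]
      subgroup.m_closed[of C G x y] by auto
  show "x \<otimes> y \<in> C \<longleftrightarrow> x \<in> C" if "y \<in> C"
    using that assms subgroup.m_closed[of C G "x \<otimes> y" "inv y"] subgroup.m_inv_closed[of C G y]
      subgroup.m_closed[of C G x y] by (auto simp: m_assoc)
qed

lemma inv_pos: "(\<one>, x) \<notin> r \<Longrightarrow> x \<in> carrier G \<Longrightarrow> \<one> \<sqsubset> inv x"
  using total[of \<one> x] le_inv[of x] by (metis inv_inv inv_one one_closed)

lemma convex_less:
  assumes C: "convex_subgroup C" and x: "x \<notin> C" "\<one> \<sqsubset> x" and c: "c \<in> C"
  shows "c \<sqsubset> x"
proof -
  have "c \<in> carrier G" "x \<in> carrier G" using convex_subgroupD(2)[OF C] c x carrierD by auto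
  then show ?thesis using convex_subgroupD(6)[OF C, of x c] x c not_le by blast
qed

text \<open>Inversion does not reverse a left order, so this is not \<open>convex_less\<close>
  applied to inverses. Instead, \<open>c\<close> below \<open>x\<close> would put
  \<open>inv c \<otimes> x\<close> between \<one> and \<open>inv c\<close>, hence into
  \<open>C\<close>.\<close>

lemma convex_greater:
  assumes C: "convex_subgroup C" and x: "x \<notin> C" "x \<sqsubset> \<one>" and c: "c \<in> C"
  shows "x \<sqsubset> c"
proof -
  have G: "c \<in> carrier G" "x \<in> carrier G" using convex_subgroupD(2)[OF C] c x carrierD by auto
  have "\<not> (c, x) \<in> r"
  proof
    assume "(c, x) \<in> r"
    then have "(\<one>, inv c \<otimes> x) \<in> r" using le_iff G by blast
    moreover have "(inv c \<otimes> x, inv c) \<in> r" using mult_le[of x \<one> "inv c"] x G by simp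
    ultimately have "inv c \<otimes> x \<in> C" using convex_subgroupD(5,6)[OF C] c by blast
    then show False
      using x c G subgroup_mult_iff[of C "inv c" x] convex_subgroupD(1,5)[OF C] by simp
  qed
  then show ?thesis using not_le G by blast
qed

text \<open>A factor from \<open>C\<close> cannot change the sign of an element outside:
  \<open>y\<close> lies above \<open>inv x\<close>, and \<open>inv y\<close> lies below
  \<open>x\<close>.\<close>

lemma convex_mult_pos:
  assumes C: "convex_subgroup C" and x: "x \<in> C" and y: "y \<notin> C" "\<one> \<sqsubset> y"
  shows "\<one> \<sqsubset> x \<otimes> y" "\<one> \<sqsubset> y \<otimes> x"
proof -
  have G: "x \<in> carrier G" "y \<in> carrier G" using convex_subgroupD(2)[OF C] x y carrierD by auto
  have nC: "x \<otimes> y \<notin> C" "y \<otimes> x \<notin> C"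
    using subgroup_mult_iff[OF convex_subgroupD(1)[OF C]] G x y by auto
  have ne: "x \<otimes> y \<noteq> \<one>" "y \<otimes> x \<noteq> \<one>"
    using nC convex_subgroupD(3)[OF C] by auto
  have "(inv x, y) \<in> r" using convex_less[OF C y] convex_subgroupD(5)[OF C x] by blast
  then show "\<one> \<sqsubset> x \<otimes> y" using le_iff[of "inv x" y] G ne by auto
  have "inv y \<notin> C" using subgroup_inv_iff convex_subgroupD(1)[OF C] y G by blast
  moreover have "inv y \<sqsubset> \<one>" using y G inv_le[of y] by auto
  ultimately have "(inv y, x) \<in> r" using convex_greater[OF C] x by blast
  then show "\<one> \<sqsubset> y \<otimes> x" using le_iff[of "inv y" x] G ne by auto
qed

text \<open>A positive element of \<open>C\<close> outside \<open>D\<close> and one of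
  \<open>D\<close> outside \<open>C\<close> would be comparable, and convexity would absorb the
  smaller one.\<close>

lemma convex_chain:
  assumes C: "convex_subgroup C" and D: "convex_subgroup D"
  shows "C \<subseteq> D \<or> D \<subseteq> C"
proof (rule ccontr)
  assume "\<not> ?thesis"
  then obtain c d where cd: "c \<in> C" "c \<notin> D" "d \<in> D" "d \<notin> C" by blast
  have G: "c \<in> carrier G" "d \<in> carrier G" using cd convex_subgroupD(2) C D by blast+
  have pos: "\<exists>x'. x' \<in> A \<and> x' \<notin> B \<and> (\<one>, x') \<in> r"
    if "x \<in> A" "x \<notin> B" "convex_subgroup A" "convex_subgroup B" for x A B
  proof (cases "(\<one>, x) \<in> r")
    case False
    have x: "x \<in> carrier G" using that convex_subgroupD(2) by blast
    then have "(\<one>, inv x) \<in> r" using False total[of \<one> x] le_inv by blast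
    then show ?thesis
      using that x subgroup_inv_iff convex_subgroupD(1,5) by (intro exI[of _ "inv x"]) auto
  qed (use that in blast)
  obtain c' where c': "c' \<in> C" "c' \<notin> D" "(\<one>, c') \<in> r" using pos[OF cd(1,2) C D] by blast
  obtain d' where d': "d' \<in> D" "d' \<notin> C" "(\<one>, d') \<in> r" using pos[OF cd(3,4) D C] by blast
  show False
    using total[of c' d'] c' d' carrierD convex_subgroupD(6)[OF C] convex_subgroupD(6)[OF D] by blast
qed

lemma convex_subgroup_one: "convex_subgroup {\<one>}"
  unfolding convex_subgroup_def using triv_subgroup antisym by auto

lemma convex_subgroup_carrier: "convex_subgroup (carrier G)"
  unfolding convex_subgroup_def using subgroup_self carrierD by auto

section \<open>Reversing an ordering on chosen levels\<close>

definition convex_level :: "'a \<Rightarrow> 'a set set" where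
  "convex_level x = {C. convex_subgroup C \<and> x \<in> C}"

lemma convex_level_inv: "x \<in> carrier G \<Longrightarrow> convex_level (inv x) = convex_level x"
  unfolding convex_level_def using subgroup_inv_iff convex_subgroupD(1) by blast

text \<open>\<open>J = UNIV\<close> gives back the positive cone of \<open>r\<close>. Every
  \<open>J\<close> is admissible, because a product of elements of different levels takes its level
  and sign from the factor lying outside more convex subgroups.\<close>

definition flip_cone :: "'a set set set \<Rightarrow> 'a set" where
  "flip_cone J = {x \<in> carrier G. x \<noteq> \<one> \<and> ((\<one>, x) \<in> r \<longleftrightarrow> convex_level x \<in> J)}"

lemma flip_cone_mult_level_eq:
  assumes x: "x \<in> flip_cone J" and y: "y \<in> flip_cone J" and eq: "convex_level x = convex_level y"
  shows "x \<otimes> y \<in> flip_cone J"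
proof -
  have key: "a \<otimes> b \<noteq> \<one> \<and> (\<one>, a \<otimes> b) \<in> r \<and> convex_level (a \<otimes> b) = convex_level a"
    if "\<one> \<sqsubset> a" "\<one> \<sqsubset> b" "convex_level a = convex_level b" for a b
  proof -
    have ab: "a \<in> carrier G" "b \<in> carrier G" using that carrierD by auto
    have le: "(a, a \<otimes> b) \<in> r" using mult_ge that ab by blast
    have "\<one> \<sqsubset> a \<otimes> b" using lt_le_trans[OF that(1) le] .
    moreover have "a \<in> C \<longleftrightarrow> a \<otimes> b \<in> C" if C: "convex_subgroup C" for C
    proof -
      have "a \<in> C \<longleftrightarrow> b \<in> C" using C \<open>convex_level a = convex_level b\<close> unfolding convex_level_def by blast
      then show ?thesis using convex_subgroupD(4,6)[OF C] le \<open>\<one> \<sqsubset> a\<close> by blast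
    qed
    then have "convex_level (a \<otimes> b) = convex_level a" unfolding convex_level_def by blast
    ultimately show ?thesis by auto
  qed
  have G: "x \<in> carrier G" "y \<in> carrier G" "x \<noteq> \<one>" "y \<noteq> \<one>" using x y by (auto simp: flip_cone_def)
  show ?thesis
  proof (cases "(\<one>, x) \<in> r")
    case True
    then have "convex_level x \<in> J" using x by (simp add: flip_cone_def)
    then have "(\<one>, y) \<in> r" using y eq by (simp add: flip_cone_def)
    then show ?thesis using key[of x y] True G eq x by (auto simp: flip_cone_def)
  next
    case False
    then have nJ: "convex_level x \<notin> J" using x by (simp add: flip_cone_def)
    then have "(\<one>, y) \<notin> r" using y eq by (simp add: flip_cone_def)
    then have "\<one> \<sqsubset> inv x" "\<one> \<sqsubset> inv y" using False G inv_pos by blast+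
    then have k: "inv y \<otimes> inv x \<noteq> \<one>" "(\<one>, inv y \<otimes> inv x) \<in> r"
      "convex_level (inv y \<otimes> inv x) = convex_level y"
      using key[of "inv y" "inv x"] G eq convex_level_inv by auto
    have i: "inv y \<otimes> inv x = inv (x \<otimes> y)" using G by (simp add: inv_mult_group)
    have "x \<otimes> y \<noteq> \<one>" using k(1) G i by auto
    moreover have "(\<one>, x \<otimes> y) \<notin> r" using k(2) i G le_inv[of "x \<otimes> y"] antisym \<open>x \<otimes> y \<noteq> \<one>\<close> by auto
    moreover have "convex_level (x \<otimes> y) = convex_level x"
      using k(3) i G eq convex_level_inv[of "x \<otimes> y"] by simp
    ultimately show ?thesis using nJ G by (simp add: flip_cone_def)
  qed
qed

lemma mult_level_less:
  assumes G: "x \<in> carrier G" "y \<in> carrier G"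
    and C: "convex_subgroup C" "x \<in> C" "y \<notin> C"
  shows "convex_level (x \<otimes> y) = convex_level y" "convex_level (y \<otimes> x) = convex_level y"
    and "x \<otimes> y \<noteq> \<one>" "y \<otimes> x \<noteq> \<one>"
    and "(\<one>, x \<otimes> y) \<in> r \<longleftrightarrow> (\<one>, y) \<in> r" "(\<one>, y \<otimes> x) \<in> r \<longleftrightarrow> (\<one>, y) \<in> r"
proof -
  have nC: "x \<otimes> y \<notin> C" "y \<otimes> x \<notin> C"
    using subgroup_mult_iff[OF convex_subgroupD(1)[OF C(1)]] G C by auto
  show ne: "x \<otimes> y \<noteq> \<one>" "y \<otimes> x \<noteq> \<one>"
    using nC convex_subgroupD(3)[OF C(1)] by auto
  have y1: "y \<noteq> \<one>" using C convex_subgroupD(3) by blast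
  have "(x \<otimes> y \<in> D \<longleftrightarrow> y \<in> D) \<and> (y \<otimes> x \<in> D \<longleftrightarrow> y \<in> D)" if D: "convex_subgroup D" for D
  proof (cases "C \<subseteq> D")
    case True
    then show ?thesis using subgroup_mult_iff[OF convex_subgroupD(1)[OF D]] G C by blast
  next
    case False
    then have "D \<subseteq> C" using convex_chain[OF C(1) D] by blast
    then show ?thesis using nC C by blast
  qed
  then show "convex_level (x \<otimes> y) = convex_level y" "convex_level (y \<otimes> x) = convex_level y"
    unfolding convex_level_def by blast+
  have neg: "x \<otimes> y \<sqsubset> \<one> \<and> y \<otimes> x \<sqsubset> \<one>" if "(\<one>, y) \<notin> r"
  proof -
    have "\<one> \<sqsubset> inv y" using inv_pos that G(2) by blast
    moreover have "inv y \<notin> C" "inv x \<in> C" using subgroup_inv_iff convex_subgroupD(1)[OF C(1)] G C by auto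
    ultimately have "\<one> \<sqsubset> inv x \<otimes> inv y" "\<one> \<sqsubset> inv y \<otimes> inv x" using convex_mult_pos C(1) by blast+
    then have "\<one> \<sqsubset> inv (y \<otimes> x)" "\<one> \<sqsubset> inv (x \<otimes> y)" using G by (simp_all add: inv_mult_group)
    then show ?thesis using le_inv[of "x \<otimes> y"] le_inv[of "y \<otimes> x"] G ne by auto
  qed
  show "(\<one>, x \<otimes> y) \<in> r \<longleftrightarrow> (\<one>, y) \<in> r" "(\<one>, y \<otimes> x) \<in> r \<longleftrightarrow> (\<one>, y) \<in> r"
    using convex_mult_pos[OF C(1,2,3)] neg y1 antisym by blast+
qed

lemma flip_cone_in_orderings: "cone_order G (flip_cone J) \<in> orderings G"
proof (rule cone_order_in_orderings)
  fix x y assume xy: "x \<in> flip_cone J" "y \<in> flip_cone J"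
  then have G: "x \<in> carrier G" "y \<in> carrier G" by (auto simp: flip_cone_def)
  consider "convex_level x = convex_level y" | C where "convex_subgroup C" "x \<in> C" "y \<notin> C"
    | C where "convex_subgroup C" "y \<in> C" "x \<notin> C"
    unfolding convex_level_def by blast
  then show "x \<otimes> y \<in> flip_cone J"
  proof cases
    case 1
    then show ?thesis using flip_cone_mult_level_eq xy by blast
  next
    case 2
    show ?thesis using mult_level_less[OF G 2] xy G by (simp add: flip_cone_def)
  next
    case 3
    show ?thesis using mult_level_less[OF G(2,1) 3] xy G by (simp add: flip_cone_def)
  qed
next
  fix x assume x: "x \<in> carrier G" "x \<noteq> \<one>"
  then have "(\<one>, inv x) \<in> r \<longleftrightarrow> (\<one>, x) \<notin> r" using le_inv total[of \<one> x] antisym[of x \<one>] by auto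
  then show "x \<in> flip_cone J \<or> inv x \<in> flip_cone J"
    using x convex_level_inv[of x] by (auto simp: flip_cone_def)
qed (auto simp: flip_cone_def)

lemma finite_convex_subgroups:
  assumes cnt: "countable (orderings G)"
  shows "finite {C. convex_subgroup C}"
proof -
  let ?L = "convex_level ` (carrier G - {\<one>})"
  have "inj_on (\<lambda>J. cone_order G (flip_cone J)) (Pow ?L)"
  proof (rule inj_onI)
    fix J K assume JK: "J \<in> Pow ?L" "K \<in> Pow ?L"
      and eq: "cone_order G (flip_cone J) = cone_order G (flip_cone K)"
    have mem: "l \<in> J \<longleftrightarrow> l \<in> K" if l: "l \<in> ?L" for l
    proof -
      obtain y where "l = convex_level y" "y \<in> carrier G - {\<one>}" using l by (rule imageE)
      then have y: "y \<in> carrier G" "y \<noteq> \<one>" "l = convex_level y" by auto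
      \<comment> \<open>Every level contains a positive element, whose sign in the flipped ordering
        reveals whether the level belongs to \<open>J\<close>.\<close>
      obtain x where x: "x \<in> carrier G" "x \<noteq> \<one>" "l = convex_level x" "(\<one>, x) \<in> r"
      proof (cases "(\<one>, y) \<in> r")
        case False
        then have "(\<one>, inv y) \<in> r" using total[of \<one> y] y le_inv by blast
        then show ?thesis using that[of "inv y"] y convex_level_inv by simp
      qed (use that y in blast)
      have "(\<one>, x) \<in> cone_order G (flip_cone M) \<longleftrightarrow> l \<in> M" for M
        using x by (auto simp: cone_order_def flip_cone_def)
      then show ?thesis using eq by metis
    qed
    then show "J = K" using JK by blast
  qed
  moreover have "(\<lambda>J. cone_order G (flip_cone J)) ` Pow ?L \<subseteq> orderings G"
    using flip_cone_in_orderings by blast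
  ultimately have "countable (Pow ?L)"
    using cnt countable_image_inj_on countable_subset by blast
  then have fin: "finite ?L" by (rule finite_if_countable_Pow)
  \<comment> \<open>A convex subgroup is determined by the levels that contain it, so finitely many
    levels allow only finitely many convex subgroups.\<close>
  have "inj_on (\<lambda>C. {l \<in> ?L. C \<in> l}) {C. convex_subgroup C}"
  proof (rule inj_onI)
    fix C D assume C: "C \<in> {C. convex_subgroup C}" and D: "D \<in> {C. convex_subgroup C}"
      and eq: "{l \<in> ?L. C \<in> l} = {l \<in> ?L. D \<in> l}"
    have "x \<in> C \<longleftrightarrow> x \<in> D" if "x \<in> carrier G" for x
    proof (cases "x = \<one>")
      case False
      then have "C \<in> convex_level x \<longleftrightarrow> D \<in> convex_level x" using eq that by blast
      then show ?thesis using C D by (simp add: convex_level_def)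
    qed (use C D convex_subgroupD(3) in auto)
    then show "C = D" using C D convex_subgroupD(2) by blast
  qed
  moreover have "finite ((\<lambda>C. {l \<in> ?L. C \<in> l}) ` {C. convex_subgroup C})"
    using fin by (intro finite_subset[OF _ finite_Pow_iff[THEN iffD2, OF fin]]) blast
  ultimately show ?thesis using finite_imageD by blast
qed

end

section \<open>Hoelder's theorem for archimedean preorders\<close>

definition real_hom :: "('a, 'b) monoid_scheme \<Rightarrow> ('a \<Rightarrow> real) \<Rightarrow> bool" where
  "real_hom G f \<longleftrightarrow> (\<forall>x\<in>carrier G. \<forall>y\<in>carrier G. f (x \<otimes>\<^bsub>G\<^esub> y) = f x + f y)"

lemma real_hom_mult:
  "\<lbrakk>real_hom G f; x \<in> carrier G; y \<in> carrier G\<rbrakk> \<Longrightarrow> f (x \<otimes>\<^bsub>G\<^esub> y) = f x + f y"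
  by (simp add: real_hom_def)

context group
begin

lemma real_hom_one: "real_hom G f \<Longrightarrow> f \<one> = 0"
  using real_hom_mult[of G f \<one> \<one>] by simp

lemma real_hom_inv: "real_hom G f \<Longrightarrow> x \<in> carrier G \<Longrightarrow> f (inv x) = - f x"
  using real_hom_mult[of G f x "inv x"] real_hom_one[of f] by simp

lemma real_hom_nat_pow: "real_hom G f \<Longrightarrow> x \<in> carrier G \<Longrightarrow> f (x [^] (n::nat)) = real n * f x"
  by (induction n) (auto simp: real_hom_one real_hom_mult algebra_simps)

lemma real_hom_int_pow: "real_hom G f \<Longrightarrow> x \<in> carrier G \<Longrightarrow> f (x [^] (k::int)) = of_int k * f x"
  by (cases k rule: int_cases2)
     (auto simp: int_pow_int int_pow_neg_int real_hom_nat_pow real_hom_inv)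

end

text \<open>A preorder instead of an order: in the application the elements equivalent to \<one>
  form the smaller subgroup of a convex jump, so Hoelder's argument applies without passing to a
  quotient.\<close>

locale archimedean_preordered_group = group G for G (structure) +
  fixes le :: "'a \<Rightarrow> 'a \<Rightarrow> bool"
  assumes le_total: "\<lbrakk>x \<in> carrier G; y \<in> carrier G\<rbrakk> \<Longrightarrow> le x y \<or> le y x"
    and le_trans: "\<lbrakk>x \<in> carrier G; y \<in> carrier G; z \<in> carrier G; le x y; le y z\<rbrakk> \<Longrightarrow> le x z"
    and mult_left: "\<lbrakk>x \<in> carrier G; y \<in> carrier G; z \<in> carrier G; le x y\<rbrakk> \<Longrightarrow> le (z \<otimes> x) (z \<otimes> y)"
    and mult_right: "\<lbrakk>x \<in> carrier G; y \<in> carrier G; z \<in> carrier G; le x y\<rbrakk> \<Longrightarrow> le (x \<otimes> z) (y \<otimes> z)"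
    and archimedean: "\<lbrakk>x \<in> carrier G; y \<in> carrier G; \<not> le x \<one>\<rbrakk> \<Longrightarrow> \<exists>n::nat. le y (x [^] n)"
begin

lemma le_refl: "x \<in> carrier G \<Longrightarrow> le x x"
  using le_total by blast

lemma mult_mono:
  assumes "a \<in> carrier G" "b \<in> carrier G" "c \<in> carrier G" "d \<in> carrier G" "le a b" "le c d"
  shows "le (a \<otimes> c) (b \<otimes> d)"
  using assms by (intro le_trans[of "a \<otimes> c" "b \<otimes> c" "b \<otimes> d"] mult_left mult_right) auto

lemma nat_pow_mono:
  assumes "x \<in> carrier G" "y \<in> carrier G" "le x y"
  shows "le (x [^] (n::nat)) (y [^] n)"
  using assms by (induction n) (auto intro: le_refl mult_mono)

lemma inv_antimono:
  assumes "x \<in> carrier G" "y \<in> carrier G" "le x y"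
  shows "le (inv y) (inv x)"
  using mult_right[OF _ _ _ mult_left[of x y "inv x"], of "inv y"] assms by (simp add: m_assoc)

text \<open>Without commutativity, the powers of \<open>b \<otimes> c\<close> are still bounded below by one of the
  products \<open>b [^] n \<otimes> c [^] n\<close> and \<open>c [^] n \<otimes> b [^] n\<close>.\<close>

lemma pow_mult_le:
  assumes G: "b \<in> carrier G" "c \<in> carrier G" and bc: "le (b \<otimes> c) (c \<otimes> b)"
  shows "le (b [^] (n::nat) \<otimes> c [^] n) ((b \<otimes> c) [^] n)"
proof (induction n)
  case (Suc n)
  have shift: "b \<otimes> (c \<otimes> b) [^] (n::nat) \<otimes> c = (b \<otimes> c) [^] Suc n" for n
  proof (induction n)
    case (Suc n)
    have "b \<otimes> (c \<otimes> b) [^] Suc n \<otimes> c = (b \<otimes> (c \<otimes> b) [^] n \<otimes> c) \<otimes> (b \<otimes> c)"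
      using G by (simp add: m_assoc)
    then show ?case using Suc by simp
  qed (use G in simp)
  have "b [^] Suc n \<otimes> c [^] Suc n = b \<otimes> (b [^] n \<otimes> c [^] n) \<otimes> c"
    using G nat_pow_Suc2[of b n] by (simp add: m_assoc)
  moreover have "le (b \<otimes> (b [^] n \<otimes> c [^] n) \<otimes> c) (b \<otimes> (b \<otimes> c) [^] n \<otimes> c)"
    using Suc G by (intro mult_right mult_left) auto
  moreover have "le (b \<otimes> (b \<otimes> c) [^] n \<otimes> c) (b \<otimes> (c \<otimes> b) [^] n \<otimes> c)"
    using bc G by (intro mult_right mult_left nat_pow_mono) auto
  ultimately show ?case
    using G le_trans[of "b [^] Suc n \<otimes> c [^] Suc n" "b \<otimes> (b \<otimes> c) [^] n \<otimes> c" "(b \<otimes> c) [^] Suc n"]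
    by (simp only: shift nat_pow_closed m_closed)
qed (use le_refl in simp)

context
  fixes e
  assumes e: "e \<in> carrier G" "\<not> le e \<one>"
begin

lemma unit_pow_le_iff: "le (e [^] (m::int)) (e [^] (k::int)) \<longleftrightarrow> m \<le> k"
proof -
  have one_e: "le \<one> e" using e le_total by blast
  have nat: "le \<one> (e [^] (n::nat))" for n using nat_pow_mono[of \<one> e n] one_e e by simp
  have pos: "le (e [^] m) (e [^] k)" if "m \<le> k" for m k :: int
  proof -
    have "e [^] k = e [^] m \<otimes> e [^] (nat (k - m))"
      using that e by (simp flip: int_pow_int int_pow_mult)
    then show ?thesis using mult_left[of \<one> "e [^] nat (k - m)" "e [^] m"] nat e by simp
  qed
  have "m \<le> k" if le: "le (e [^] m) (e [^] k)"
  proof (rule ccontr)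
    assume "\<not> m \<le> k"
    then have "le (e [^] (k + 1)) (e [^] m)" by (intro pos) auto
    then have "le (e [^] (k + 1)) (e [^] k)" using le le_trans e by (meson int_pow_closed)
    then have "le (inv (e [^] k) \<otimes> e [^] (k + 1)) (inv (e [^] k) \<otimes> e [^] k)"
      using mult_left[of "e [^] (k + 1)" "e [^] k" "inv (e [^] k)"] e by simp
    then show False using e by (simp add: int_pow_mult)
  qed
  then show ?thesis using pos by blast
qed

text \<open>The lower Dedekind cut of the ratio of \<open>b\<close> to the unit \<open>e\<close>;
  its supremum becomes the value of the homomorphism.\<close>

definition lower_cut :: "'a \<Rightarrow> real set" where
  "lower_cut b = {of_int m / of_nat n | m n. n > 0 \<and> le (e [^] (m::int)) (b [^] (n::nat))}"

definition position :: "'a \<Rightarrow> real" where "position b = Sup (lower_cut b)"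

lemma cut_le:
  assumes b: "b \<in> carrier G" and n: "n > 0" "n' > 0"
    and le: "le (e [^] (m::int)) (b [^] (n::nat))" "le (b [^] (n'::nat)) (e [^] (m'::int))"
  shows "real_of_int m / real n \<le> real_of_int m' / real n'"
proof -
  have "le ((e [^] m) [^] n') ((b [^] n) [^] n')" "le ((b [^] n') [^] n) ((e [^] m') [^] n)"
    using le b e by (auto intro: nat_pow_mono)
  moreover have "(b [^] n) [^] n' = (b [^] n') [^] n" using b by (simp add: nat_pow_pow mult.commute)
  ultimately have "le ((e [^] m) [^] n') ((e [^] m') [^] n)"
    using le_trans[of "(e [^] m) [^] n'" "(b [^] n) [^] n'" "(e [^] m') [^] n"] b e by auto
  then have "m * int n' \<le> m' * int n"
    using e by (simp add: int_pow_pow unit_pow_le_iff flip: int_pow_int)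
  then have "real_of_int (m * int n') \<le> real_of_int (m' * int n)" by linarith
  then show ?thesis using n by (simp add: field_simps)
qed

lemma lower_cut:
  assumes b: "b \<in> carrier G"
  shows "lower_cut b \<noteq> {}" "bdd_above (lower_cut b)"
proof -
  obtain k :: nat where "le (inv b) (e [^] k)" using archimedean[of e "inv b"] b e by auto
  then have "le (inv (e [^] k)) b" using inv_antimono[of "inv b" "e [^] k"] b e by simp
  then have "le (e [^] (- int k)) (b [^] (1::nat))" using b e by (simp add: int_pow_neg_int)
  then show "lower_cut b \<noteq> {}" unfolding lower_cut_def using zero_less_one[where 'a=nat] by blast
  obtain l :: nat where "le b (e [^] l)" using archimedean[of e b] b e by auto
  then have "le (b [^] (1::nat)) (e [^] int l)" using b e by (simp add: int_pow_int)
  then show "bdd_above (lower_cut b)"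
    unfolding lower_cut_def bdd_above_def using cut_le[OF b, of _ 1] by (auto simp: intro!: exI)
qed

lemma position_lower:
  assumes b: "b \<in> carrier G" and n: "n > 0" and le: "le (e [^] (m::int)) (b [^] (n::nat))"
  shows "of_int m / of_nat n \<le> position b"
  unfolding position_def by (rule cSup_upper) (use lower_cut[OF b] le n in \<open>auto simp: lower_cut_def\<close>)

lemma position_upper:
  assumes b: "b \<in> carrier G" and n: "n > 0" and le: "le (b [^] (n::nat)) (e [^] (m::int))"
  shows "position b \<le> of_int m / of_nat n"
  unfolding position_def
  by (rule cSup_least) (use lower_cut[OF b] cut_le[OF b _ n _ le] in \<open>auto simp: lower_cut_def\<close>)

lemma less_position:
  assumes b: "b \<in> carrier G" and n: "n > 0" and less: "of_int m / of_nat n < position b"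
  shows "le (e [^] (m::int)) (b [^] (n::nat))"
proof (rule ccontr)
  assume "\<not> ?thesis"
  then have "le (b [^] n) (e [^] m)" using le_total[of "b [^] n" "e [^] m"] b e by auto
  then show False using position_upper[OF b n] less by fastforce
qed

lemma position_less:
  assumes b: "b \<in> carrier G" and n: "n > 0" and less: "position b < of_int m / of_nat n"
  shows "le (b [^] (n::nat)) (e [^] (m::int))"
proof (rule ccontr)
  assume "\<not> ?thesis"
  then have "le (e [^] m) (b [^] n)" using le_total[of "b [^] n" "e [^] m"] b e by auto
  then show False using position_lower[OF b n] less by fastforce
qed

lemma position_superadditive:
  assumes b: "b \<in> carrier G" and c: "c \<in> carrier G"
  shows "position b + position c \<le> position (b \<otimes> c)"
proof -
  have bound: "position b + position c - 2 / real n \<le> position (b \<otimes> c)" if n: "n > 0" for n :: nat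
  proof -
    \<comment> \<open>The largest integer strictly below \<open>n * position b\<close>:
      \<open>less_position\<close> needs a strict inequality. Rounding loses at most 1 for each
      factor, whence the error \<open>2 / n\<close>.\<close>
    define m where "m = \<lceil>n * position b\<rceil> - 1"
    define k where "k = \<lceil>n * position c\<rceil> - 1"
    have m: "n * position b - 1 \<le> m" "m < n * position b" unfolding m_def by linarith+
    have k: "n * position c - 1 \<le> k" "k < n * position c" unfolding k_def by linarith+
    have le: "le (e [^] m) (b [^] n)" "le (e [^] k) (c [^] n)"
      using m(2) k(2) n b c by (auto intro!: less_position simp: field_simps)
    have "le (e [^] (m + k)) ((b \<otimes> c) [^] n)"
    proof (cases "le (b \<otimes> c) (c \<otimes> b)")
      case True
      have "le (e [^] m \<otimes> e [^] k) (b [^] n \<otimes> c [^] n)" using le b c e by (intro mult_mono) auto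
      moreover have "le (b [^] n \<otimes> c [^] n) ((b \<otimes> c) [^] n)" by (rule pow_mult_le[OF b c True])
      ultimately show ?thesis
        using le_trans[of "e [^] m \<otimes> e [^] k" "b [^] n \<otimes> c [^] n" "(b \<otimes> c) [^] n"] b c e
        by (simp add: int_pow_mult)
    next
      case False
      then have cb: "le (c \<otimes> b) (b \<otimes> c)" using le_total b c by blast
      have "le (e [^] k \<otimes> e [^] m) (c [^] n \<otimes> b [^] n)" using le b c e by (intro mult_mono) auto
      moreover have "le (c [^] n \<otimes> b [^] n) ((c \<otimes> b) [^] n)" by (rule pow_mult_le[OF c b cb])
      moreover have "le ((c \<otimes> b) [^] n) ((b \<otimes> c) [^] n)" using cb b c by (intro nat_pow_mono) auto
      moreover have "e [^] (m + k) = e [^] k \<otimes> e [^] m" using e by (metis add.commute int_pow_mult)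
      ultimately show ?thesis
        using le_trans[of "e [^] k \<otimes> e [^] m" "c [^] n \<otimes> b [^] n" "(c \<otimes> b) [^] n"]
          le_trans[of "e [^] k \<otimes> e [^] m" "(c \<otimes> b) [^] n" "(b \<otimes> c) [^] n"] b c e
        by simp
    qed
    then have "of_int (m + k) / real n \<le> position (b \<otimes> c)" using b c n by (intro position_lower) auto
    moreover have "position b + position c - 2 / real n \<le> of_int (m + k) / real n"
    proof -
      have "n * position b + n * position c - 2 \<le> of_int (m + k)" using m(1) k(1) by simp
      then have "(n * position b + n * position c - 2) / n \<le> of_int (m + k) / n"
        by (rule divide_right_mono) simp
      then show ?thesis using n by (simp add: add_divide_distrib diff_divide_distrib)
    qed
    ultimately show ?thesis by linarith
  qed
  show ?thesis
  proof (rule field_le_epsilon)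
    fix d :: real assume "d > 0"
    then obtain n :: nat where "n > 0" "2 / d < n" using reals_Archimedean2[of "max 1 (2 / d)"]
      by (metis less_max_iff_disj max_less_iff_conj of_nat_0_less_iff zero_less_one order_less_trans)
    then have "2 / real n < d" using \<open>d > 0\<close> by (simp add: field_simps)
    then show "position b + position c \<le> position (b \<otimes> c) + d" using bound[OF \<open>n > 0\<close>] by linarith
  qed
qed

text \<open>Inverting a comparison of \<open>b [^] n\<close> with a power of \<open>e\<close> gives
  this inequality; together with superadditivity it forces \<open>position\<close> to be
  additive.\<close>

lemma position_inv:
  assumes b: "b \<in> carrier G"
  shows "position (inv b) \<ge> - position b"
proof (rule ccontr)
  assume "\<not> ?thesis"
  then obtain q where q: "q \<in> \<rat>" "position b < q" "q < - position (inv b)"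
    using Rats_dense_in_real[of "position b" "- position (inv b)"] by auto
  obtain m :: int and n :: nat where mn: "n > 0" "q = of_int m / of_nat n"
    using q(1) by (metis Rats_cases' of_int_of_nat_eq zero_less_imp_eq_int of_nat_0_less_iff)
  have "le (b [^] n) (e [^] m)" using position_less[OF b mn(1)] q(2) mn(2) by simp
  then have "le (e [^] (- m)) (inv b [^] n)"
    using inv_antimono[of "b [^] n" "e [^] m"] b e by (simp add: int_pow_neg nat_pow_inv)
  then have "of_int (- m) / of_nat n \<le> position (inv b)" using b mn(1) by (intro position_lower) auto
  then show False using q(3) mn(2) by simp
qed

lemma real_hom_position: "real_hom G position"
  unfolding real_hom_def
proof (intro ballI antisym)
  fix b c assume bc: "b \<in> carrier G" "c \<in> carrier G"
  show "position b + position c \<le> position (b \<otimes> c)" by (rule position_superadditive[OF bc])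
  have "position (b \<otimes> c) + position (inv c) \<le> position (b \<otimes> c \<otimes> inv c)"
    using bc by (intro position_superadditive) auto
  then show "position (b \<otimes> c) \<le> position b + position c"
    using position_inv[OF bc(2)] bc by (simp add: m_assoc)
qed

lemma position_le_iff:
  assumes G: "x \<in> carrier G" "y \<in> carrier G"
  shows "le x y \<longleftrightarrow> position x \<le> position y"
proof
  assume le: "le x y"
  show "position x \<le> position y" unfolding position_def
  proof (rule cSup_subset_mono)
    show "lower_cut x \<subseteq> lower_cut y"
    proof
      fix q assume "q \<in> lower_cut x"
      then obtain m n where mn: "q = of_int m / of_nat n" "n > 0" "le (e [^] (m::int)) (x [^] (n::nat))"
        unfolding lower_cut_def by blast
      have "le (e [^] m) (y [^] n)"
        using le_trans[of "e [^] m" "x [^] n" "y [^] n"] mn(3) nat_pow_mono[OF G le] G e by simp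
      then show "q \<in> lower_cut y" unfolding lower_cut_def using mn by blast
    qed
  qed (use lower_cut G in auto)
next
  assume pos: "position x \<le> position y"
  show "le x y"
  proof (rule ccontr)
    assume n: "\<not> le x y"
    have "\<not> le (inv y \<otimes> x) \<one>"
    proof
      assume "le (inv y \<otimes> x) \<one>"
      then have "le (y \<otimes> (inv y \<otimes> x)) (y \<otimes> \<one>)" using G by (intro mult_left) auto
      then show False using n G by simp
    qed
    \<comment> \<open>An element strictly above \<one> has a power above the unit, so its position
      is at least \<open>1 / k\<close> and hence positive.\<close>
    then obtain k :: nat where k: "le e ((inv y \<otimes> x) [^] k)" using archimedean[of "inv y \<otimes> x" e] G e by auto
    have "k > 0" using k e by (cases k) auto
    moreover have "le (e [^] (1::int)) ((inv y \<otimes> x) [^] k)" using k e by simp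
    ultimately have "of_int 1 / of_nat k \<le> position (inv y \<otimes> x)"
      using G by (intro position_lower) auto
    moreover have "position (inv y \<otimes> x) = position x - position y"
      using G real_hom_mult[OF real_hom_position] real_hom_inv[OF real_hom_position] by simp
    moreover have "of_int 1 / real k > 0" using \<open>k > 0\<close> by simp
    ultimately show False using pos by linarith
  qed
qed

end

theorem Hoelder: "\<exists>f. real_hom G f \<and> (\<forall>x\<in>carrier G. \<forall>y\<in>carrier G. le x y \<longleftrightarrow> f x \<le> f y)"
proof (cases "\<exists>e\<in>carrier G. \<not> le e \<one>")
  case True
  then obtain e where e: "e \<in> carrier G" "\<not> le e \<one>" by blast
  then show ?thesis using real_hom_position[OF e] position_le_iff[OF e] by blast
next
  case False
  have "le x y" if "x \<in> carrier G" "y \<in> carrier G" for x y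
    using False mult_left[of "inv y \<otimes> x" \<one> y] that by simp
  then show ?thesis by (intro exI[of _ "\<lambda>_. 0"]) (simp add: real_hom_def)
qed

end

section \<open>Families of orderings\<close>

lemma countable_if_inj_on:
  assumes "inj_on f A" "f ` A \<subseteq> B" "countable B"
  shows "countable A"
  using assms(1) countable_subset[OF assms(2,3)] by (rule countable_image_inj_on[rotated])

context left_ordered_group
begin

lemma eq_if_positive_eq:
  assumes s: "s \<in> orderings G" and eq: "\<And>x. x \<in> carrier G \<Longrightarrow> (\<one>, x) \<in> r \<longleftrightarrow> (\<one>, x) \<in> s"
  shows "r = s"
proof -
  interpret s: left_ordered_group G s by unfold_locales (rule s)
  have "r \<subseteq> s"
  proof
    fix p assume "p \<in> r"
    then obtain x y where p: "p = (x, y)" "(x, y) \<in> r" by (cases p) auto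
    then have "x \<in> carrier G" "y \<in> carrier G" using carrierD by auto
    then show "p \<in> s" using p le_iff[of x y] s.le_iff[of x y] eq[of "inv x \<otimes> y"] by simp
  qed
  then show ?thesis using orderings_eqI ord s by blast
qed

section \<open>Orderings of subgroups\<close>

lemma Restr_in_orderings:
  assumes C: "subgroup C G"
  shows "Restr r C \<in> orderings (G\<lparr>carrier := C\<rparr>)"
proof -
  have sub: "C \<subseteq> carrier G" using C by (rule subgroup.subset)
  show ?thesis unfolding orderings_iff
  proof (intro conjI ballI impI)
    fix x assume "x \<in> carrier (G\<lparr>carrier := C\<rparr>)" then show "(x, x) \<in> Restr r C" using sub refl by auto
  next
    fix x y z assume "(x, y) \<in> Restr r C" "(y, z) \<in> Restr r C"
    then show "(x, z) \<in> Restr r C" using le_trans by blast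
  next
    fix x y assume "(x, y) \<in> Restr r C" "(y, x) \<in> Restr r C"
    then show "x = y" using antisym by blast
  next
    fix x y assume "x \<in> carrier (G\<lparr>carrier := C\<rparr>)" "y \<in> carrier (G\<lparr>carrier := C\<rparr>)"
    then show "(x, y) \<in> Restr r C \<or> (y, x) \<in> Restr r C" using total[of x y] sub by auto
  next
    fix f g h assume "f \<in> carrier (G\<lparr>carrier := C\<rparr>)" "(g, h) \<in> Restr r C"
    then show "(f \<otimes>\<^bsub>G\<lparr>carrier := C\<rparr>\<^esub> g, f \<otimes>\<^bsub>G\<lparr>carrier := C\<rparr>\<^esub> h) \<in> Restr r C"
      using mult_le[of g h f] sub subgroup.m_closed[OF C] by auto
  qed auto
qed

lemma left_ordered_subgroup:
  assumes "subgroup C G"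
  shows "left_ordered_group (G\<lparr>carrier := C\<rparr>) (Restr r C)"
  using subgroup_imp_group[OF assms] Restr_in_orderings[OF assms]
  by (simp add: left_ordered_group_def left_ordered_group_axioms_def)

text \<open>Any ordering of \<open>C\<close> can be put in place of the restriction of
  \<open>r\<close>, since factors from \<open>C\<close> do not affect the signs outside
  \<open>C\<close>. The glued ordering determines the ordering of \<open>C\<close>.\<close>

lemma countable_orderings_convex_subgroup:
  assumes C: "convex_subgroup C" and cnt: "countable (orderings G)"
  shows "countable (orderings (G\<lparr>carrier := C\<rparr>))"
proof -
  let ?C = "G\<lparr>carrier := C\<rparr>"
  note sub = convex_subgroupD(1)[OF C] and CG = convex_subgroupD(2)[OF C]
  define P where "P s = {x \<in> C. x \<noteq> \<one> \<and> (\<one>, x) \<in> s} \<union> {x. x \<notin> C \<and> \<one> \<sqsubset> x}" for s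
  have glue: "cone_order G (P s) \<in> orderings G" if s: "s \<in> orderings ?C" for s
  proof -
    interpret s: left_ordered_group ?C s
      using subgroup_imp_group[OF sub] s by (simp add: left_ordered_group_def left_ordered_group_axioms_def)
    show ?thesis
    proof (rule cone_order_in_orderings)
      show "P s \<subseteq> carrier G" using CG carrierD by (auto simp: P_def)
      show "\<one> \<notin> P s" by (simp add: P_def)
      fix x y assume xy: "x \<in> P s" "y \<in> P s"
      then have G: "x \<in> carrier G" "y \<in> carrier G" using CG carrierD by (auto simp: P_def)
      note sm = subgroup_mult_iff[OF sub G]
      show "x \<otimes> y \<in> P s"
      proof (cases "x \<in> C"; cases "y \<in> C")
        assume c: "x \<in> C" "y \<in> C"
        then have xy': "s.lt \<one> x" "s.lt \<one> y" using xy by (auto simp: P_def)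
        then have "(x, x \<otimes> y) \<in> s" using s.mult_ge[of y x] c by simp
        then have "s.lt \<one> (x \<otimes> y)" using xy' s.lt_le_trans[of \<one> x "x \<otimes> y"] by simp
        then show ?thesis using c sm by (auto simp: P_def)
      next
        assume c: "x \<in> C" "y \<notin> C"
        then show ?thesis using convex_mult_pos(1)[OF C, of x y] xy sm by (auto simp: P_def)
      next
        assume c: "x \<notin> C" "y \<in> C"
        then show ?thesis using convex_mult_pos(2)[OF C, of y x] xy sm by (auto simp: P_def)
      next
        assume c: "x \<notin> C" "y \<notin> C"
        then have p: "\<one> \<sqsubset> x" "\<one> \<sqsubset> y" using xy by (auto simp: P_def)
        have "(x, x \<otimes> y) \<in> r" using mult_ge p G by blast
        then have "\<one> \<sqsubset> x \<otimes> y" using lt_le_trans[OF p(1)] by blast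
        moreover have "x \<otimes> y \<notin> C" using convex_subgroupD(6)[OF C] p c \<open>(x, x \<otimes> y) \<in> r\<close> by blast
        ultimately show ?thesis by (auto simp: P_def)
      qed
    next
      fix x assume x: "x \<in> carrier G" "x \<noteq> \<one>"
      show "x \<in> P s \<or> inv x \<in> P s"
      proof (cases "x \<in> C")
        case True
        then have i: "inv\<^bsub>?C\<^esub> x = inv x" using sub by simp
        have "(\<one>, x) \<in> s \<or> (\<one>, inv x) \<in> s"
          using s.inv_pos[of x] True unfolding i by auto
        then show ?thesis using x True convex_subgroupD(5)[OF C] by (auto simp: P_def)
      next
        case False
        then show ?thesis using x inv_pos[of x] subgroup_inv_iff[OF sub x(1)] by (auto simp: P_def)
      qed
    qed
  qed
  have "inj_on (\<lambda>s. cone_order G (P s)) (orderings ?C)"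
  proof (rule inj_onI)
    fix s t assume s: "s \<in> orderings ?C" and t: "t \<in> orderings ?C"
      and eq: "cone_order G (P s) = cone_order G (P t)"
    interpret s: left_ordered_group ?C s
      using subgroup_imp_group[OF sub] s by (simp add: left_ordered_group_def left_ordered_group_axioms_def)
    have pos: "(\<one>, x) \<in> u \<longleftrightarrow> (\<one>, x) \<in> cone_order G (P u)" if "u \<in> orderings ?C" "x \<in> C" for u x
      using that CG orderingsD(3)[of u ?C x] by (auto simp: cone_order_def P_def)
    show "s = t"
    proof (rule s.eq_if_positive_eq[OF t])
      fix x assume "x \<in> carrier ?C"
      then have x: "x \<in> C" by simp
      show "(\<one>\<^bsub>?C\<^esub>, x) \<in> s \<longleftrightarrow> (\<one>\<^bsub>?C\<^esub>, x) \<in> t"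
        using pos[OF s x] pos[OF t x] eq by simp
    qed
  qed
  moreover have "(\<lambda>s. cone_order G (P s)) ` orderings ?C \<subseteq> orderings G" using glue by blast
  ultimately show ?thesis using cnt by (rule countable_if_inj_on)
qed

text \<open>In the applications \<open>\<phi>\<close> is the orbit map of a point under an action by
  affine maps of the line; ties, which come from the stabilizer, are broken by
  \<open>r\<close>.\<close>

definition affine_order :: "('a \<Rightarrow> real) \<Rightarrow> 'a rel" where
  "affine_order \<phi> = {(x, y) \<in> carrier G \<times> carrier G. \<phi> x < \<phi> y \<or> \<phi> x = \<phi> y \<and> (x, y) \<in> r}"

lemma affine_order_in_orderings:
  assumes pos: "\<And>x. x \<in> carrier G \<Longrightarrow> \<mu> x > (0::real)"
    and equi: "\<And>x y. \<lbrakk>x \<in> carrier G; y \<in> carrier G\<rbrakk> \<Longrightarrow> \<phi> (x \<otimes> y) = \<mu> x * \<phi> y + d x"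
  shows "affine_order \<phi> \<in> orderings G"
  unfolding orderings_iff
proof (intro conjI ballI impI)
  fix x y z assume "(x, y) \<in> affine_order \<phi>" "(y, z) \<in> affine_order \<phi>"
  then show "(x, z) \<in> affine_order \<phi>" using le_trans by (auto simp: affine_order_def)
next
  fix x y assume "(x, y) \<in> affine_order \<phi>" "(y, x) \<in> affine_order \<phi>"
  then show "x = y" using antisym by (auto simp: affine_order_def)
next
  fix x y assume "x \<in> carrier G" "y \<in> carrier G"
  then show "(x, y) \<in> affine_order \<phi> \<or> (y, x) \<in> affine_order \<phi>"
    using total[of x y] by (auto simp: affine_order_def)
next
  fix f x y assume "f \<in> carrier G" "x \<in> carrier G" "y \<in> carrier G" "(x, y) \<in> affine_order \<phi>"
  then show "(f \<otimes> x, f \<otimes> y) \<in> affine_order \<phi>"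
    using mult_le[of x y f] pos[of f] by (auto simp: affine_order_def equi)
qed (auto simp: affine_order_def)

text \<open>The last hypothesis provides an element on opposite sides of \<one> for any two
  parameters, so the reals embed into the orderings.\<close>

lemma uncountable_if_affine_family:
  assumes pos: "\<And>x. x \<in> carrier G \<Longrightarrow> \<mu> x > (0::real)"
    and equi: "\<And>t x y. \<lbrakk>x \<in> carrier G; y \<in> carrier G\<rbrakk> \<Longrightarrow> \<phi> t (x \<otimes> y) = \<mu> x * \<phi> t y + d t x"
    and sep: "\<And>s t :: real. s < t \<Longrightarrow> \<exists>y\<in>carrier G. (\<phi> s y - \<phi> s \<one>) * (\<phi> t y - \<phi> t \<one>) < 0"
  shows "uncountable (orderings G)"
proof
  assume cnt: "countable (orderings G)"
  have neq: "affine_order (\<phi> s) \<noteq> affine_order (\<phi> t)" if st: "s < t" for s t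
  proof
    assume eq: "affine_order (\<phi> s) = affine_order (\<phi> t)"
    obtain y where y: "y \<in> carrier G" "(\<phi> s y - \<phi> s \<one>) * (\<phi> t y - \<phi> t \<one>) < 0"
      using sep[OF st] by blast
    have "(\<one>, y) \<in> affine_order (\<phi> s) \<longleftrightarrow> \<phi> s \<one> < \<phi> s y" "(\<one>, y) \<in> affine_order (\<phi> t) \<longleftrightarrow> \<phi> t \<one> < \<phi> t y"
      using y by (auto simp: affine_order_def)
    then show False using eq y(2) by (auto simp: mult_less_0_iff)
  qed
  have "inj (\<lambda>t. affine_order (\<phi> t))"
    by (rule injI) (metis neq linorder_neqE)
  moreover have "range (\<lambda>t. affine_order (\<phi> t)) \<subseteq> orderings G"
    using affine_order_in_orderings[OF pos equi] by blast
  ultimately have "countable (UNIV :: real set)"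
    using cnt by (rule countable_if_inj_on)
  then show False using uncountable_UNIV_real by blast
qed

text \<open>The image of the pair of \<open>f\<close> and \<open>g\<close> spans the plane, and the
  functionals \<open>f + t * g\<close> sweep out a continuum of orderings.\<close>

lemma uncountable_if_two_homs:
  assumes f: "real_hom G f" and g: "real_hom G g"
    and x: "x \<in> carrier G" "g x = 0" "f x \<noteq> 0" and y: "y \<in> carrier G" "g y \<noteq> 0"
  shows "uncountable (orderings G)"
proof (rule uncountable_if_affine_family[where \<phi> = "\<lambda>t z. f z + t * g z" and \<mu> = "\<lambda>_. 1"
      and d = "\<lambda>t z. f z + t * g z"])
  fix s t :: real assume "s < t"
  \<comment> \<open>The value of \<open>f + t * g\<close> at \<open>y\<close> in units of
    \<open>f x\<close>. A rational \<open>m / n\<close> strictly between two such values yields the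
    separating element \<open>x [^] (- m) \<otimes> y [^] n\<close>.\<close>
  let ?p = "\<lambda>t. (f y + t * g y) / f x"
  have "?p s \<noteq> ?p t" using \<open>s < t\<close> x y by simp
  then have "\<exists>q\<in>\<rat>. (?p s < q \<and> q < ?p t) \<or> (?p t < q \<and> q < ?p s)"
    using Rats_dense_in_real[of "?p s" "?p t"] Rats_dense_in_real[of "?p t" "?p s"]
    by (meson linorder_neqE)
  then obtain q where q: "q \<in> \<rat>" "(q - ?p s) * (q - ?p t) < 0"
    by (auto simp: mult_less_0_iff)
  obtain m :: int and n :: nat where mn: "n > 0" "q = of_int m / of_nat n"
    using q(1) by (metis Rats_cases' of_int_of_nat_eq zero_less_imp_eq_int of_nat_0_less_iff)
  let ?z = "x [^] (- m) \<otimes> y [^] n"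
  have val: "f ?z + t * g ?z = - (n * f x) * (q - ?p t)" for t
  proof -
    have "f ?z + t * g ?z = - m * f x + n * (f y + t * g y)"
      using f g x y by (simp add: real_hom_mult real_hom_int_pow real_hom_nat_pow algebra_simps)
    also have "\<dots> = - (n * f x) * (q - ?p t)"
      using mn x(3) by (simp add: field_simps)
    finally show ?thesis .
  qed
  have "(f ?z + s * g ?z) * (f ?z + t * g ?z) = (n * f x)\<^sup>2 * ((q - ?p s) * (q - ?p t))"
    unfolding val by (simp add: power2_eq_square)
  also have "\<dots> < 0" using mn(1) x(3) by (intro mult_pos_neg[OF _ q(2)]) simp
  finally show "\<exists>z\<in>carrier G. ((f z + s * g z) - (f \<one> + s * g \<one>)) * ((f z + t * g z) - (f \<one> + t * g \<one>)) < 0"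
    using x y real_hom_one[OF f] real_hom_one[OF g] by (intro bexI[of _ ?z]) auto
qed (use f g in \<open>auto simp: real_hom_mult algebra_simps\<close>)

end

section \<open>Convex jumps\<close>

text \<open>The image lies in a rational line. If \<open>f x \<noteq> 0\<close>, every element then
  has a positive power that agrees with a power of \<open>x\<close> modulo the kernel.\<close>

definition rank_one :: "('a, 'b) monoid_scheme \<Rightarrow> ('a \<Rightarrow> real) \<Rightarrow> bool" where
  "rank_one G f \<longleftrightarrow> (\<forall>x\<in>carrier G. \<forall>y\<in>carrier G. f x \<noteq> 0 \<longrightarrow> f y / f x \<in> \<rat>)"

lemma rank_oneD:
  assumes "rank_one G f" "x \<in> carrier G" "y \<in> carrier G" "f x \<noteq> 0"
  obtains n :: nat and m :: int where "n > 0" "real n * f y = of_int m * f x"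
proof -
  have "f y / f x \<in> \<rat>" using assms by (auto simp: rank_one_def)
  then obtain m :: int and n :: nat where "n > 0" "f y / f x = of_int m / of_nat n"
    by (metis Rats_cases' of_int_of_nat_eq zero_less_imp_eq_int of_nat_0_less_iff)
  then show thesis using assms(4) that[of n m] by (simp add: field_simps)
qed

context left_ordered_group
begin

text \<open>Two rationally independent values \<open>f x\<close> and \<open>f y\<close> are
  separated by a rational-linear map \<open>p\<close> of the reals that kills only the first, and
  then \<open>f\<close> and its composite with \<open>p\<close> are two homomorphisms as in
  \<open>uncountable_if_two_homs\<close>.\<close>

lemma rank_one_if_countable:
  assumes cnt: "countable (orderings G)" and f: "real_hom G f"
  shows "rank_one G f"
proof (rule ccontr)
  assume "\<not> rank_one G f"
  then obtain x y where x: "x \<in> carrier G" "f x \<noteq> 0" and y: "y \<in> carrier G" "f y / f x \<notin> \<rat>"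
    unfolding rank_one_def by blast
  interpret Q: vector_space "\<lambda>(q::rat) (x::real). of_rat q * x"
    by unfold_locales (simp_all add: algebra_simps of_rat_add of_rat_mult)
  interpret QQ: vector_space_pair "\<lambda>(q::rat) (x::real). of_rat q * x" "\<lambda>(q::rat) (x::real). of_rat q * x"
    by unfold_locales
  have "f y \<notin> Q.span {f x}"
  proof
    assume "f y \<in> Q.span {f x}"
    then obtain q where "f y = of_rat q * f x" by (auto simp: Q.span_singleton)
    then show False using x y by simp
  qed
  moreover have "Q.independent {f x}" using x by (simp add: Q.dependent_single)
  ultimately have ind: "Q.independent {f y, f x}" by (rule Q.independent_insertI)
  define h where "h z = (if z = f x then 0 else (1::real))" for z
  obtain p where lin: "Vector_Spaces.linear (\<lambda>(q::rat) (x::real). of_rat q * x)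
      (\<lambda>(q::rat) (x::real). of_rat q * x) p" and p: "\<forall>z\<in>{f y, f x}. p z = h z"
    using QQ.linear_independent_extend[OF ind] by blast
  interpret p: Vector_Spaces.linear "\<lambda>(q::rat) (x::real). of_rat q * x"
      "\<lambda>(q::rat) (x::real). of_rat q * x" p by (rule lin)
  have px: "p (f x) = 0" using p by (simp add: h_def)
  have "f y \<noteq> f x" using x y(2) by auto
  then have py: "p (f y) \<noteq> 0" using p by (simp add: h_def)
  have "real_hom G (\<lambda>z. p (f z))"
    using f p.add by (simp add: real_hom_def)
  then have "uncountable (orderings G)"
    using uncountable_if_two_homs[OF f, of "\<lambda>z. p (f z)" x y] x y px py by blast
  then show False using cnt by simp
qed

context
  fixes A
  assumes A: "convex_subgroup A" and A_ne: "A \<noteq> carrier G"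
    and maximal: "\<And>D. \<lbrakk>convex_subgroup D; A \<subseteq> D\<rbrakk> \<Longrightarrow> D = A \<or> D = carrier G"
    and virt: "\<And>b. b \<in> carrier G \<Longrightarrow> \<exists>n>0. \<forall>x\<in>carrier G. \<forall>y\<in>carrier G.
      (x \<otimes> b [^] (n::nat), y \<otimes> b [^] n) \<in> r \<longleftrightarrow> (x, y) \<in> r"
begin

text \<open>The elements between some \<open>inv (X n)\<close> and \<open>X n\<close> form a convex
  subgroup \<open>D\<close>. It contains \<open>g\<close>, so it is larger than \<open>A\<close>,
  and by maximality it is everything.\<close>

lemma jump_archimedean:
  assumes g: "g \<notin> A" "\<one> \<sqsubset> g" and c: "c \<in> carrier G"
  shows "\<exists>n. (c, g [^] (n::nat)) \<in> r \<and> (inv (g [^] n), c) \<in> r"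
proof -
  have gG: "g \<in> carrier G" using g carrierD by blast
  obtain m :: nat where m: "m > 0"
    and minv: "\<And>u v. \<lbrakk>u \<in> carrier G; v \<in> carrier G\<rbrakk> \<Longrightarrow> (u \<otimes> g [^] m, v \<otimes> g [^] m) \<in> r \<longleftrightarrow> (u, v) \<in> r"
    using virt[OF gG] by blast
  \<comment> \<open>Only exponents divisible by \<open>m\<close> occur, because right multiplication
    by these powers preserves \<open>r\<close>; this is what makes \<open>D\<close> closed under
    products and inverses.\<close>
  define X where "X n = g [^] (m * n)" for n :: nat
  have XG [simp]: "X n \<in> carrier G" for n using gG by (simp add: X_def)
  have X_add: "X (n + k) = X n \<otimes> X k" for n k using gG by (simp add: X_def nat_pow_mult algebra_simps)
  have X0: "X 0 = \<one>" by (simp add: X_def)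
  have rinv: "(u \<otimes> X n, v \<otimes> X n) \<in> r \<longleftrightarrow> (u, v) \<in> r" if "u \<in> carrier G" "v \<in> carrier G" for u v n
  proof (induction n)
    case (Suc n)
    have "u \<otimes> X (Suc n) = u \<otimes> X n \<otimes> g [^] m" "v \<otimes> X (Suc n) = v \<otimes> X n \<otimes> g [^] m"
      using X_add[of n 1] that gG by (simp_all add: m_assoc) (simp_all add: X_def)
    then show ?case using minv Suc that by simp
  qed (use that X0 in simp)
  have rinv': "(u \<otimes> inv (X n), v \<otimes> inv (X n)) \<in> r \<longleftrightarrow> (u, v) \<in> r"
    if "u \<in> carrier G" "v \<in> carrier G" for u v n
    using rinv[of "u \<otimes> inv (X n)" "v \<otimes> inv (X n)" n] that by (simp add: m_assoc)
  define D where "D = {b \<in> carrier G. \<exists>n. (inv (X n), b) \<in> r \<and> (b, X n) \<in> r}"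
  have Xpos: "(\<one>, X n) \<in> r" for n using g gG by (auto simp: X_def intro!: pow_pos)
  have Xmono: "(X n, X (n + k)) \<in> r" "(inv (X (n + k)), inv (X n)) \<in> r" for n k
  proof -
    show *: "(X n, X (n + k)) \<in> r" using mult_ge[OF Xpos, of "X n"] by (simp add: X_add)
    have "(inv (X k), \<one>) \<in> r" using inv_le Xpos by simp
    then show "(inv (X (n + k)), inv (X n)) \<in> r"
      using rinv'[of "inv (X k)" \<one> n] X_add[of n k] X_add[of k n]
      by (simp add: add.commute inv_mult_group)
  qed
  have "subgroup D G"
  proof (rule subgroupI)
    show "D \<subseteq> carrier G" by (auto simp: D_def)
    show "D \<noteq> {}" using X0 by (auto simp: D_def intro!: exI[of _ \<one>] exI[of _ 0])
    fix b assume "b \<in> D"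
    then obtain n where b: "b \<in> carrier G" "(inv (X n), b) \<in> r" "(b, X n) \<in> r" by (auto simp: D_def)
    have "(inv b \<otimes> inv (X n), \<one>) \<in> r" using mult_le[OF b(2), of "inv b"] b(1) by simp
    then have "(inv b, X n) \<in> r" using rinv[of "inv b \<otimes> inv (X n)" \<one> n] b(1) by (simp add: m_assoc)
    moreover have "(\<one>, inv b \<otimes> X n) \<in> r" using mult_le[OF b(3), of "inv b"] b(1) by simp
    then have "(inv (X n), inv b) \<in> r" using rinv'[of \<one> "inv b \<otimes> X n" n] b(1) by (simp add: m_assoc)
    ultimately show "inv b \<in> D" using b(1) by (auto simp: D_def)
    fix c assume "c \<in> D"
    then obtain k where c: "c \<in> carrier G" "(inv (X k), c) \<in> r" "(c, X k) \<in> r" by (auto simp: D_def)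
    have "(b \<otimes> c, b \<otimes> X k) \<in> r" using mult_le c b by blast
    moreover have "(b \<otimes> X k, X n \<otimes> X k) \<in> r" using rinv b by simp
    ultimately have 1: "(b \<otimes> c, X (n + k)) \<in> r" using le_trans X_add by metis
    have "(b \<otimes> inv (X k), b \<otimes> c) \<in> r" using mult_le c b by blast
    moreover have "(inv (X n) \<otimes> inv (X k), b \<otimes> inv (X k)) \<in> r" using rinv' b by simp
    moreover have "inv (X n) \<otimes> inv (X k) = inv (X (n + k))"
      using X_add[of k n] by (simp add: add.commute inv_mult_group)
    ultimately have 2: "(inv (X (n + k)), b \<otimes> c) \<in> r" using le_trans by metis
    show "b \<otimes> c \<in> D" using 1 2 b c by (auto simp: D_def)
  qed
  moreover have "x \<in> D" if x: "(\<one>, x) \<in> r" "(x, y) \<in> r" "y \<in> D" for x y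
  proof -
    obtain n where "(y, X n) \<in> r" using x by (auto simp: D_def)
    then have "(x, X n) \<in> r" "(inv (X n), x) \<in> r"
      using x le_trans Xpos inv_le XG by blast+
    then show ?thesis using carrierD[OF x(1)] by (auto simp: D_def)
  qed
  ultimately have conv: "convex_subgroup D" by (auto simp: convex_subgroup_def)
  have gX: "(g, X 1) \<in> r" using pow_ge[of g m] g m by (simp add: X_def)
  have gD: "g \<in> D"
    using gX Xpos[of 1] inv_le[of "X 1"] g gG le_trans[of "inv (X 1)" \<one> g] by (auto simp: D_def)
  have "A \<subseteq> D"
    using convex_chain[OF A conv] gD g by blast
  then have "D = carrier G" using maximal[OF conv] gD g by blast
  then show ?thesis using c by (auto simp: D_def X_def)
qed

text \<open>This makes \<open>A\<close> normal and the sign outside \<open>A\<close> invariant under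
  conjugation, so that the jump can be treated as a bi-ordered quotient.\<close>

lemma jump_conj:
  assumes g: "g \<notin> A" "\<one> \<sqsubset> g" and c: "c \<in> carrier G"
  shows "inv c \<otimes> g \<otimes> c \<notin> A" "\<one> \<sqsubset> inv c \<otimes> g \<otimes> c"
proof -
  have notin: "inv c \<otimes> g \<otimes> c \<notin> A" if g: "g \<notin> A" "\<one> \<sqsubset> g" and c: "c \<in> carrier G" for g c
  proof
    define w where "w = inv c \<otimes> g \<otimes> c"
    assume "inv c \<otimes> g \<otimes> c \<in> A"
    then have w: "w \<in> A" by (simp add: w_def)
    have gG: "g \<in> carrier G" using g carrierD by blast
    have wG: "w \<in> carrier G" using w convex_subgroupD(2)[OF A] by blast
    have gcw: "g \<otimes> c = c \<otimes> w" using gG c by (simp add: w_def m_assoc)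
    have pow: "g [^] (n::nat) \<otimes> c = c \<otimes> w [^] n" for n
    proof (induction n)
      case (Suc n)
      have "g [^] Suc n \<otimes> c = g [^] n \<otimes> c \<otimes> w" using gG c wG gcw by (simp add: m_assoc)
      then show ?case using Suc c wG by (simp add: m_assoc)
    qed (use c in simp)
    have wn: "w [^] (n::nat) \<in> A" for n
      using w by (induction n) (auto intro: convex_subgroupD(3,4)[OF A])
    show False
    proof (cases "c \<in> A")
      case True
      have "g = c \<otimes> w \<otimes> inv c" using gG c by (simp add: w_def m_assoc)
      then show False using g True w convex_subgroupD(4,5)[OF A] by blast
    next
      case False
      \<comment> \<open>For positive \<open>c\<close> this closes the cycle \<open>g [^] n \<le> g
        [^] n \<otimes> c = c \<otimes> w [^] n < c \<otimes> c \<le> g [^] n\<close>, as powers of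
        \<open>w\<close> stay in \<open>A\<close> and hence below \<open>c\<close>. For negative
        \<open>c\<close> the mirrored cycle uses \<open>inv (g [^] n)\<close>.\<close>
      obtain n :: nat where n: "(c \<otimes> c, g [^] n) \<in> r" "(inv (g [^] n), c \<otimes> c) \<in> r"
        using jump_archimedean[OF g, of "c \<otimes> c"] c by auto
      show False
      proof (cases "(\<one>, c) \<in> r")
        case True
        then have "\<one> \<sqsubset> c" using False convex_subgroupD(3)[OF A] by auto
        then have "w [^] n \<sqsubset> c" using convex_less[OF A False] wn by blast
        then have "c \<otimes> w [^] n \<sqsubset> c \<otimes> c" using mult_le c wG by auto
        moreover have "(g [^] n, g [^] n \<otimes> c) \<in> r" using mult_ge[OF True] gG by simp
        ultimately show False using n(1) pow antisym le_trans by metis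
      next
        case neg: False
        then have "c \<sqsubset> \<one>" using total[of \<one> c] c by auto
        then have "c \<sqsubset> inv (w [^] n)" using convex_greater[OF A False] convex_subgroupD(5)[OF A wn] by blast
        then have "c \<otimes> c \<sqsubset> c \<otimes> inv (w [^] n)" using mult_le c wG by auto
        moreover have "(c \<otimes> inv (w [^] n), c \<otimes> inv (w [^] n) \<otimes> inv c) \<in> r"
          using mult_ge[of "inv c" "c \<otimes> inv (w [^] n)"] inv_pos[OF neg c] c wG by simp
        moreover have "c \<otimes> inv (w [^] n) \<otimes> inv c = inv (g [^] n)"
        proof -
          have "g [^] n = c \<otimes> w [^] n \<otimes> inv c" using pow[of n] c gG wG
            by (metis inv_solve_right m_closed nat_pow_closed)
          then show ?thesis using c wG by (simp add: inv_mult_group m_assoc)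
        qed
        ultimately show False using n(2) antisym le_trans by metis
      qed
    qed
  qed
  have pos_up: "\<one> \<sqsubset> inv c \<otimes> g \<otimes> c" if g: "g \<notin> A" "\<one> \<sqsubset> g" and c: "c \<in> carrier G" "(\<one>, c) \<in> r" for g c
  proof -
    define w where "w = inv c \<otimes> g \<otimes> c"
    have gG: "g \<in> carrier G" using g carrierD by blast
    have wG: "w \<in> carrier G" using gG c by (simp add: w_def)
    have gcw: "g \<otimes> c = c \<otimes> w" using gG c by (simp add: w_def m_assoc)
    have "\<one> \<noteq> w" using notin[OF g c(1)] convex_subgroupD(3)[OF A] by (auto simp: w_def)
    moreover have "(\<one>, w) \<in> r"
    proof (rule ccontr)
      assume "(\<one>, w) \<notin> r"
      then have "(w, \<one>) \<in> r" using total[of \<one> w] wG by auto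
      \<comment> \<open>Iterating this inequality bounds all powers of \<open>g\<close> by
        \<open>c\<close>, against the archimedean property.\<close>
      then have le: "(g \<otimes> c, c) \<in> r" using mult_le[of w \<one> c] c by (simp add: gcw)
      have "(g [^] (n::nat) \<otimes> c, c) \<in> r" for n
      proof (induction n)
        case (Suc n)
        have "(g [^] Suc n \<otimes> c, g [^] n \<otimes> c) \<in> r"
          using mult_le[OF le, of "g [^] n"] gG c by (simp add: m_assoc)
        then show ?case using Suc le_trans by blast
      qed (use c in simp)
      moreover have "(g [^] n, g [^] n \<otimes> c) \<in> r" for n :: nat using mult_ge[OF c(2)] gG by simp
      \<comment> \<open>The bound to be exceeded is \<open>c \<otimes> g\<close> and not
        \<open>c\<close>: the archimedean property gives only a weak inequality, while
        \<open>c < c \<otimes> g\<close> is strict.\<close>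
      moreover obtain n where n: "(c \<otimes> g, g [^] (n::nat)) \<in> r" using jump_archimedean[OF g, of "c \<otimes> g"] c gG by auto
      ultimately have "(c \<otimes> g, c) \<in> r" using le_trans by blast
      moreover have "(c, c \<otimes> g) \<in> r" using mult_ge g c by blast
      ultimately have "c \<otimes> g = c" using antisym by blast
      then have "g = \<one>" using c gG by (metis l_cancel_one)
      then show False using g by simp
    qed
    ultimately show ?thesis by (simp add: w_def)
  qed
  show "inv c \<otimes> g \<otimes> c \<notin> A" using notin assms by blast
  show "\<one> \<sqsubset> inv c \<otimes> g \<otimes> c"
  proof (cases "(\<one>, c) \<in> r")
    case True
    then show ?thesis using pos_up assms by blast
  next
    case False
    define w where "w = inv c \<otimes> g \<otimes> c"
    have gG: "g \<in> carrier G" using g carrierD by blast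
    have wG: "w \<in> carrier G" using gG c by (simp add: w_def)
    have wA: "w \<notin> A" using notin assms by (simp add: w_def)
    have "(\<one>, w) \<in> r"
    proof (rule ccontr)
      assume "(\<one>, w) \<notin> r"
      then have "\<one> \<sqsubset> inv w" using inv_pos wG by blast
      moreover have "inv w \<notin> A" using wA subgroup_inv_iff convex_subgroupD(1)[OF A] wG by blast
      moreover have "(\<one>, inv c) \<in> r" using inv_pos[OF False c] by simp
      ultimately have "\<one> \<sqsubset> inv (inv c) \<otimes> inv w \<otimes> inv c" using pos_up[of "inv w" "inv c"] c by blast
      moreover have "inv (inv c) \<otimes> inv w \<otimes> inv c = inv g"
        using gG c by (simp add: w_def inv_mult_group m_assoc)
      ultimately have "(\<one>, inv g) \<in> r" by simp
      then show False using le_inv[of g] gG g antisym by blast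
    qed
    moreover have "\<one> \<noteq> w" using wA convex_subgroupD(3)[OF A] by auto
    ultimately show ?thesis by (simp add: w_def)
  qed
qed

text \<open>\<open>Q\<close> is the nonnegative cone of a total preorder in which the elements of
  \<open>A\<close> count as zero. Its invariance under conjugation supplies the right invariance
  that Hoelder's theorem demands.\<close>

lemma jump_hom:
  obtains f where "real_hom G f" "\<And>x. x \<in> carrier G \<Longrightarrow> f x = 0 \<longleftrightarrow> x \<in> A"
    "\<And>x. \<lbrakk>x \<in> carrier G; f x > 0\<rbrakk> \<Longrightarrow> \<one> \<sqsubset> x"
proof -
  define Q where "Q = {x \<in> carrier G. x \<in> A \<or> \<one> \<sqsubset> x}"
  note subA = convex_subgroupD(1)[OF A] and AG = convex_subgroupD(2)[OF A]
  have Qmult: "x \<otimes> y \<in> Q" if xy: "x \<in> Q" "y \<in> Q" for x y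
  proof -
    have G: "x \<in> carrier G" "y \<in> carrier G" using xy by (auto simp: Q_def)
    consider "x \<in> A" "y \<in> A" | "x \<in> A" "y \<notin> A" "\<one> \<sqsubset> y" | "x \<notin> A" "\<one> \<sqsubset> x" "y \<in> A" | "\<one> \<sqsubset> x" "\<one> \<sqsubset> y"
      using xy by (auto simp: Q_def)
    then show ?thesis
    proof cases
      case 4
      then have "\<one> \<sqsubset> x \<otimes> y" using mult_ge[of y x] lt_le_trans[of \<one> x "x \<otimes> y"] G by blast
      then show ?thesis using G by (simp add: Q_def)
    qed (use convex_subgroupD(4)[OF A] convex_mult_pos[OF A] G in \<open>auto simp: Q_def\<close>)
  qed
  have Qtotal: "x \<in> Q \<or> inv x \<in> Q" if "x \<in> carrier G" for x
    using that inv_pos[of x] convex_subgroupD(3)[OF A] by (auto simp: Q_def)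
  have Qboth: "x \<in> A" if "x \<in> Q" "inv x \<in> Q" for x
  proof (rule ccontr)
    assume x: "x \<notin> A"
    have G: "x \<in> carrier G" using that by (auto simp: Q_def)
    have "inv x \<notin> A" using x subgroup_inv_iff[OF subA G] by blast
    then have "(\<one>, x) \<in> r" "(\<one>, inv x) \<in> r" using that x by (auto simp: Q_def)
    then have "x = \<one>" using le_inv G antisym by blast
    then show False using x convex_subgroupD(3)[OF A] by simp
  qed
  have Aconj: "inv c \<otimes> a \<otimes> c \<in> A" if a: "a \<in> A" and c: "c \<in> carrier G" for a c
  proof (rule ccontr)
    define w where "w = inv c \<otimes> a \<otimes> c"
    assume "inv c \<otimes> a \<otimes> c \<notin> A"
    then have w: "w \<notin> A" by (simp add: w_def)
    have G: "a \<in> carrier G" "w \<in> carrier G" using a c AG by (auto simp: w_def)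
    have inv: "inv w \<notin> A" using w subgroup_inv_iff[OF subA G(2)] by blast
    have undo: "inv (inv c) \<otimes> w \<otimes> inv c = a" "inv (inv c) \<otimes> inv w \<otimes> inv c = inv a"
      using G c by (simp_all add: w_def m_assoc inv_mult_group)
    have "\<one> \<noteq> w" using w convex_subgroupD(3)[OF A] by auto
    then consider "\<one> \<sqsubset> w" | "\<one> \<sqsubset> inv w" using inv_pos G by blast
    then show False
    proof cases
      case 1
      show False using jump_conj(1)[OF w 1, of "inv c"] undo a c by simp
    next
      case 2
      show False using jump_conj(1)[OF inv 2, of "inv c"] undo a c convex_subgroupD(5)[OF A] by simp
    qed
  qed
  have Qconj: "inv c \<otimes> x \<otimes> c \<in> Q" if "x \<in> Q" "c \<in> carrier G" for x c
    using that Aconj[of x c] jump_conj(2)[of x c] by (cases "x \<in> A") (auto simp: Q_def)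
  interpret archimedean_preordered_group G "\<lambda>x y. inv x \<otimes> y \<in> Q"
  proof unfold_locales
    fix x y assume G: "x \<in> carrier G" "y \<in> carrier G"
    show "inv x \<otimes> y \<in> Q \<or> inv y \<otimes> x \<in> Q"
      using Qtotal[of "inv x \<otimes> y"] G by (simp add: inv_mult_group)
  next
    fix x y z assume "x \<in> carrier G" "y \<in> carrier G" "z \<in> carrier G" "inv x \<otimes> y \<in> Q" "inv y \<otimes> z \<in> Q"
    then show "inv x \<otimes> z \<in> Q" using Qmult[of "inv x \<otimes> y" "inv y \<otimes> z"] by (simp add: m_assoc)
  next
    fix x y z assume "x \<in> carrier G" "y \<in> carrier G" "z \<in> carrier G" "inv x \<otimes> y \<in> Q"
    then show "inv (z \<otimes> x) \<otimes> (z \<otimes> y) \<in> Q" by (simp add: inv_mult_group m_assoc)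
  next
    fix x y z assume "x \<in> carrier G" "y \<in> carrier G" "z \<in> carrier G" "inv x \<otimes> y \<in> Q"
    then show "inv (x \<otimes> z) \<otimes> (y \<otimes> z) \<in> Q"
      using Qconj[of "inv x \<otimes> y" z] by (simp add: inv_mult_group m_assoc)
  next
    fix x y assume G: "x \<in> carrier G" "y \<in> carrier G" and "inv x \<otimes> \<one> \<notin> Q"
    then have nQ: "inv x \<notin> Q" by simp
    then have "x \<in> Q" "x \<notin> A" using Qtotal G convex_subgroupD(5)[OF A] AG by (auto simp: Q_def)
    then have x: "x \<notin> A" "\<one> \<sqsubset> x" by (auto simp: Q_def)
    from jump_archimedean[OF x G(2)] obtain n :: nat where "(y, x [^] n) \<in> r" by (elim exE conjE)
    then have "(\<one>, inv y \<otimes> x [^] n) \<in> r" using le_iff[of y "x [^] n"] G nat_pow_closed by blast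
    then show "\<exists>n::nat. inv y \<otimes> x [^] n \<in> Q"
      using G convex_subgroupD(3)[OF A] by (intro exI[of _ n]) (auto simp: Q_def)
  qed
  obtain f where f: "real_hom G f"
    and iff: "\<And>x y. \<lbrakk>x \<in> carrier G; y \<in> carrier G\<rbrakk> \<Longrightarrow> inv x \<otimes> y \<in> Q \<longleftrightarrow> f x \<le> f y"
    using Hoelder by metis
  have f1: "f \<one> = 0" by (rule real_hom_one[OF f])
  have pos: "x \<in> Q \<longleftrightarrow> 0 \<le> f x" "inv x \<in> Q \<longleftrightarrow> f x \<le> 0" if "x \<in> carrier G" for x
    using iff[of \<one> x] iff[of x \<one>] that f1 by simp_all
  show thesis
  proof
    fix x assume x: "x \<in> carrier G"
    show "f x = 0 \<longleftrightarrow> x \<in> A"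
      using pos[OF x] Qboth[of x] convex_subgroupD(5)[OF A, of x] x by (auto simp: Q_def)
    assume "f x > 0"
    then have "x \<in> Q" "inv x \<notin> Q" using pos[OF x] by auto
    then show "\<one> \<sqsubset> x" using convex_subgroupD(5)[OF A, of x] x by (auto simp: Q_def)
  qed (rule f)
qed

end

end

section \<open>The action on a convex jump\<close>

text \<open>Powers of \<open>c\<close> shrink a nonzero element below the length of the interval,
  and the integer multiples of so small a number cannot jump over it.\<close>

lemma dense_additive_contraction:
  fixes T :: "real set"
  assumes add: "\<And>a b. \<lbrakk>a \<in> T; b \<in> T\<rbrakk> \<Longrightarrow> a + b \<in> T" and neg: "\<And>a. a \<in> T \<Longrightarrow> - a \<in> T"
    and scale: "\<And>a. a \<in> T \<Longrightarrow> c * a \<in> T" and c: "0 < c" "c < 1"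
    and u: "u \<in> T" "u \<noteq> 0" and st: "s < t"
  shows "\<exists>a\<in>T. s < a \<and> a < t"
proof -
  obtain n where n: "c ^ n < (t - s) / \<bar>u\<bar>" using real_arch_pow_inv[of "(t - s) / \<bar>u\<bar>" c] st u c by auto
  define v where "v = c ^ n * \<bar>u\<bar>"
  have v: "v > 0" "v < t - s" using n u c by (auto simp: v_def field_simps)
  have "c ^ n * a \<in> T" if "a \<in> T" for a n
    using that scale by (induction n) (auto simp: mult.assoc)
  moreover have "\<bar>u\<bar> \<in> T" using u neg by (auto simp: abs_if)
  ultimately have vT: "v \<in> T" unfolding v_def by blast
  have "0 \<in> T" using add[OF u(1) neg[OF u(1)]] by simp
  then have natT: "real k * v \<in> T" for k
    by (induction k) (auto simp: algebra_simps intro: add vT)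
  have kT: "of_int k * v \<in> T" for k
  proof (cases k rule: int_cases2)
    case (nonpos n)
    then show ?thesis using neg[OF natT, of n] by simp
  qed (simp add: natT)
  define k where "k = \<lfloor>s / v\<rfloor> + 1"
  have "s / v < of_int k" "of_int k \<le> s / v + 1" unfolding k_def by linarith+
  then have "s < of_int k * v" "of_int k * v \<le> s + v" using v(1) by (auto simp: field_simps)
  then show ?thesis using kT v(2) by (intro bexI[of _ "of_int k * v"]) auto
qed

text \<open>\<open>g\<close> describes the jump above \<open>A\<close>, \<open>\<tau>\<close> the
  top jump of \<open>A\<close> itself, and \<open>\<mu> b\<close> the factor by which conjugation by
  \<open>b\<close> scales \<open>\<tau>\<close>. These data do not mention \<open>r\<close>, so they
  can be reused with every ordering of the group. The element \<open>u\<close> forces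
  \<open>\<mu>\<close> to be multiplicative.\<close>

locale jump_action = left_ordered_group +
  fixes A :: "'a set" and g \<tau> \<mu> :: "'a \<Rightarrow> real" and u
  assumes A: "subgroup A G" and g: "real_hom G g"
    and ker: "\<And>x. x \<in> carrier G \<Longrightarrow> g x = 0 \<longleftrightarrow> x \<in> A"
    and \<tau>: "real_hom (G\<lparr>carrier := A\<rparr>) \<tau>"
    and action: "\<And>b a. \<lbrakk>b \<in> carrier G; a \<in> A\<rbrakk> \<Longrightarrow> \<tau> (b \<otimes> a \<otimes> inv b) = \<mu> b * \<tau> a"
    and u: "u \<in> A" "\<tau> u \<noteq> 0"
begin

abbreviation commutator :: "'a \<Rightarrow> 'a \<Rightarrow> 'a" where
  "commutator x y \<equiv> x \<otimes> y \<otimes> inv x \<otimes> inv y"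

lemma AG: "a \<in> A \<Longrightarrow> a \<in> carrier G"
  using subgroup.subset[OF A] by blast

lemma A_closed: "a \<in> A \<Longrightarrow> b \<in> A \<Longrightarrow> a \<otimes> b \<in> A" "a \<in> A \<Longrightarrow> inv a \<in> A"
  using subgroup.m_closed[OF A] subgroup.m_inv_closed[OF A] by auto

lemma \<tau>_mult: "a \<in> A \<Longrightarrow> b \<in> A \<Longrightarrow> \<tau> (a \<otimes> b) = \<tau> a + \<tau> b"
  using real_hom_mult[OF \<tau>] by simp

lemma \<tau>_one: "\<tau> \<one> = 0"
  using \<tau>_mult[of \<one> \<one>] subgroup.one_closed[OF A] by simp

lemma \<tau>_inv: "a \<in> A \<Longrightarrow> \<tau> (inv a) = - \<tau> a"
  using \<tau>_mult[of a "inv a"] A_closed AG \<tau>_one by simp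

lemma conj_closed: "b \<in> carrier G \<Longrightarrow> a \<in> A \<Longrightarrow> b \<otimes> a \<otimes> inv b \<in> A"
  using ker[of "b \<otimes> a \<otimes> inv b"] ker[of a] AG[of a] by (simp add: real_hom_mult[OF g] real_hom_inv[OF g])

lemma commutator_closed: "x \<in> carrier G \<Longrightarrow> y \<in> carrier G \<Longrightarrow> commutator x y \<in> A"
  using ker[of "commutator x y"] by (simp add: real_hom_mult[OF g] real_hom_inv[OF g])

lemma \<mu>_mult:
  assumes "x \<in> carrier G" "y \<in> carrier G"
  shows "\<mu> (x \<otimes> y) = \<mu> x * \<mu> y"
proof -
  have "x \<otimes> y \<otimes> u \<otimes> inv (x \<otimes> y) = x \<otimes> (y \<otimes> u \<otimes> inv y) \<otimes> inv x"
    using assms AG[OF u(1)] by (simp add: inv_mult_group m_assoc)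
  then have "\<mu> (x \<otimes> y) * \<tau> u = \<mu> x * (\<mu> y * \<tau> u)"
    using action[of "x \<otimes> y" u] action[of x "y \<otimes> u \<otimes> inv y"] action[of y u] conj_closed[of y u] assms u(1)
    by (metis m_closed)
  then show ?thesis using u(2) by simp
qed

lemma \<mu>_one: "\<mu> \<one> = 1"
  using action[of \<one> u] u AG by simp

lemma \<mu>_A: "a \<in> A \<Longrightarrow> \<mu> a = 1"
  using action[of a u] u AG \<tau>_mult[of "a \<otimes> u" "inv a"] \<tau>_mult[of a u] A_closed \<tau>_inv by simp

lemma \<mu>_inv: "x \<in> carrier G \<Longrightarrow> \<mu> x * \<mu> (inv x) = 1"
  using \<mu>_mult[of x "inv x"] \<mu>_one by simp

text \<open>Cocycle identities: with \<open>x\<close> fixed, \<open>\<tau> (commutator x y)\<close>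
  is a 1-cocycle in \<open>y\<close> for the action by the factors \<open>\<mu>\<close>.\<close>

lemma \<tau>_commutator_mult:
  assumes "x \<in> carrier G" "y \<in> carrier G" "z \<in> carrier G"
  shows "\<tau> (commutator x (y \<otimes> z)) = \<tau> (commutator x y) + \<mu> y * \<tau> (commutator x z)"
    and "\<tau> (commutator (y \<otimes> z) x) = \<mu> y * \<tau> (commutator z x) + \<tau> (commutator y x)"
proof -
  have "commutator x (y \<otimes> z) = commutator x y \<otimes> (y \<otimes> commutator x z \<otimes> inv y)"
    "commutator (y \<otimes> z) x = (y \<otimes> commutator z x \<otimes> inv y) \<otimes> commutator y x"
    using assms by (simp_all add: inv_mult_group m_assoc)
  then show "\<tau> (commutator x (y \<otimes> z)) = \<tau> (commutator x y) + \<mu> y * \<tau> (commutator x z)"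
    "\<tau> (commutator (y \<otimes> z) x) = \<mu> y * \<tau> (commutator z x) + \<tau> (commutator y x)"
    using assms by (simp_all add: \<tau>_mult action commutator_closed conj_closed)
qed

lemma \<tau>_commutator_A:
  assumes "x \<in> carrier G" "a \<in> A"
  shows "\<tau> (commutator x a) = (\<mu> x - 1) * \<tau> a"
  using assms by (simp add: \<tau>_mult action conj_closed \<tau>_inv A_closed algebra_simps)

text \<open>The fixed point of \<open>x\<close> is placed at \<open>0\<close>; this determines the translation part of the affine
  action extending the action of \<open>A\<close> by translations.\<close>

lemma uncountable_if_affine_action:
  assumes pos: "\<And>b. b \<in> carrier G \<Longrightarrow> \<mu> b > 0" and x: "x \<in> carrier G" "\<mu> x < 1"
  shows "uncountable (orderings G)"
proof -
  \<comment> \<open>Dividing by \<open>\<mu> x - 1\<close> normalizes the cocycle so that it extends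
    \<open>\<tau>\<close>. The element \<open>y\<close> then acts by
    \<open>v \<mapsto> \<mu> y * v + c y\<close>, and \<open>c x = 0\<close> because
    \<open>x\<close> commutes with itself.\<close>
  define c where "c y = \<tau> (commutator x y) / (\<mu> x - 1)" for y
  have c_mult: "c (y \<otimes> z) = c y + \<mu> y * c z" if "y \<in> carrier G" "z \<in> carrier G" for y z
    using \<tau>_commutator_mult(1)[OF x(1) that] by (simp add: c_def add_divide_distrib)
  have c_A: "c a = \<tau> a" if "a \<in> A" for a
    using \<tau>_commutator_A[OF x(1) that] x(2) by (simp add: c_def)
  have c_x: "c x = 0" using x(1) by (simp add: c_def m_assoc \<tau>_one)
  have c_one: "c \<one> = 0" using c_A subgroup.one_closed[OF A] \<tau>_one by simp
  show ?thesis
  proof (rule uncountable_if_affine_family[where \<mu> = \<mu> and \<phi> = "\<lambda>t y. \<mu> y * t + c y" and d = "\<lambda>t. c"])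
    fix s t :: real assume st: "s < t"
    have "\<exists>v\<in>\<tau> ` A. s < v \<and> v < t"
    proof (rule dense_additive_contraction[of "\<tau> ` A" "\<mu> x" "\<tau> u"])
      fix v w assume "v \<in> \<tau> ` A" "w \<in> \<tau> ` A"
      then show "v + w \<in> \<tau> ` A" using \<tau>_mult A_closed(1) by (metis (no_types, lifting) imageE imageI)
    next
      fix v assume v: "v \<in> \<tau> ` A"
      then show "- v \<in> \<tau> ` A" using \<tau>_inv A_closed(2) by (metis (no_types, lifting) imageE imageI)
      show "\<mu> x * v \<in> \<tau> ` A" using v action conj_closed x(1) by (metis (no_types, lifting) imageE imageI)
    qed (use pos x u st in auto)
    then obtain a where a: "a \<in> A" "s < \<tau> a" "\<tau> a < t" by blast
    \<comment> \<open>This conjugate of the contraction \<open>x\<close> has its fixed point at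
      \<open>\<tau> a\<close>, between \<open>s\<close> and \<open>t\<close>, so it moves these two
      base points in opposite directions.\<close>
    let ?y = "a \<otimes> (x \<otimes> inv a)"
    have y: "?y \<in> carrier G" using a AG x by simp
    have \<mu>y: "\<mu> ?y = \<mu> x" using a AG x by (simp add: \<mu>_mult \<mu>_A A_closed)
    have cy: "c ?y = (1 - \<mu> x) * \<tau> a"
      using a AG x by (simp add: c_mult c_A c_x \<mu>_A A_closed \<tau>_inv algebra_simps)
    have val: "\<mu> ?y * t + c ?y - (\<mu> \<one> * t + c \<one>) = (1 - \<mu> x) * (\<tau> a - t)" for t
      unfolding \<mu>y cy by (simp add: \<mu>_one c_one algebra_simps)
    have "(1 - \<mu> x) * (\<tau> a - s) > 0" "(1 - \<mu> x) * (\<tau> a - t) < 0"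
      using a x(2) by (auto simp: mult_less_0_iff)
    then show "\<exists>y\<in>carrier G. (\<mu> y * s + c y - (\<mu> \<one> * s + c \<one>)) * (\<mu> y * t + c y - (\<mu> \<one> * t + c \<one>)) < 0"
      using y by (intro bexI[of _ ?y]) (simp_all only: val mult_pos_neg)
  qed (use pos in \<open>auto simp: c_mult \<mu>_mult algebra_simps\<close>)
qed

text \<open>With trivial factors, \<open>\<tau> (commutator w z)\<close> is a homomorphism in
  \<open>w\<close> that vanishes on \<open>A\<close> and at \<open>z\<close>. By rank one a power of
  \<open>y\<close> agrees with a power of \<open>z\<close> modulo \<open>A\<close>, so it vanishes
  at \<open>y\<close> as well.\<close>

lemma \<tau>_commutator_trivial:
  assumes triv: "\<And>b. b \<in> carrier G \<Longrightarrow> \<mu> b = 1" and rank: "rank_one G g"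
    and y: "y \<in> carrier G" and z: "z \<in> carrier G"
  shows "\<tau> (commutator y z) = 0"
proof (cases "g z = 0")
  case True
  then show ?thesis using \<tau>_commutator_A[OF y] ker z triv y by simp
next
  case False
  have hom: "real_hom G (\<lambda>w. \<tau> (commutator w z))"
    using \<tau>_commutator_mult(2)[OF z] triv by (simp add: real_hom_def)
  have "\<tau> (commutator a z) = 0" if a: "a \<in> A" for a
  proof -
    have "commutator a z = a \<otimes> (z \<otimes> inv a \<otimes> inv z)" using a AG z by (simp add: m_assoc)
    then show ?thesis using a z triv by (simp add: \<tau>_mult action conj_closed A_closed \<tau>_inv)
  qed
  moreover obtain n :: nat and m :: int where nm: "n > 0" "real n * g y = of_int m * g z"
    using rank_oneD[OF rank z y False] by blast
  have "y [^] n \<otimes> z [^] (- m) \<in> A"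
    using ker[of "y [^] n \<otimes> z [^] (- m)"] y z nm(2)
    by (simp add: real_hom_mult[OF g] real_hom_nat_pow[OF g] real_hom_int_pow[OF g])
  ultimately have "\<tau> (commutator (y [^] n \<otimes> z [^] (- m)) z) = 0" by blast
  then have "real n * \<tau> (commutator y z) - m * \<tau> (commutator z z) = 0"
    using real_hom_mult[OF hom, of "y [^] n" "z [^] (- m)"] real_hom_nat_pow[OF hom y]
      real_hom_int_pow[OF hom z, of "- m"] y z by simp
  moreover have "\<tau> (commutator z z) = 0" using z \<tau>_one by (simp add: m_assoc)
  ultimately show ?thesis using nm(1) by simp
qed

text \<open>Modulo the kernel of \<open>\<tau>\<close> the group is abelian, so \<open>\<tau>\<close> extends by divisibility of the reals.\<close>

lemma extend_hom:
  assumes triv: "\<And>b. b \<in> carrier G \<Longrightarrow> \<mu> b = 1" and rank: "rank_one G g"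
    and x: "x \<in> carrier G" "g x \<noteq> 0"
  shows "\<exists>f. real_hom G f \<and> (\<forall>a\<in>A. f a = \<tau> a)"
proof -
  define N where "N = {a \<in> A. \<tau> a = 0}"
  have N_sub: "subgroup N G"
    by (rule subgroupI)
      (use AG A_closed \<tau>_mult \<tau>_inv \<tau>_one subgroup.one_closed[OF A] in \<open>auto simp: N_def\<close>)
  have "\<forall>b\<in>carrier G. \<forall>a\<in>N. b \<otimes> a \<otimes> inv b \<in> N"
    using conj_closed action by (simp add: N_def)
  then have N: "N \<lhd> G" using N_sub normal_inv_iff by blast
  let ?Q = "G Mod N"
  let ?\<pi> = "\<lambda>y. N #> y"
  have Q: "group ?Q" using N by (rule normal.factorgroup_is_group)
  have "?\<pi> \<in> hom G ?Q" using N by (rule normal.r_coset_hom_Mod)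
  then interpret \<pi>: group_hom G ?Q ?\<pi>
    using Q by (simp add: group_hom_def group_hom_axioms_def)
  have \<pi>_comm: "?\<pi> (y \<otimes> z) = ?\<pi> (z \<otimes> y)" if "y \<in> carrier G" "z \<in> carrier G" for y z
  proof -
    have cN: "commutator y z \<in> N"
      using that commutator_closed \<tau>_commutator_trivial[OF triv rank] by (simp add: N_def)
    have "y \<otimes> z = commutator y z \<otimes> (z \<otimes> y)" using that by (simp add: m_assoc)
    then have "?\<pi> (y \<otimes> z) = (N #> commutator y z) #> (z \<otimes> y)"
      using that coset_mult_assoc[OF subgroup.subset[OF N_sub], of "commutator y z" "z \<otimes> y"] by simp
    then show ?thesis using coset_join2[OF _ N_sub cN] that by simp
  qed
  interpret Q: comm_group ?Q
  proof (rule group.group_comm_groupI[OF Q])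
    fix X Y assume "X \<in> carrier ?Q" "Y \<in> carrier ?Q"
    then obtain y z where "y \<in> carrier G" "X = ?\<pi> y" "z \<in> carrier G" "Y = ?\<pi> z"
      unfolding carrier_FactGroup by blast
    then show "X \<otimes>\<^bsub>?Q\<^esub> Y = Y \<otimes>\<^bsub>?Q\<^esub> X" using \<pi>_comm \<pi>.hom_mult by metis
  qed
  note Q_pow = group.int_pow_closed[OF Q] group.int_pow_pow[OF Q] group.int_pow_mult[OF Q]
    and Q_ac = comm_monoid.m_ac[OF Q.comm_monoid_axioms] monoid.m_closed[OF group.is_monoid[OF Q]]
  \<comment> \<open>Identities that hold only modulo \<open>N\<close> may be read in
    \<open>A\<close>, because \<open>\<tau>\<close> is constant on the cosets of \<open>N\<close>
    there.\<close>
  have transfer: "w \<in> A \<and> \<tau> w = \<tau> w'" if "w \<in> carrier G" "w' \<in> A" "?\<pi> w = ?\<pi> w'" for w w'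
  proof -
    have "w \<in> N #> w'" using rcos_self[OF that(1) N_sub] that(3) by simp
    then obtain n where "n \<in> N" "w = n \<otimes> w'" by (auto simp: r_coset_def)
    then show ?thesis using that(2) A_closed \<tau>_mult by (simp add: N_def)
  qed
  have \<tau>_pow: "\<tau> (a [^] (k::int)) = k * \<tau> a" "a [^] k \<in> A" if "a \<in> A" for a k
    using group.real_hom_int_pow[OF subgroup_imp_group[OF A] \<tau>, of a k] that
      group.int_pow_closed[OF subgroup_imp_group[OF A], of a k] int_pow_consistent[OF A that, of k]
    by simp_all
  \<comment> \<open>\<open>D k q y\<close> lies in \<open>A\<close> exactly when
    \<open>k * g y = q * g x\<close>. An extension of \<open>\<tau>\<close> with value 0 at
    \<open>x\<close> must then send \<open>y\<close> to \<open>\<tau> (D k q y) / k\<close>.\<close>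
  define D where "D k q y = y [^] (k::int) \<otimes> x [^] (- q::int)" for k q y
  have DG: "D k q y \<in> carrier G" if "y \<in> carrier G" for k q y using that x by (simp add: D_def)
  have \<pi>D: "?\<pi> (D k q y) = ?\<pi> y [^]\<^bsub>?Q\<^esub> k \<otimes>\<^bsub>?Q\<^esub> ?\<pi> x [^]\<^bsub>?Q\<^esub> (- q)" if "y \<in> carrier G" for k q y
    using that x by (simp only: D_def \<pi>.hom_mult \<pi>.hom_int_pow int_pow_closed)
  have \<pi>c: "y \<in> carrier G \<Longrightarrow> ?\<pi> y \<in> carrier ?Q" for y by (rule \<pi>.hom_closed)
  have D_scale: "D (k * l) (q * l) y \<in> A \<and> \<tau> (D (k * l) (q * l) y) = l * \<tau> (D k q y)"
    if "y \<in> carrier G" "D k q y \<in> A" for k q l y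
  proof -
    have "?\<pi> (D (k * l) (q * l) y) = ?\<pi> (D k q y) [^]\<^bsub>?Q\<^esub> l"
      unfolding \<pi>D[OF that(1)] using \<pi>c[OF that(1)] \<pi>c[OF x(1)]
      by (simp only: Q.int_pow_distrib Q_pow minus_mult_left)
    also have "\<dots> = ?\<pi> (D k q y [^] l)" using DG[OF that(1)] by (simp only: \<pi>.hom_int_pow)
    finally show ?thesis using transfer[OF DG[OF that(1)] \<tau>_pow(2)[OF that(2)]] \<tau>_pow(1)[OF that(2)] by simp
  qed
  have D_add: "D k (q + p) (y \<otimes> z) \<in> A \<and> \<tau> (D k (q + p) (y \<otimes> z)) = \<tau> (D k q y) + \<tau> (D k p z)"
    if "y \<in> carrier G" "z \<in> carrier G" "D k q y \<in> A" "D k p z \<in> A" for k q p y z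
  proof -
    have yz: "y \<otimes> z \<in> carrier G" using that by simp
    have "?\<pi> (D k (q + p) (y \<otimes> z)) = ?\<pi> (D k q y) \<otimes>\<^bsub>?Q\<^esub> ?\<pi> (D k p z)"
      unfolding \<pi>D[OF yz] \<pi>D[OF that(1)] \<pi>D[OF that(2)] \<pi>.hom_mult[OF that(1,2)]
      using \<pi>c[OF that(1)] \<pi>c[OF that(2)] \<pi>c[OF x(1)]
      by (simp only: Q.int_pow_distrib Q_pow minus_add_distrib Q_ac)
    also have "\<dots> = ?\<pi> (D k q y \<otimes> D k p z)" using DG that by (simp only: \<pi>.hom_mult)
    finally show ?thesis
      using transfer[OF DG[OF yz] A_closed(1)[OF that(3,4)]] \<tau>_mult[OF that(3,4)] by simp
  qed
  have D_unique: "of_int l * \<tau> (D k q y) = of_int k * \<tau> (D l p y)"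
    if y: "y \<in> carrier G" and D: "D k q y \<in> A" "D l p y \<in> A" for k l q p y
  proof -
    have e: "of_int k * g y = of_int q * g x" "of_int l * g y = of_int p * g x"
      using ker[OF DG[OF y]] D y x
      by (simp_all add: D_def real_hom_mult[OF g] real_hom_int_pow[OF g])
    have "of_int l * (of_int q * g x) = of_int k * (of_int p * g x)"
      unfolding e[symmetric] by simp
    then have "of_int (q * l) * g x = of_int (p * k) * g x" by (simp add: ac_simps)
    then have "q * l = p * k" using x(2) by (metis mult_cancel_right of_int_eq_iff)
    then show ?thesis using D_scale[OF y D(1), of l] D_scale[OF y D(2), of k] by (simp add: mult.commute)
  qed
  have D_ex: "\<exists>k q. k > 0 \<and> D k q y \<in> A" if y: "y \<in> carrier G" for y
  proof -
    obtain n :: nat and m :: int where "n > 0" "real n * g y = of_int m * g x"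
      using rank_oneD[OF rank x(1) y x(2)] by blast
    then have "D (int n) m y \<in> A"
      using ker[OF DG[OF y], of "int n" m] y x
      by (simp add: D_def real_hom_mult[OF g] real_hom_int_pow[OF g])
    then show ?thesis using \<open>n > 0\<close> by (intro exI[of _ "int n"] exI[of _ m] conjI) auto
  qed
  define f where "f y = (let (k, q) = (SOME (k, q). k > 0 \<and> D k q y \<in> A) in \<tau> (D k q y) / of_int k)" for y
  have f: "f y = \<tau> (D k q y) / of_int k" if "y \<in> carrier G" "k > 0" "D k q y \<in> A" for y k q
  proof -
    obtain l p where lp: "(SOME (k, q). k > 0 \<and> D k q y \<in> A) = (l, p)" by (cases "SOME (k, q). k > 0 \<and> D k q y \<in> A")
    have "\<exists>c. (\<lambda>(k, q). k > 0 \<and> D k q y \<in> A) c" using that by auto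
    from someI_ex[OF this] have "l > 0" "D l p y \<in> A" unfolding lp by auto
    then show ?thesis using D_unique[OF that(1) that(3), of l p] that(2) lp
      by (simp add: f_def field_simps)
  qed
  have "real_hom G f" unfolding real_hom_def
  proof (intro ballI)
    fix y z assume yz: "y \<in> carrier G" "z \<in> carrier G"
    obtain k q where kq: "k > 0" "D k q y \<in> A" using D_ex[OF yz(1)] by blast
    obtain l p where lp: "l > 0" "D l p z \<in> A" using D_ex[OF yz(2)] by blast
    have 1: "D (k * l) (q * l) y \<in> A" using D_scale[OF yz(1) kq(2)] by blast
    have 2: "D (k * l) (p * k) z \<in> A" using D_scale[OF yz(2) lp(2), of k] by (simp add: mult.commute)
    have kl: "k * l > 0" using kq lp by simp
    have 3: "D (k * l) (q * l + p * k) (y \<otimes> z) \<in> A" using D_add[OF yz 1 2] by blast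
    show "f (y \<otimes> z) = f y + f z"
      using f[OF yz(1) kl 1] f[OF yz(2) kl 2] f[OF m_closed[OF yz] kl 3] D_add[OF yz 1 2]
      by (simp add: add_divide_distrib)
  qed
  moreover have "f a = \<tau> a" if "a \<in> A" for a
    using f[of a 1 0] that AG by (simp add: D_def)
  ultimately show ?thesis by blast
qed

text \<open>If all factors are 1, the extension of \<open>\<tau>\<close> and the homomorphism
  \<open>g\<close> are told apart by \<open>u\<close>; otherwise some element or its inverse acts as
  a contraction.\<close>

theorem uncountable_if_positive_action:
  assumes pos: "\<And>b. b \<in> carrier G \<Longrightarrow> \<mu> b > 0" and rank: "rank_one G g"
    and x: "x \<in> carrier G" "g x \<noteq> 0"
  shows "uncountable (orderings G)"
proof (cases "\<forall>b\<in>carrier G. \<mu> b = 1")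
  case True
  then obtain f where f: "real_hom G f" "\<And>a. a \<in> A \<Longrightarrow> f a = \<tau> a"
    using extend_hom[OF _ rank x] by blast
  show ?thesis
    by (rule uncountable_if_two_homs[OF f(1) g, of u x]) (use u f(2) ker AG x in auto)
next
  case False
  then obtain b where b: "b \<in> carrier G" "\<mu> b \<noteq> 1" by blast
  have "\<exists>b'\<in>carrier G. \<mu> b' < 1"
  proof (cases "\<mu> b < 1")
    case False
    then have "\<mu> b > 1" using b by simp
    then have "\<mu> (inv b) < 1" using \<mu>_inv[OF b(1)] pos[of "inv b"] b(1)
      by (metis inv_closed less_1_mult linorder_neqE mult_1_right not_less_iff_gr_or_eq mult_less_cancel_left)
    then show ?thesis using b by blast
  qed (use b in blast)
  then show ?thesis using uncountable_if_affine_action[OF pos] by blast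
qed

end

section \<open>Tararin's argument and the induction over convex subgroups\<close>

text \<open>If \<open>h\<close> did not vanish at some \<open>a\<close> in the kernel of
  \<open>f\<close>, multiplying an element on the chosen side of \<open>f\<close> by powers of
  \<open>a\<close> would give \<open>h\<close> the wrong sign there. So \<open>h\<close> vanishes on
  the kernel, and rank one makes it proportional to \<open>f\<close>.\<close>

lemma (in group) proportional_if_same_sign:
  assumes f: "real_hom G f" and h: "real_hom G h" and rank: "rank_one G f"
    and u: "u \<in> carrier G" "f u \<noteq> 0"
    and sgn: "d \<noteq> 0" "e \<noteq> 0" "\<And>x. \<lbrakk>x \<in> carrier G; d * f x > 0\<rbrakk> \<Longrightarrow> e * h x \<ge> 0"
    and y: "y \<in> carrier G"
  shows "h y = h u / f u * f y"
proof -
  have ker: "h a = 0" if a: "a \<in> carrier G" "f a = 0" for a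
  proof (rule ccontr)
    assume ha: "h a \<noteq> 0"
    obtain v where v: "v \<in> carrier G" "d * f v > 0"
    proof (cases "d * f u > 0")
      case False
      then have "d * f (inv u) > 0"
        using u sgn(1) real_hom_inv[OF f u(1)] by (simp add: mult_less_0_iff zero_less_mult_iff) linarith
      then show ?thesis using that[of "inv u"] u(1) by simp
    qed (use that u in blast)
    have bound: "e * h v + of_int k * (e * h a) \<ge> 0" for k :: int
    proof -
      have "f (v \<otimes> a [^] k) = f v" "h (v \<otimes> a [^] k) = h v + of_int k * h a"
        using a v by (simp_all add: real_hom_mult[OF f] real_hom_int_pow[OF f] real_hom_mult[OF h]
            real_hom_int_pow[OF h])
      then show ?thesis using sgn(3)[of "v \<otimes> a [^] k"] v a by (simp add: algebra_simps)
    qed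
    obtain n :: nat where n: "e * h v < real n * \<bar>e * h a\<bar>"
      using reals_Archimedean3[of "\<bar>e * h a\<bar>"] ha sgn(2) by auto
    show False
      using bound[of "int n"] bound[of "- int n"] n by (auto simp: abs_if split: if_splits)
  qed
  obtain n :: nat and m :: int where nm: "n > 0" "real n * f y = of_int m * f u"
    using rank_oneD[OF rank u(1) y u(2)] by blast
  let ?a = "y [^] n \<otimes> u [^] (- m)"
  have "f ?a = 0" using nm y u
    by (simp add: real_hom_mult[OF f] real_hom_nat_pow[OF f] real_hom_int_pow[OF f])
  then have "h ?a = 0" using ker y u by simp
  then have hy: "real n * h y = of_int m * h u"
    using y u by (simp add: real_hom_mult[OF h] real_hom_nat_pow[OF h] real_hom_int_pow[OF h])
  have "real n * (h u / f u * f y) = h u / f u * (real n * f y)" by simp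
  also have "\<dots> = of_int m * h u" unfolding nm(2) using u(2) by simp
  finally show ?thesis using hy nm(1) by (metis mult_cancel_left of_nat_eq_0_iff less_irrefl)
qed

text \<open>\<open>tame G\<close> is the inductive invariant: the top convex jump has rank one and is the same for all
  orderings of \<open>G\<close>.\<close>

definition tame :: "('a, 'b) monoid_scheme \<Rightarrow> bool" where
  "tame G \<longleftrightarrow> finite (orderings G) \<and>
     (carrier G = {\<one>\<^bsub>G\<^esub>} \<or>
      (\<exists>f. real_hom G f \<and> (\<exists>u\<in>carrier G. f u \<noteq> 0) \<and> rank_one G f \<and>
        (\<forall>s\<in>orderings G. \<exists>e\<noteq>0. \<forall>x\<in>carrier G. e * f x > 0 \<longrightarrow> (\<one>\<^bsub>G\<^esub>, x) \<in> s)))"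

context jump_action
begin

text \<open>Otherwise \<open>z\<close> lies below some \<open>b\<close> in \<open>A\<close> on the
  positive side of \<open>\<tau>\<close>. The negative factor puts
  \<open>h = inv z \<otimes> b \<otimes> z\<close> on the negative side, so \<open>inv h\<close> is
  positive, and \<open>\<one> \<le> inv z \<otimes> b\<close> then gives
  \<open>\<one> \<le> inv h \<le> inv z\<close>.\<close>

lemma negative_action_beyond:
  assumes e: "e \<noteq> 0" "\<And>a. \<lbrakk>a \<in> A; e * \<tau> a > 0\<rbrakk> \<Longrightarrow> (\<one>, a) \<in> r"
    and z: "z \<in> carrier G" "\<mu> z < 0" "\<one> \<sqsubset> z" and a: "a \<in> A"
  shows "a \<sqsubset> z"
proof (rule ccontr)
  assume "\<not> a \<sqsubset> z"
  then have za: "(z, a) \<in> r" using not_le[of z a] z(1) AG[OF a] by blast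
  obtain v where v: "v \<in> A" "e * \<tau> v > 0"
  proof (cases "e * \<tau> u > 0")
    case False
    then have "e * \<tau> (inv u) > 0"
      using u e(1) \<tau>_inv[OF u(1)] by (simp add: mult_less_0_iff zero_less_mult_iff) linarith
    then show ?thesis using that[of "inv u"] u(1) A_closed(2) by blast
  qed (use that u in blast)
  obtain b where b: "b \<in> A" "e * \<tau> b > 0" "(z, b) \<in> r"
  proof (cases "e * \<tau> a > 0")
    case False
    have "e * \<tau> (inv a \<otimes> v) > 0"
      using False v a by (simp add: \<tau>_mult \<tau>_inv A_closed algebra_simps)
    then have "(\<one>, inv a \<otimes> v) \<in> r" using e(2) v a A_closed by blast
    then have "(a, v) \<in> r" using le_iff[of a v] AG a v by blast
    then show ?thesis using that[of v] v le_trans[OF za] by blast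
  qed (use that a za in blast)
  have bG: "b \<in> carrier G" using b(1) by (rule AG)
  define h where "h = inv z \<otimes> b \<otimes> z"
  have h: "h \<in> A" using conj_closed[of "inv z" b] z(1) b(1) by (simp add: h_def)
  have hG: "h \<in> carrier G" using h by (rule AG)
  have "z \<otimes> h \<otimes> inv z = b" using z(1) bG by (simp add: h_def m_assoc)
  then have "\<tau> b = \<mu> z * \<tau> h" using action[OF z(1) h] by simp
  then have "\<mu> z * (e * \<tau> h) > 0" using b(2) by (simp add: algebra_simps)
  then have "e * \<tau> h < 0" using z(2) by (simp add: zero_less_mult_iff)
  then have "e * \<tau> (inv h) > 0" using \<tau>_inv[OF h] by simp
  then have "(\<one>, inv h) \<in> r" using e(2) A_closed(2)[OF h] by blast
  moreover have "(\<one>, inv z \<otimes> b) \<in> r" using le_iff[of z b] b(3) z(1) bG by blast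
  then have "(inv h, inv h \<otimes> (inv z \<otimes> b)) \<in> r" using mult_ge hG by blast
  moreover have "inv h \<otimes> (inv z \<otimes> b) = inv z"
    using z(1) bG by (simp add: h_def inv_mult_group m_assoc)
  ultimately have "(\<one>, inv z) \<in> r" using le_trans by metis
  then show False using le_inv[OF z(1)] z(3) antisym by blast
qed

text \<open>Negative factors are covered by \<open>negative_action_beyond\<close>. An element
  \<open>y\<close> with positive factor below some element of \<open>A\<close> would have all its
  powers below a positive \<open>x\<close> with negative factor, although by rank one some power of
  \<open>y\<close> agrees with a nontrivial power of \<open>x\<close> modulo
  \<open>A\<close>.\<close>

lemma beyond_if_negative_action:
  assumes e: "e \<noteq> 0" "\<And>a. \<lbrakk>a \<in> A; e * \<tau> a > 0\<rbrakk> \<Longrightarrow> (\<one>, a) \<in> r"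
    and rank: "rank_one G g" and neg: "x \<in> carrier G" "\<mu> x < 0"
    and \<mu>0: "\<And>b. b \<in> carrier G \<Longrightarrow> \<mu> b \<noteq> 0"
    and y: "y \<in> carrier G" "y \<notin> A" "(\<one>, y) \<in> r" and a: "a \<in> A"
  shows "a \<sqsubset> y"
proof (rule ccontr)
  assume "\<not> a \<sqsubset> y"
  then have ya: "(y, a) \<in> r" using not_le[of y a] y(1) AG[OF a] by blast
  have y1: "\<one> \<sqsubset> y" using y subgroup.one_closed[OF A] by auto
  have "\<mu> y > 0"
    using negative_action_beyond[OF e y(1) _ y1 a] \<open>\<not> a \<sqsubset> y\<close> \<mu>0[OF y(1)] by force
  have \<mu>inv: "\<mu> (inv b) < 0 \<longleftrightarrow> \<mu> b < 0" if "b \<in> carrier G" for b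
    using \<mu>_inv[OF that] by (metis mult_less_0_iff not_less_iff_gr_or_eq zero_less_mult_iff zero_less_one)
  have "\<mu> \<one> \<noteq> \<mu> x" using neg(2) \<mu>_one by simp
  then have x1: "x \<noteq> \<one>" by auto
  obtain x where x: "x \<in> carrier G" "\<mu> x < 0" "\<one> \<sqsubset> x"
  proof (cases "(\<one>, x) \<in> r")
    case False
    then show ?thesis using that[of "inv x"] neg \<mu>inv inv_pos by simp
  qed (use that neg x1 in blast)
  have xA: "x \<notin> A" using \<mu>_A x(2) by force
  \<comment> \<open>By induction \<open>inv (y [^] n) \<otimes> x\<close> is positive with negative
    factor, hence beyond \<open>A\<close> and therefore beyond \<open>y\<close>.\<close>
  have ypow: "y [^] (n::nat) \<sqsubset> x \<and> \<mu> (y [^] n) > 0" for n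
  proof (induction n)
    case (Suc n)
    let ?z = "inv (y [^] n) \<otimes> x"
    have "(\<one>, ?z) \<in> r" using le_iff[of "y [^] n" x] Suc x(1) y(1) by auto
    moreover have \<mu>z: "\<mu> ?z < 0"
    proof -
      have "\<mu> (inv (y [^] n)) > 0" using \<mu>_inv[of "y [^] n"] Suc y(1)
        by (metis nat_pow_closed zero_less_mult_pos zero_less_one)
      then show ?thesis using x y(1) by (simp add: \<mu>_mult mult_pos_neg)
    qed
    moreover have "\<one> \<noteq> ?z" using \<mu>z \<mu>_one by auto
    ultimately have "a \<sqsubset> ?z" using negative_action_beyond[OF e, of ?z a] x(1) y(1) a by simp
    then have "y \<sqsubset> ?z" using le_lt_trans[OF ya] by blast
    then have "(y [^] n \<otimes> y, y [^] n \<otimes> ?z) \<in> r" "y [^] n \<otimes> y \<noteq> y [^] n \<otimes> ?z"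
      using mult_le[of y ?z "y [^] n"] x(1) y(1) by (simp_all del: mult_inv_cancel)
    moreover have "y [^] n \<otimes> ?z = x" using x(1) y(1) by simp
    ultimately show ?case using Suc \<open>\<mu> y > 0\<close> y(1) by (simp add: \<mu>_mult)
  qed (use x(3) \<mu>_one in simp)
  have gx: "g x \<noteq> 0" and gy: "g y \<noteq> 0" using ker xA x(1) y by auto
  obtain n :: nat and m :: int where nm: "n > 0" "real n * g y = of_int m * g x"
    using rank_oneD[OF rank x(1) y(1) gx] by blast
  \<comment> \<open>The exponents are doubled so that, for positive \<open>m\<close>, a positive
    power of \<open>x\<close> remains after one factor is split off
    \<open>x [^] (2 * m)\<close>.\<close>
  define b where "b = x [^] (- (2 * m)) \<otimes> y [^] (2 * n)"
  have "g b = 0" using nm(2) x(1) y(1)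
    by (simp add: b_def real_hom_mult[OF g] real_hom_int_pow[OF g] real_hom_nat_pow[OF g])
  then have b: "b \<in> A" using ker[of b] x(1) y(1) by (simp add: b_def)
  have bG: "b \<in> carrier G" using b by (rule AG)
  have ybig: "(\<one>, y [^] (k::nat)) \<in> r" for k using pow_pos y(3) by blast
  have "m \<noteq> 0" using nm gy by auto
  then consider "m < 0" | "m > 0" by linarith
  then show False
  proof cases
    case 1
    define k where "k = nat (- (2 * m))"
    have k: "k > 0" "b = x [^] k \<otimes> y [^] (2 * n)"
      using 1 by (simp_all add: k_def b_def flip: int_pow_int)
    have "(x, x [^] k) \<in> r" using pow_ge[of x k] x(3) k(1) by blast
    moreover have "(x [^] k, b) \<in> r" unfolding k(2) using mult_ge[OF ybig] x(1) by blast
    moreover have "b \<sqsubset> x" using negative_action_beyond[OF e x b] .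
    ultimately show False using le_trans antisym by blast
  next
    case 2
    define k where "k = nat (2 * m - 1)"
    have k: "k > 0" "2 * m = int k + 1" using 2 by (auto simp: k_def)
    have "x [^] (2 * m) = x [^] k \<otimes> x" using k(2) x(1) by (simp add: int_pow_mult int_pow_int)
    moreover have "x [^] (2 * m) \<otimes> b = y [^] (2 * n)"
      using x(1) y(1) by (simp add: b_def int_pow_neg)
    ultimately have y2: "y [^] (2 * n) = x [^] k \<otimes> (x \<otimes> b)" using x(1) bG by (simp add: m_assoc)
    \<comment> \<open>If \<open>x \<otimes> b\<close> were negative, its inverse would be positive
      with negative factor and so lie beyond \<open>inv b\<close>; multiplying by \<open>b\<close>
      would make \<open>inv x\<close> positive.\<close>
    have "(\<one>, x \<otimes> b) \<in> r"
    proof (rule ccontr)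
      assume n: "(\<one>, x \<otimes> b) \<notin> r"
      then have "\<one> \<sqsubset> inv (x \<otimes> b)" using inv_pos x(1) bG by simp
      moreover have "\<mu> (inv (x \<otimes> b)) < 0" using \<mu>inv[of "x \<otimes> b"] x bG b by (simp add: \<mu>_mult \<mu>_A)
      ultimately have "inv b \<sqsubset> inv (x \<otimes> b)"
        using negative_action_beyond[OF e, of "inv (x \<otimes> b)" "inv b"] x(1) bG b A_closed(2) by simp
      then have "(b \<otimes> inv b, b \<otimes> inv (x \<otimes> b)) \<in> r" using mult_le bG by blast
      then have "(\<one>, inv x) \<in> r" using bG x(1) by (simp add: inv_mult_group)
      then show False using le_inv[OF x(1)] x(3) antisym by blast
    qed
    then have "(x [^] k, y [^] (2 * n)) \<in> r" unfolding y2 using mult_ge x(1) by simp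
    moreover have "(x, x [^] k) \<in> r" using pow_ge[of x k] x(3) k(1) by blast
    moreover have "y [^] (2 * n) \<sqsubset> x" using ypow by blast
    ultimately show False using le_trans antisym by blast
  qed
qed

end

text \<open>Suppose \<open>g x\<close> and \<open>g y\<close> have the same sign but
  \<open>inv y\<close> is positive. A product of positive powers of \<open>inv y\<close> and
  \<open>x\<close> then falls into \<open>A\<close>, although it is at least \<open>inv y\<close>,
  which lies beyond \<open>A\<close>.\<close>

lemma (in left_ordered_group) positive_iff_if_beyond:
  assumes A: "subgroup A G" and g: "real_hom G g"
    and ker: "\<And>x. x \<in> carrier G \<Longrightarrow> g x = 0 \<longleftrightarrow> x \<in> A" and rank: "rank_one G g"
    and beyond: "\<And>y a. \<lbrakk>y \<in> carrier G; y \<notin> A; (\<one>, y) \<in> r; a \<in> A\<rbrakk> \<Longrightarrow> a \<sqsubset> y"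
    and x: "x \<in> carrier G" "x \<notin> A" "(\<one>, x) \<in> r" and y: "y \<in> carrier G" "y \<notin> A"
  shows "(\<one>, y) \<in> r \<longleftrightarrow> g x * g y > 0"
proof -
  have *: "(\<one>, y) \<in> r" if y: "y \<in> carrier G" and gxy: "g x * g y > 0" for y
  proof (rule ccontr)
    assume "(\<one>, y) \<notin> r"
    then have y': "\<one> \<sqsubset> inv y" using inv_pos y by blast
    have gx: "g x \<noteq> 0" using ker x by blast
    have yA: "inv y \<notin> A" using ker[of "inv y"] gxy y real_hom_inv[OF g y] by auto
    obtain n :: nat and m :: int where nm: "n > 0" "real n * g y = of_int m * g x"
      using rank_oneD[OF rank x(1) y gx] by blast
    have "of_int m * (g x * g x) = real n * (g x * g y)" using nm(2) by (simp add: algebra_simps)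
    moreover have "real n * (g x * g y) > 0" using nm(1) gxy by simp
    ultimately have "of_int m * (g x * g x) > 0" by linarith
    then have m: "m > 0" using gx by (simp add: zero_less_mult_iff)
    define b where "b = inv y [^] n \<otimes> x [^] nat m"
    have gxm: "g (x [^] nat m) = of_int m * g x" using real_hom_nat_pow[OF g x(1), of "nat m"] m by simp
    have "g b = 0" using nm(2) x(1) y m
      by (simp add: b_def real_hom_mult[OF g] real_hom_inv[OF g] real_hom_nat_pow[OF g] gxm del: pow_nat)
    then have b: "b \<in> A" using ker[of b] x(1) y by (simp add: b_def)
    have "(inv y, inv y [^] n) \<in> r" using pow_ge[of "inv y" n] y' nm(1) by blast
    moreover have "(inv y [^] n, b) \<in> r"
      unfolding b_def using mult_ge[OF pow_pos[OF x(3)]] y by blast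
    moreover have "b \<sqsubset> inv y" using beyond[of "inv y" b] y y' yA b by simp
    ultimately show False using le_trans antisym by blast
  qed
  have "g x * g y \<noteq> 0" using ker x y by simp
  show ?thesis
  proof (cases "g x * g y > 0")
    case False
    then have "g x * g y < 0" using \<open>g x * g y \<noteq> 0\<close> by linarith
    then have "g x * g (inv y) > 0" using real_hom_inv[OF g y(1)] by simp
    then have "(y, \<one>) \<in> r" using *[of "inv y"] y(1) le_inv[OF y(1)] by simp
    then show ?thesis using False antisym[of \<one> y] y(2) subgroup.one_closed[OF A] by blast
  qed (use *[OF y(1)] in simp)
qed

context left_ordered_group
begin

text \<open>Both \<open>Restr r A\<close> and its conjugate by \<open>b\<close> are orderings of \<open>A\<close>, so \<open>\<tau>\<close> is compatible with
  each of them.\<close>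

lemma conj_scale:
  assumes A: "subgroup A G" and normal: "\<And>b a. \<lbrakk>b \<in> carrier G; a \<in> A\<rbrakk> \<Longrightarrow> b \<otimes> a \<otimes> inv b \<in> A"
    and \<tau>: "real_hom (G\<lparr>carrier := A\<rparr>) \<tau>" and rank: "rank_one (G\<lparr>carrier := A\<rparr>) \<tau>"
    and u: "u \<in> A" "\<tau> u \<noteq> 0"
    and compat: "\<And>s. s \<in> orderings (G\<lparr>carrier := A\<rparr>) \<Longrightarrow>
      \<exists>e\<noteq>0. \<forall>a\<in>A. e * \<tau> a > 0 \<longrightarrow> (\<one>, a) \<in> s"
    and b: "b \<in> carrier G"
  shows "\<exists>m\<noteq>0. \<forall>a\<in>A. \<tau> (b \<otimes> a \<otimes> inv b) = m * \<tau> a"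
proof -
  let ?A = "G\<lparr>carrier := A\<rparr>"
  have AG: "a \<in> carrier G" if "a \<in> A" for a using that subgroup.subset[OF A] by blast
  interpret A: group ?A using A by (rule subgroup_imp_group)
  obtain e where e: "e \<noteq> 0" "\<forall>a\<in>A. e * \<tau> a > 0 \<longrightarrow> (\<one>, a) \<in> Restr r A"
    using compat[OF Restr_in_orderings[OF A]] by blast
  interpret b: left_ordered_group G "right_translate G (inv b) r"
    using right_translate_in_orderings[OF ord, of "inv b"] b by unfold_locales simp
  obtain d where d: "d \<noteq> 0" "\<forall>a\<in>A. d * \<tau> a > 0 \<longrightarrow> (\<one>, a) \<in> Restr (right_translate G (inv b) r) A"
    using compat[OF b.Restr_in_orderings[OF A]] by blast
  have hom: "real_hom ?A (\<lambda>a. \<tau> (b \<otimes> a \<otimes> inv b))"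
    unfolding real_hom_def
  proof (intro ballI)
    fix x y assume "x \<in> carrier ?A" "y \<in> carrier ?A"
    then have xy: "x \<in> A" "y \<in> A" by simp_all
    have "b \<otimes> (x \<otimes> y) \<otimes> inv b = (b \<otimes> x \<otimes> inv b) \<otimes> (b \<otimes> y \<otimes> inv b)"
      using xy AG b by (simp add: m_assoc)
    then show "\<tau> (b \<otimes> (x \<otimes>\<^bsub>?A\<^esub> y) \<otimes> inv b) = \<tau> (b \<otimes> x \<otimes> inv b) + \<tau> (b \<otimes> y \<otimes> inv b)"
      using real_hom_mult[OF \<tau>, of "b \<otimes> x \<otimes> inv b" "b \<otimes> y \<otimes> inv b"] normal[OF b] xy by simp
  qed
  have sgn: "e * \<tau> (b \<otimes> a \<otimes> inv b) \<ge> 0" if a: "a \<in> A" "d * \<tau> a > 0" for a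
  proof (rule ccontr)
    let ?w = "b \<otimes> a \<otimes> inv b"
    assume neg: "\<not> e * \<tau> ?w \<ge> 0"
    have w: "?w \<in> A" by (rule normal[OF b a(1)])
    have i: "inv\<^bsub>?A\<^esub> ?w = inv ?w" using A w by simp
    have iw: "inv ?w \<in> A" using A w by (rule subgroup.m_inv_closed)
    have "\<tau> (inv ?w) = - \<tau> ?w" using A.real_hom_inv[OF \<tau>, of ?w] w unfolding i by simp
    then have "(\<one>, inv ?w) \<in> r" using e(2) iw neg by auto
    then have le: "(?w, \<one>) \<in> r" using le_inv AG[OF w] by blast
    have "(inv b, a \<otimes> inv b) \<in> r" using d(2) a b AG by (auto simp: right_translate_def)
    then have "(\<one>, ?w) \<in> r" using mult_le[of "inv b" "a \<otimes> inv b" b] b AG[OF a(1)] by (simp add: m_assoc)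
    then have "?w = \<one>" using le antisym by blast
    then show False using neg A.real_hom_one[OF \<tau>] by simp
  qed
  define m where "m = \<tau> (b \<otimes> u \<otimes> inv b) / \<tau> u"
  have m: "\<tau> (b \<otimes> a \<otimes> inv b) = m * \<tau> a" if "a \<in> A" for a
    unfolding m_def
    using A.proportional_if_same_sign[OF \<tau> hom rank, of u d e a] u d(1) e(1) sgn that by simp
  \<comment> \<open>Conjugation by \<open>b\<close> sends this element to \<open>u\<close>, so the
    factor cannot vanish.\<close>
  let ?v = "inv b \<otimes> u \<otimes> inv (inv b)"
  have "?v \<in> A" using normal[of "inv b" u] b u by simp
  moreover have "b \<otimes> ?v \<otimes> inv b = u" using b AG[OF u(1)] by (simp add: m_assoc)
  ultimately have "\<tau> u = m * \<tau> ?v" using m[of ?v] by simp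
  then have "m \<noteq> 0" using u(2) by auto
  then show ?thesis using m by blast
qed

text \<open>The ordering \<open>r\<close> serves to find \<open>g\<close> and the factors;
  \<open>beyond\<close>, \<open>positive_iff\<close> and \<open>compat\<close> are then claims about
  an arbitrary ordering \<open>s\<close> of the group.\<close>

lemma tame_convex_step:
  assumes A: "convex_subgroup A" and A_ne: "A \<noteq> carrier G"
    and maximal: "\<And>D. \<lbrakk>convex_subgroup D; A \<subseteq> D\<rbrakk> \<Longrightarrow> D = A \<or> D = carrier G"
    and virt: "\<And>b. b \<in> carrier G \<Longrightarrow> \<exists>n>0. \<forall>x\<in>carrier G. \<forall>y\<in>carrier G.
      (x \<otimes> b [^] (n::nat), y \<otimes> b [^] n) \<in> r \<longleftrightarrow> (x, y) \<in> r"
    and cnt: "countable (orderings G)" and tame: "tame (G\<lparr>carrier := A\<rparr>)"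
  shows "tame G"
proof -
  let ?A = "G\<lparr>carrier := A\<rparr>"
  note subA = convex_subgroupD(1)[OF A]
  have AG: "a \<in> carrier G" if "a \<in> A" for a using that convex_subgroupD(2)[OF A] by blast
  obtain g where g: "real_hom G g" and ker: "\<And>x. x \<in> carrier G \<Longrightarrow> g x = 0 \<longleftrightarrow> x \<in> A"
    using jump_hom[OF A A_ne maximal virt] by metis
  have rank: "rank_one G g" by (rule rank_one_if_countable[OF cnt g])
  obtain x0 where x0: "x0 \<in> carrier G" "x0 \<notin> A" using A_ne convex_subgroupD(2)[OF A] by blast
  have gx0: "g x0 \<noteq> 0" using ker x0 by simp
  have normal: "b \<otimes> a \<otimes> inv b \<in> A" if "b \<in> carrier G" "a \<in> A" for b a
    using ker[of "b \<otimes> a \<otimes> inv b"] ker[of a] AG[of a] that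
    by (simp add: real_hom_mult[OF g] real_hom_inv[OF g])
  have beyond: "a \<noteq> y \<and> (a, y) \<in> s"
    if s: "s \<in> orderings G" and y: "y \<in> carrier G" "y \<notin> A" "(\<one>, y) \<in> s" and a: "a \<in> A" for s y a
  proof (cases "A = {\<one>}")
    case True
    then show ?thesis using y a by auto
  next
    case False
    then have "carrier ?A \<noteq> {\<one>\<^bsub>?A\<^esub>}" by simp
    then obtain \<tau> u where \<tau>: "real_hom ?A \<tau>" "rank_one ?A \<tau>" and u: "u \<in> A" "\<tau> u \<noteq> 0"
      and compat: "\<And>s. s \<in> orderings ?A \<Longrightarrow> \<exists>e\<noteq>0. \<forall>a\<in>A. e * \<tau> a > 0 \<longrightarrow> (\<one>, a) \<in> s"
      using tame unfolding tame_def by auto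
    have "\<forall>b\<in>carrier G. \<exists>m. m \<noteq> 0 \<and> (\<forall>a\<in>A. \<tau> (b \<otimes> a \<otimes> inv b) = m * \<tau> a)"
      using conj_scale[OF subA normal \<tau> u compat] by blast
    then obtain \<mu> where \<mu>: "\<And>b. b \<in> carrier G \<Longrightarrow> \<mu> b \<noteq> 0"
      "\<And>b a. \<lbrakk>b \<in> carrier G; a \<in> A\<rbrakk> \<Longrightarrow> \<tau> (b \<otimes> a \<otimes> inv b) = \<mu> b * \<tau> a"
      by metis
    have ja: "jump_action_axioms G A g \<tau> \<mu> u"
      unfolding jump_action_axioms_def using subA g ker \<tau>(1) \<mu>(2) u by blast
    interpret jump_action G r A g \<tau> \<mu> u
      using left_ordered_group_axioms ja by (rule jump_action.intro)
    \<comment> \<open>Countability excludes an action by positive factors only, which opens the way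
      to Tararin's argument.\<close>
    have "\<not> (\<forall>b\<in>carrier G. \<mu> b > 0)"
      using uncountable_if_positive_action[OF _ rank x0(1) gx0] cnt by blast
    then obtain x where x: "x \<in> carrier G" "\<mu> x < 0" using \<mu>(1) by (meson linorder_neqE)
    interpret s: left_ordered_group G s by unfold_locales (rule s)
    interpret s: jump_action G s A g \<tau> \<mu> u
      using s.left_ordered_group_axioms ja by (rule jump_action.intro)
    obtain e where e: "e \<noteq> 0" "\<And>a. \<lbrakk>a \<in> A; e * \<tau> a > 0\<rbrakk> \<Longrightarrow> (\<one>, a) \<in> s"
      using compat[OF s.Restr_in_orderings[OF subA]] by blast
    show ?thesis using s.beyond_if_negative_action[OF e rank x \<mu>(1) y a] by blast
  qed
  have positive_iff: "(\<one>, y) \<in> s \<longleftrightarrow> g x * g y > 0"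
    if s: "s \<in> orderings G" and x: "x \<in> carrier G" "x \<notin> A" "(\<one>, x) \<in> s"
      and y: "y \<in> carrier G" "y \<notin> A" for s x y
  proof -
    interpret s: left_ordered_group G s by unfold_locales (rule s)
    show ?thesis using s.positive_iff_if_beyond[OF subA g ker rank _ x y] beyond[OF s] by blast
  qed
  have compat: "\<exists>e\<noteq>0. \<forall>y\<in>carrier G. e * g y > 0 \<longrightarrow> (\<one>, y) \<in> s" if s: "s \<in> orderings G" for s
  proof -
    interpret s: left_ordered_group G s by unfold_locales (rule s)
    obtain x where x: "x \<in> carrier G" "x \<notin> A" "(\<one>, x) \<in> s"
    proof (cases "(\<one>, x0) \<in> s")
      case False
      then show ?thesis using that[of "inv x0"] x0 s.inv_pos subgroup_inv_iff[OF subA] by simp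
    qed (use that x0 in blast)
    have "(\<one>, y) \<in> s" if y: "y \<in> carrier G" "g x * g y > 0" for y
    proof -
      have "y \<notin> A" using ker[OF y(1)] y(2) by auto
      then show ?thesis using positive_iff[OF s x y(1)] y(2) by blast
    qed
    moreover have "g x \<noteq> 0" using ker x by simp
    ultimately show ?thesis by blast
  qed
  \<comment> \<open>The sign of \<open>x0\<close> fixes all signs outside \<open>A\<close> through
    \<open>g\<close>, so an ordering is its restriction to \<open>A\<close> plus one bit.\<close>
  have "inj_on (\<lambda>s. (Restr s A, (\<one>, x0) \<in> s)) (orderings G)"
  proof (rule inj_onI)
    fix s t assume s: "s \<in> orderings G" and t: "t \<in> orderings G"
      and eq: "(Restr s A, (\<one>, x0) \<in> s) = (Restr t A, (\<one>, x0) \<in> t)"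
    interpret s: left_ordered_group G s by unfold_locales (rule s)
    interpret t: left_ordered_group G t by unfold_locales (rule t)
    obtain x where x: "x \<in> carrier G" "x \<notin> A" "(\<one>, x) \<in> s" "(\<one>, x) \<in> t"
    proof (cases "(\<one>, x0) \<in> s")
      case False
      then have "(\<one>, inv x0) \<in> s" "(\<one>, inv x0) \<in> t" using eq s.inv_pos t.inv_pos x0 by auto
      then show ?thesis using that[of "inv x0"] x0 subgroup_inv_iff[OF subA] by simp
    qed (use that x0 eq in blast)
    show "s = t"
    proof (rule s.eq_if_positive_eq[OF t])
      fix y assume y: "y \<in> carrier G"
      show "(\<one>, y) \<in> s \<longleftrightarrow> (\<one>, y) \<in> t"
      proof (cases "y \<in> A")
        case True
        then have "(\<one>, y) \<in> Restr s A \<longleftrightarrow> (\<one>, y) \<in> Restr t A" using eq by simp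
        then show ?thesis using True convex_subgroupD(3)[OF A] by simp
      next
        case False
        then show ?thesis using positive_iff[OF s x(1,2,3) y] positive_iff[OF t x(1,2,4) y] by blast
      qed
    qed
  qed
  moreover have "(\<lambda>s. (Restr s A, (\<one>, x0) \<in> s)) ` orderings G \<subseteq> orderings ?A \<times> UNIV"
    using left_ordered_group.Restr_in_orderings[OF _ subA] is_group
    by (auto simp: left_ordered_group_def left_ordered_group_axioms_def)
  moreover have "finite (orderings ?A \<times> (UNIV :: bool set))" using tame by (simp add: tame_def)
  ultimately have "finite (orderings G)" by (rule inj_on_finite)
  then show ?thesis unfolding tame_def using g rank x0(1) gx0 compat by blast
qed

section \<open>Induction along the chain of convex subgroups\<close>

lemma convex_subgroup_trans:
  assumes C: "convex_subgroup C"
    and D: "left_ordered_group.convex_subgroup (G\<lparr>carrier := C\<rparr>) (Restr r C) D"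
  shows "convex_subgroup D" "D \<subseteq> C"
proof -
  note sub = convex_subgroupD(1)[OF C]
  interpret C: left_ordered_group "G\<lparr>carrier := C\<rparr>" "Restr r C"
    using sub by (rule left_ordered_subgroup)
  show DC: "D \<subseteq> C" using C.convex_subgroupD(2)[OF D] by simp
  have "subgroup D G" using incl_subgroup[OF sub C.convex_subgroupD(1)[OF D]] .
  moreover have "x \<in> D" if "(\<one>, x) \<in> r" "(x, y) \<in> r" "y \<in> D" for x y
  proof -
    have "x \<in> C" using convex_subgroupD(6)[OF C that(1,2)] that(3) DC by blast
    then show ?thesis
      using C.convex_subgroupD(6)[OF D, of x y] that DC convex_subgroupD(3)[OF C] by auto
  qed
  ultimately show "convex_subgroup D" by (auto simp: convex_subgroup_def)
qed

lemma convex_subgroup_restrict: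
  assumes C: "convex_subgroup C" and D: "convex_subgroup D" "D \<subseteq> C"
  shows "left_ordered_group.convex_subgroup (G\<lparr>carrier := C\<rparr>) (Restr r C) D"
proof -
  interpret C: left_ordered_group "G\<lparr>carrier := C\<rparr>" "Restr r C"
    using convex_subgroupD(1)[OF C] by (rule left_ordered_subgroup)
  have "subgroup D (G\<lparr>carrier := C\<rparr>)"
    using subgroup_incl[OF convex_subgroupD(1)[OF D(1)] convex_subgroupD(1)[OF C] D(2)] .
  then show ?thesis using convex_subgroupD(6)[OF D(1)] by (auto simp: C.convex_subgroup_def)
qed

text \<open>Finiteness of the chain provides a maximal proper convex subgroup at each stage and
  makes the induction end. The condition on powers descends to \<open>C\<close>, as powers of
  elements of \<open>C\<close> stay in \<open>C\<close>.\<close>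

lemma tame_if_virtually_right_invariant:
  assumes cnt: "countable (orderings G)"
    and virt: "\<And>b. b \<in> carrier G \<Longrightarrow> \<exists>n>0. \<forall>x\<in>carrier G. \<forall>y\<in>carrier G.
      (x \<otimes> b [^] (n::nat), y \<otimes> b [^] n) \<in> r \<longleftrightarrow> (x, y) \<in> r"
    and C: "convex_subgroup C"
  shows "tame (G\<lparr>carrier := C\<rparr>)"
  using C
proof (induction "card {D. convex_subgroup D \<and> D \<subset> C}" arbitrary: C rule: less_induct)
  case less
  note C = less.prems
  let ?C = "G\<lparr>carrier := C\<rparr>"
  let ?S = "\<lambda>C. {D. convex_subgroup D \<and> D \<subset> C}"
  have fin: "finite (?S C)" for C by (rule finite_subset[OF _ finite_convex_subgroups[OF cnt]]) blast
  show ?case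
  proof (cases "C = {\<one>}")
    case True
    have "orderings ?C \<subseteq> Pow (carrier ?C \<times> carrier ?C)" using orderings_subset by blast
    then have "finite (orderings ?C)" using True by (auto intro: finite_subset)
    then show ?thesis using True by (simp add: tame_def)
  next
    case False
    then have "{\<one>} \<in> ?S C" using convex_subgroup_one convex_subgroupD(3)[OF C] by auto
    then obtain A where A: "A \<in> ?S C" and max: "\<And>D. D \<in> ?S C \<Longrightarrow> A \<subseteq> D \<Longrightarrow> A = D"
      using finite_has_maximal[OF fin, of C] by auto
    have "?S A \<subset> ?S C" using A by blast
    then have "card (?S A) < card (?S C)" by (rule psubset_card_mono[OF fin])
    then have tame: "tame (G\<lparr>carrier := A\<rparr>)" using less.hyps A by blast
    interpret C: left_ordered_group ?C "Restr r C"
      using convex_subgroupD(1)[OF C] by (rule left_ordered_subgroup)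
    show ?thesis
    proof (rule C.tame_convex_step)
      show "C.convex_subgroup A" using convex_subgroup_restrict[OF C] A by blast
      show "A \<noteq> carrier ?C" using A by auto
      show "D = A \<or> D = carrier ?C" if "C.convex_subgroup D" "A \<subseteq> D" for D
        using max[of D] convex_subgroup_trans[OF C that(1)] that(2) by auto
      show "countable (orderings ?C)" by (rule countable_orderings_convex_subgroup[OF C cnt])
      show "tame (?C\<lparr>carrier := A\<rparr>)" using tame by simp
      fix b assume "b \<in> carrier ?C"
      then have b: "b \<in> C" "b \<in> carrier G" using convex_subgroupD(2)[OF C] by auto
      obtain n :: nat where n: "n > 0" "\<forall>x\<in>carrier G. \<forall>y\<in>carrier G.
          (x \<otimes> b [^] n, y \<otimes> b [^] n) \<in> r \<longleftrightarrow> (x, y) \<in> r" using virt[OF b(2)] by blast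
      have bn: "b [^]\<^bsub>?C\<^esub> n = b [^] n" by (simp flip: nat_pow_consistent)
      have "b [^] n \<in> C" using C.nat_pow_closed[of b n] b(1) bn by simp
      then show "\<exists>n>0. \<forall>x\<in>carrier ?C. \<forall>y\<in>carrier ?C.
          (x \<otimes>\<^bsub>?C\<^esub> b [^]\<^bsub>?C\<^esub> (n::nat), y \<otimes>\<^bsub>?C\<^esub> b [^]\<^bsub>?C\<^esub> n) \<in> Restr r C \<longleftrightarrow> (x, y) \<in> Restr r C"
        using n convex_subgroupD(2,4)[OF C] by (intro exI[of _ n]) (auto simp: bn subset_iff)
    qed
  qed
qed

end

theorem (in group) finite_orderings_if_countable:
  assumes cnt: "countable (orderings G)"
  shows "finite (orderings G)"
proof (cases "orderings G = {}")
  case False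
  then obtain r where r: "r \<in> orderings G" and virt: "\<forall>b\<in>carrier G. \<exists>n>0. \<forall>x\<in>carrier G. \<forall>y\<in>carrier G.
      (x \<otimes> b [^] (n::nat), y \<otimes> b [^] n) \<in> r \<longleftrightarrow> (x, y) \<in> r"
    using exists_virtually_right_invariant_ordering[OF cnt] by blast
  interpret left_ordered_group G r by unfold_locales (rule r)
  have "tame (G\<lparr>carrier := carrier G\<rparr>)"
    using tame_if_virtually_right_invariant[OF cnt _ convex_subgroup_carrier] virt by blast
  then show ?thesis by (simp add: tame_def)
qed simp

theorem theoremC:
  fixes G :: "('a, 'b) monoid_scheme"
  assumes "group G"
    and "countable (carrier G)"
    and "orderable G"
  shows "finite (orderings G) \<or>
    (\<exists>S \<subseteq> topspace (space_of_orderings G).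
       subtopology (space_of_orderings G) S homeomorphic_space top_of_set cantor_set)"
proof (cases "countable (orderings G)")
  case True
  then show ?thesis using group.finite_orderings_if_countable[OF assms(1)] by blast
next
  case False
  then show ?thesis using uncountable_orderings_contains_cantor_set[OF assms(2)] by blast
qed

end
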